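(* Let $C$ be the group with generators $u_1,\dots,u_{27}$ and relations (R1)–(R4) below, and let $\psi_C\colon C\to S_{18}$ be the homomorphism sending $u_j$ to the transposition $(\alpha\,\beta)$, where $\{\alpha,\beta\}$ is the pair of endpoints of edge $j$ of $T$. Then: (i) $\psi_C$ is surjective. The subgroup $\langle u_j : j\in T_0\rangle$, where $T_0=\{5,6,8,9,11,12,14,16,18,19,20,21,22,24,25,26,27\}$ is a spanning tree of $T$, is mapped isomorphically onto $S_{18}$ by $\psi_C$. Hence $C=S_{18}\ltimes K_C$ with $K_C=\ker\psi_C$. (ii) Let $H$ be the group generated by $x_1,\dots,x_{18},y_1,\dots,y_{18},z$ with relations $[x_i,x_j]=[y_i,y_j]=[x_i,y_j]=1$ for all $i\neq j$, $[x_i,y_i]=z$ for all $i$, and $z$ central. Let $\mathrm{ab}\colon H\to\mathbb{Z}^2=\langle x\rangle\times\langle y\rangle$ be given by $x_i\mapsto x$, $y_i\mapsto y$, $z\mapsto 1$. Then $K_C\cong\ker(\mathrm{ab})$. Moreover $C\cong S_{18}\ltimes\ker(\mathrm{ab})$, where $\sigma\in S_{18}$ acts by $x_i\mapsto x_{\sigma(i)}$, $y_i\mapsto y_{\sigma(i)}$, $z\mapsto z$, and under this isomorphism $\psi_C$ corresponds to the projection onto $S_{18}$. (iii) In particular, $K_C$ is a central extension of $\mathbb{Z}^{34}$ by $\mathbb{Z}=\langle z\rangle$, and the center of $C$ is the infinite cyclic group $\langle z\rangle$.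
   Context: Let $T$ be the graph with vertex set $\{1,\dots,18\}$ and 27 edges labelled $1,\dots,27$. Edge $j$ joins the two vertices listed after it: 1:$\{2,7\}$, 2:$\{1,13\}$, 3:$\{4,9\}$, 4:$\{1,3\}$, 5:$\{1,5\}$, 6:$\{2,3\}$, 7:$\{2,6\}$, 8:$\{3,10\}$, 9:$\{4,6\}$, 10:$\{4,5\}$, 11:$\{5,8\}$, 12:$\{6,14\}$, 13:$\{7,15\}$, 14:$\{7,11\}$, 15:$\{8,12\}$, 16:$\{8,16\}$, 17:$\{9,11\}$, 18:$\{9,17\}$, 19:$\{10,12\}$, 20:$\{10,18\}$, 21:$\{11,12\}$, 22:$\{13,15\}$, 23:$\{13,17\}$, 24:$\{14,18\}$, 25:$\{14,16\}$, 26:$\{15,16\}$, 27:$\{17,18\}$. (Geometrically, the vertices of $T$ are the 18 planes and the edges are the 27 intersection lines of a degeneration of $\mathbb{T}\times\mathbb{T}$, for $\mathbb{T}$ a complex torus, into a union of planes. This triangulates a torus with 9 vertices $V_1,\dots,V_9$, each lying on 6 lines.) Nine hexagons in $T$ are given by ordered 6-tuples of edges $(a_r,b_r,c_r,d_r,e_r,f_r)$, $r=1,\dots,9$: $V_1$: $(2,4,6,1,13,22)$; $V_2$: $(1,7,9,3,17,14)$; $V_3$: $(3,10,5,2,23,18)$; $V_4$: $(11,15,19,8,4,5)$; $V_5$: $(8,20,24,12,7,6)$; $V_6$: $(12,25,16,11,10,9)$; $V_7$: $(26,13,14,21,15,16)$; $V_8$: $(21,17,18,27,20,19)$; $V_9$: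 $(27,23,22,26,25,24)$. In each tuple, cyclically consecutive edges share an endpoint, so the six edges form a 6-cycle in $T$. The group $C$ is generated by $u_1,\dots,u_{27}$ with the relations: (R1) $u_j^2=1$ for all $j$; (R2) $u_iu_j=u_ju_i$ whenever edges $i$ and $j$ have no common endpoint; (R3) $u_iu_ju_i=u_ju_iu_j$ whenever $i\neq j$ and edges $i,j$ share an endpoint; (R4) for each $r=1,\dots,9$: $u_{a_r}u_{b_r}u_{c_r}u_{d_r}u_{e_r}=u_{b_r}u_{c_r}u_{d_r}u_{e_r}u_{f_r}$. *)

theory Defs
  imports "HOL-Algebra.Algebra" "HOL-Combinatorics.Transposition"
begin

text \<open>A word is a list of letters (a, True) = generator a, (a, False) = its inverse.\<close>
type_synonym 'a word = "('a \<times> bool) list"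

definition wordS :: "'a set \<Rightarrow> 'a word \<Rightarrow> bool" where
  "wordS S w \<longleftrightarrow> fst ` set w \<subseteq> S"

definition inv_word :: "'a word \<Rightarrow> 'a word" where
  "inv_word w = rev (map (\<lambda>(a, b). (a, \<not> b)) w)"

definition eq_rel :: "'a word \<Rightarrow> 'a word \<Rightarrow> 'a word" where
  "eq_rel l r = l @ inv_word r"

inductive pres_rel :: "'a set \<Rightarrow> 'a word set \<Rightarrow> 'a word \<Rightarrow> 'a word \<Rightarrow> bool"
  for S R where
  refl: "wordS S w \<Longrightarrow> pres_rel S R w w"
| sym: "pres_rel S R v w \<Longrightarrow> pres_rel S R w v"
| trans: "pres_rel S R u v \<Longrightarrow> pres_rel S R v w \<Longrightarrow> pres_rel S R u w"
| cancel: "wordS S xs \<Longrightarrow> wordS S ys \<Longrightarrow> a \<in> S \<Longrightarrow>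
           pres_rel S R (xs @ [(a, b), (a, \<not> b)] @ ys) (xs @ ys)"
| relator: "r \<in> R \<Longrightarrow> wordS S r \<Longrightarrow> wordS S xs \<Longrightarrow> wordS S ys \<Longrightarrow>
           pres_rel S R (xs @ r @ ys) (xs @ ys)"

definition pres_class :: "'a set \<Rightarrow> 'a word set \<Rightarrow> 'a word \<Rightarrow> 'a word set" where
  "pres_class S R w = {v. pres_rel S R w v}"

definition presented_group :: "'a set \<Rightarrow> 'a word set \<Rightarrow> 'a word set monoid" where
  "presented_group S R =
     \<lparr> carrier = pres_class S R ` {w. wordS S w},
       monoid.mult = (\<lambda>A B. {v. \<exists>a\<in>A. \<exists>b\<in>B. pres_rel S R (a @ b) v}),
       one = pres_class S R [] \<rparr>"

definition pgen :: "'a set \<Rightarrow> 'a word set \<Rightarrow> 'a \<Rightarrow> 'a word set" where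
  "pgen S R a = pres_class S R [(a, True)]"

definition edge_list :: "(nat \<times> nat) list" where
  "edge_list = [(2,7),(1,13),(4,9),(1,3),(1,5),(2,3),(2,6),(3,10),(4,6),(4,5),(5,8),(6,14),
     (7,15),(7,11),(8,12),(8,16),(9,11),(9,17),(10,12),(10,18),(11,12),(13,15),(13,17),
     (14,18),(14,16),(15,16),(17,18)]"

text \<open>Endpoints of edge j (1 <= j <= 27).\<close>
definition edgeT :: "nat \<Rightarrow> nat set" where
  "edgeT j = {fst (edge_list ! (j - 1)), snd (edge_list ! (j - 1))}"

definition eA :: "nat \<Rightarrow> nat" where "eA j = fst (edge_list ! (j - 1))"
definition eB :: "nat \<Rightarrow> nat" where "eB j = snd (edge_list ! (j - 1))"

definition hexagons :: "(nat \<times> nat \<times> nat \<times> nat \<times> nat \<times> nat) list" where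
  "hexagons = [(2,4,6,1,13,22),(1,7,9,3,17,14),(3,10,5,2,23,18),(11,15,19,8,4,5),
     (8,20,24,12,7,6),(12,25,16,11,10,9),(26,13,14,21,15,16),(21,17,18,27,20,19),
     (27,23,22,26,25,24)]"

definition gC :: "nat \<Rightarrow> (nat \<times> bool)" where "gC j = (j, True)"

definition relC :: "nat word set" where
  "relC =
     {[gC j, gC j] | j. j \<in> {1..27}}
   \<union> {eq_rel [gC i, gC j] [gC j, gC i] | i j.
        i \<in> {1..27} \<and> j \<in> {1..27} \<and> edgeT i \<inter> edgeT j = {}}
   \<union> {eq_rel [gC i, gC j, gC i] [gC j, gC i, gC j] | i j.
        i \<in> {1..27} \<and> j \<in> {1..27} \<and> i \<noteq> j \<and> edgeT i \<inter> edgeT j \<noteq> {}}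
   \<union> {eq_rel [gC a, gC b, gC c, gC d, gC e] [gC b, gC c, gC d, gC e, gC f] | a b c d e f.
        (a, b, c, d, e, f) \<in> set hexagons}"

definition C_grp :: "nat word set monoid" where
  "C_grp = presented_group {1..27} relC"

definition uC :: "nat \<Rightarrow> nat word set" where
  "uC j = pgen {1..27} relC j"

definition is_psiC :: "(nat word set \<Rightarrow> (nat \<Rightarrow> nat)) \<Rightarrow> bool" where
  "is_psiC \<psi> \<longleftrightarrow> \<psi> \<in> hom C_grp (sym_group 18) \<and>
      (\<forall>j\<in>{1..27}. \<psi> (uC j) = transpose (eA j) (eB j))"

definition T0 :: "nat set" where
  "T0 = {5,6,8,9,11,12,14,16,18,19,20,21,22,24,25,26,27}"

datatype hgen = HX nat | HY nat | HZ

definition SH :: "hgen set" where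
  "SH = HX ` {1..18} \<union> HY ` {1..18} \<union> {HZ}"

definition comm_word :: "'a \<Rightarrow> 'a \<Rightarrow> 'a word" where
  "comm_word a b = [(a, True), (b, True), (a, False), (b, False)]"

definition relH :: "hgen word set" where
  "relH =
     {comm_word (HX i) (HX j) | i j. i \<in> {1..18} \<and> j \<in> {1..18} \<and> i \<noteq> j}
   \<union> {comm_word (HY i) (HY j) | i j. i \<in> {1..18} \<and> j \<in> {1..18} \<and> i \<noteq> j}
   \<union> {comm_word (HX i) (HY j) | i j. i \<in> {1..18} \<and> j \<in> {1..18} \<and> i \<noteq> j}
   \<union> {eq_rel (comm_word (HX i) (HY i)) [(HZ, True)] | i. i \<in> {1..18}}
   \<union> {comm_word HZ g | g. g \<in> SH}"

definition H_grp :: "hgen word set monoid" where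
  "H_grp = presented_group SH relH"

definition xH :: "nat \<Rightarrow> hgen word set" where "xH i = pgen SH relH (HX i)"
definition yH :: "nat \<Rightarrow> hgen word set" where "yH i = pgen SH relH (HY i)"
definition zH :: "hgen word set" where "zH = pgen SH relH HZ"

definition Z2 :: "(int \<times> int) monoid" where
  "Z2 = \<lparr> carrier = UNIV, monoid.mult = (\<lambda>(a, b) (c, d). (a + c, b + d)), one = (0, 0) \<rparr>"

definition Zn :: "nat \<Rightarrow> (nat \<Rightarrow> int) monoid" where
  "Zn n = \<lparr> carrier = {f. \<forall>i\<ge>n. f i = 0}, monoid.mult = (\<lambda>f g i. f i + g i), one = (\<lambda>_. 0) \<rparr>"

definition is_ab :: "(hgen word set \<Rightarrow> int \<times> int) \<Rightarrow> bool" where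
  "is_ab ab \<longleftrightarrow> ab \<in> hom H_grp Z2 \<and>
     (\<forall>i\<in>{1..18}. ab (xH i) = (1, 0) \<and> ab (yH i) = (0, 1)) \<and> ab zH = (0, 0)"

fun hrelabel :: "(nat \<Rightarrow> nat) \<Rightarrow> hgen \<Rightarrow> hgen" where
  "hrelabel \<sigma> (HX i) = HX (\<sigma> i)"
| "hrelabel \<sigma> (HY i) = HY (\<sigma> i)"
| "hrelabel \<sigma> HZ = HZ"

definition hact :: "(nat \<Rightarrow> nat) \<Rightarrow> hgen word set \<Rightarrow> hgen word set" where
  "hact \<sigma> A = {v. \<exists>w\<in>A. pres_rel SH relH (map (\<lambda>(g, b). (hrelabel \<sigma> g, b)) w) v}"

text \<open>G semidirect N with G acting on N by phi; the pair (g,n) stands for n g, so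
  (g,n)(g',n') = (g g', n phi_g(n')). The first projection is the projection onto G.\<close>
definition sdprod :: "('a, 'c) monoid_scheme \<Rightarrow> ('b, 'd) monoid_scheme \<Rightarrow> ('a \<Rightarrow> 'b \<Rightarrow> 'b)
    \<Rightarrow> ('a \<times> 'b) monoid" where
  "sdprod G N \<phi> = \<lparr> carrier = carrier G \<times> carrier N,
      monoid.mult = (\<lambda>(g, n) (g', n'). (g \<otimes>\<^bsub>G\<^esub> g', n \<otimes>\<^bsub>N\<^esub> \<phi> g n')),
      one = (\<one>\<^bsub>G\<^esub>, \<one>\<^bsub>N\<^esub>) \<rparr>"

definition group_center :: "('a, 'b) monoid_scheme \<Rightarrow> 'a set" where
  "group_center G = {x \<in> carrier G. \<forall>y\<in>carrier G. x \<otimes>\<^bsub>G\<^esub> y = y \<otimes>\<^bsub>G\<^esub> x}"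

end

theory Submission
  imports Defs
begin

text \<open>
  A lower bound for \<open>C\<close> comes from a model: over the Heisenberg group, an edge of \<open>T\<close> acts as a monomial
  transposition matrix whose entries record a \<open>\<int>\<^sup>2\<close>-valued cocycle on \<open>T\<close>, and the hexagon relations say that
  this cocycle has no holonomy around the hexagons, i.e. that it lives on the torus.

  For the upper bound, the 17 edges of a Hamiltonian path generate a quotient of \<open>S\<^sub>1\<^sub>8\<close>, hence a copy
  of it. The hexagon relations force the fork relations at the trivalent vertices, so conjugating the
  edge that closes the path (respectively a chord) by this copy of \<open>S\<^sub>1\<^sub>8\<close> yields families of lifted transpositions
  \<open>P a b\<close> and \<open>Q a b\<close>; the products \<open>X a b = P a b (a b)\<close> and \<open>Y a b = Q a b (a b)\<close> are additive cocycles.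
  Eight hexagons express the remaining edges through these families. The ninth one says that the
  commutator of \<open>X\<close> and \<open>Y\<close> at a vertex does not depend on the vertex; it therefore commutes with everything
  and is the central element \<open>z\<close>. This gives every element of \<open>C\<close> a normal form, which the model reads off.
\<close>

section \<open>Presented groups\<close>

text \<open>The tree \<open>T0\<close> has branch points (vertex 10, for instance). Three edges at a
  vertex that satisfy only the pairwise braid relations generate an affine, hence infinite, Coxeter
  group, so (R1)-(R3) on \<open>T0\<close> do not by themselves bound the subgroup it generates.
  Along a path they are exactly the Coxeter relations. This is why the upper bound rests on a
  Hamiltonian path, and why the claim about \<open>T0\<close> is read off the injective model
  afterwards: the cocycle is normalized to vanish on \<open>T0\<close>. The entries of the matrices
  must be Heisenberg and not merely \<open>\<int>\<times>\<int>\<close>: with abelian entries the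
  translations at one vertex would commute and \<open>z\<close> would be invisible. The bookkeeping
  of edges is 27 = 17 + 2 + 8: the path, the two edges whose conjugates form the families, and one
  edge solved from each of eight hexagons. Edges 8 and 11 belong to both families at once, and the
  last hexagon compares the two mixed words that they produce. Central coordinates of normal forms
  are never computed: injectivity needs them only once all other exponents vanish, and surjectivity
  adjusts them at the end by a power of the central element.\<close>

lemma wordS_simps [simp]:
  "wordS S []" "wordS S (x # w) \<longleftrightarrow> fst x \<in> S \<and> wordS S w"
  "wordS S (v @ w) \<longleftrightarrow> wordS S v \<and> wordS S w"
  by (auto simp: wordS_def)

lemma inv_word_simps [simp]:
  "inv_word [] = []" "inv_word (x # w) = inv_word w @ [(fst x, \<not> snd x)]"
  "inv_word (v @ w) = inv_word w @ inv_word v"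
  by (auto simp: inv_word_def case_prod_unfold)

lemma wordS_inv_word [simp]: "wordS S (inv_word w) \<longleftrightarrow> wordS S w"
  by (induction w) auto

lemma pres_rel_wordS: "pres_rel S R v w \<Longrightarrow> wordS S v \<and> wordS S w"
  by (induction rule: pres_rel.induct) auto

lemma pres_rel_context:
  assumes "pres_rel S R v w" "wordS S xs" "wordS S ys"
  shows "pres_rel S R (xs @ v @ ys) (xs @ w @ ys)"
  using assms
proof (induction rule: pres_rel.induct)
  case (refl w) then show ?case by (auto intro: pres_rel.refl)
next
  case (sym v w) then show ?case by (auto intro: pres_rel.sym)
next
  case (trans u v w) then show ?case by (auto intro: pres_rel.trans)
next
  case (cancel xs' ys' a b)
  then show ?case
    using pres_rel.cancel[of S "xs @ xs'" "ys' @ ys" a R b] by auto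
next
  case (relator r xs' ys')
  then show ?case
    using pres_rel.relator[of r R S "xs @ xs'" "ys' @ ys"] by auto
qed

lemma pres_rel_append:
  assumes "pres_rel S R v v'" "pres_rel S R w w'"
  shows "pres_rel S R (v @ w) (v' @ w')"
proof -
  have "pres_rel S R (v @ w) (v' @ w)"
    using pres_rel_context[OF assms(1), of "[]" w] pres_rel_wordS[OF assms(2)] by simp
  moreover have "pres_rel S R (v' @ w) (v' @ w')"
    using pres_rel_context[OF assms(2), of v' "[]"] pres_rel_wordS[OF assms(1)] by simp
  ultimately show ?thesis by (rule pres_rel.trans)
qed

lemma pres_rel_inv_left: "wordS S w \<Longrightarrow> pres_rel S R (inv_word w @ w) []"
proof (induction w)
  case Nil then show ?case by (simp add: pres_rel.refl)
next
  case (Cons x w)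
  have "pres_rel S R (inv_word w @ [(fst x, \<not> snd x), (fst x, \<not> \<not> snd x)] @ w) (inv_word w @ w)"
    using Cons.prems by (intro pres_rel.cancel) auto
  then show ?case using Cons pres_rel.trans by fastforce
qed

lemma pres_class_eq_iff:
  "wordS S w \<Longrightarrow> pres_class S R v = pres_class S R w \<longleftrightarrow> pres_rel S R v w"
  unfolding pres_class_def by (auto intro: pres_rel.intros)

lemma presented_group_mult:
  assumes "wordS S v" "wordS S w"
  shows "pres_class S R v \<otimes>\<^bsub>presented_group S R\<^esub> pres_class S R w = pres_class S R (v @ w)"
proof -
  have "{x. \<exists>a\<in>pres_class S R v. \<exists>b\<in>pres_class S R w. pres_rel S R (a @ b) x} = pres_class S R (v @ w)"
    (is "?L = ?R")
  proof
    show "?L \<subseteq> ?R"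
      using pres_rel_append pres_rel.trans unfolding pres_class_def by fast
    have "v \<in> pres_class S R v" "w \<in> pres_class S R w"
      using assms by (auto simp: pres_class_def pres_rel.refl)
    then show "?R \<subseteq> ?L" unfolding pres_class_def[of _ _ "v @ w"] by blast
  qed
  then show ?thesis by (simp add: presented_group_def)
qed

lemma presented_group_carrier:
  "carrier (presented_group S R) = pres_class S R ` {w. wordS S w}"
  "\<one>\<^bsub>presented_group S R\<^esub> = pres_class S R []"
  by (simp_all add: presented_group_def)

lemma presented_group_is_group: "group (presented_group S R)"
proof (rule groupI, goal_cases)
  case (5 x)
  then obtain w where w: "x = pres_class S R w" "wordS S w"
    by (auto simp: presented_group_carrier)
  have "pres_class S R (inv_word w) \<otimes>\<^bsub>presented_group S R\<^esub> x = \<one>\<^bsub>presented_group S R\<^esub>"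
    using w pres_rel_inv_left[OF w(2)]
    by (simp add: presented_group_mult presented_group_carrier pres_class_eq_iff)
  moreover have "pres_class S R (inv_word w) \<in> carrier (presented_group S R)"
    using w by (auto simp: presented_group_carrier)
  ultimately show ?case by blast
qed (auto simp: presented_group_carrier presented_group_mult intro!: imageI)

lemma presented_group_inv:
  assumes "wordS S w"
  shows "inv\<^bsub>presented_group S R\<^esub> pres_class S R w = pres_class S R (inv_word w)"
  using assms pres_rel_inv_left[OF assms]
  by (intro group.inv_equality[OF presented_group_is_group])
     (auto simp: presented_group_mult presented_group_carrier pres_class_eq_iff)

definition word_eval :: "('b, 'c) monoid_scheme \<Rightarrow> ('a \<Rightarrow> 'b) \<Rightarrow> 'a word \<Rightarrow> 'b" where
  "word_eval G \<phi> w = foldr (\<lambda>x g. (if snd x then \<phi> (fst x) else inv\<^bsub>G\<^esub> \<phi> (fst x)) \<otimes>\<^bsub>G\<^esub> g) w \<one>\<^bsub>G\<^esub>"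

lemma word_eval_Nil [simp]: "word_eval G \<phi> [] = \<one>\<^bsub>G\<^esub>"
  and word_eval_Cons [simp]: "word_eval G \<phi> (x # w) =
    (if snd x then \<phi> (fst x) else inv\<^bsub>G\<^esub> \<phi> (fst x)) \<otimes>\<^bsub>G\<^esub> word_eval G \<phi> w"
  by (simp_all add: word_eval_def)

context group
begin

lemma word_eval_closed [simp]:
  "\<phi> \<in> S \<rightarrow> carrier G \<Longrightarrow> wordS S w \<Longrightarrow> word_eval G \<phi> w \<in> carrier G"
  by (induction w) (auto simp: Pi_iff)

lemma word_eval_append:
  "\<phi> \<in> S \<rightarrow> carrier G \<Longrightarrow> wordS S v \<Longrightarrow> wordS S w \<Longrightarrow>
    word_eval G \<phi> (v @ w) = word_eval G \<phi> v \<otimes> word_eval G \<phi> w"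
proof (induction v)
  case (Cons x v)
  then have "\<phi> (fst x) \<in> carrier G" by auto
  with Cons show ?case by (simp add: m_assoc del: inv_mult_group)
qed simp

lemma word_eval_inv_word:
  "\<phi> \<in> S \<rightarrow> carrier G \<Longrightarrow> wordS S w \<Longrightarrow> word_eval G \<phi> (inv_word w) = inv (word_eval G \<phi> w)"
proof (induction w)
  case (Cons x w)
  then have "\<phi> (fst x) \<in> carrier G" by auto
  with Cons show ?case by (simp add: word_eval_append inv_mult_group)
qed simp

lemma word_eval_pres_rel:
  assumes "pres_rel S R v w" "\<phi> \<in> S \<rightarrow> carrier G"
    and "\<And>r. r \<in> R \<Longrightarrow> wordS S r \<Longrightarrow> word_eval G \<phi> r = \<one>"
  shows "word_eval G \<phi> v = word_eval G \<phi> w"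
  using assms
proof (induction rule: pres_rel.induct)
  case (cancel xs ys a b)
  then have "\<phi> a \<in> carrier G" by auto
  with cancel show ?case
    by (cases b) (simp_all add: word_eval_append m_assoc[symmetric] inv_solve_right)
qed (simp_all add: word_eval_append)

text \<open>Von Dyck's theorem. The map evaluates an arbitrary representative of a class;
  \<open>word_eval_pres_rel\<close> makes the choice immaterial. The value is given on all words
  because the equivariance of the map out of \<open>H_grp\<close> is checked on words.\<close>

lemma presented_group_hom_exists:
  assumes "\<phi> \<in> S \<rightarrow> carrier G" "\<And>r. r \<in> R \<Longrightarrow> wordS S r \<Longrightarrow> word_eval G \<phi> r = \<one>"
  obtains h where "h \<in> hom (presented_group S R) G"
    "\<And>w. wordS S w \<Longrightarrow> h (pres_class S R w) = word_eval G \<phi> w"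
proof -
  define h where "h A = word_eval G \<phi> (SOME w. w \<in> A)" for A
  have h: "h (pres_class S R w) = word_eval G \<phi> w" if "wordS S w" for w
  proof -
    have "w \<in> pres_class S R w" using that by (simp add: pres_class_def pres_rel.refl)
    then have "(SOME w'. w' \<in> pres_class S R w) \<in> pres_class S R w" by (rule someI)
    then have "pres_rel S R w (SOME w'. w' \<in> pres_class S R w)" by (simp add: pres_class_def)
    from word_eval_pres_rel[OF this assms] show ?thesis by (simp add: h_def)
  qed
  have "h \<in> hom (presented_group S R) G"
    by (rule homI) (use assms(1) in
      \<open>auto simp: presented_group_carrier presented_group_mult h word_eval_append\<close>)
  with h that show thesis by blast
qed

end

lemma pgen_in_carrier [simp]: "a \<in> S \<Longrightarrow> pgen S R a \<in> carrier (presented_group S R)"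
  by (auto simp: pgen_def presented_group_carrier)

lemma word_eval_pgen:
  "wordS S w \<Longrightarrow> word_eval (presented_group S R) (pgen S R) w = pres_class S R w"
proof (induction w)
  case (Cons x w)
  then have "wordS S [x]" by simp
  have "(if snd x then pgen S R (fst x) else inv\<^bsub>presented_group S R\<^esub> pgen S R (fst x)) = pres_class S R [x]"
    using Cons.prems by (cases x) (auto simp: pgen_def presented_group_inv)
  with Cons presented_group_mult[OF \<open>wordS S [x]\<close>, of w R] show ?case by simp
qed (simp add: presented_group_carrier)

lemma presented_group_relator:
  assumes "r \<in> R" "wordS S r"
  shows "word_eval (presented_group S R) (pgen S R) r = \<one>\<^bsub>presented_group S R\<^esub>"
  using pres_rel.relator[OF assms, of "[]" "[]"] assms
  by (simp add: word_eval_pgen presented_group_carrier pres_class_eq_iff)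

lemma presented_group_relation:
  assumes "eq_rel l r \<in> R" "wordS S l" "wordS S r"
  shows "word_eval (presented_group S R) (pgen S R) l = word_eval (presented_group S R) (pgen S R) r"
proof -
  interpret group "presented_group S R" by (rule presented_group_is_group)
  have *: "pgen S R \<in> S \<rightarrow> carrier (presented_group S R)" by simp
  have "word_eval (presented_group S R) (pgen S R) (l @ inv_word r) = \<one>\<^bsub>presented_group S R\<^esub>"
    using presented_group_relator[of "eq_rel l r" R S] assms by (simp add: eq_rel_def)
  then have "word_eval (presented_group S R) (pgen S R) l
      \<otimes>\<^bsub>presented_group S R\<^esub> inv\<^bsub>presented_group S R\<^esub> word_eval (presented_group S R) (pgen S R) r
      = \<one>\<^bsub>presented_group S R\<^esub>"
    using * assms by (simp add: word_eval_append word_eval_inv_word)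
  then show ?thesis using * assms by (metis inv_closed inv_equality inv_inv word_eval_closed)
qed

lemma presented_group_generate:
  "carrier (presented_group S R) = generate (presented_group S R) (pgen S R ` S)" (is "?C = ?D")
proof
  interpret group "presented_group S R" by (rule presented_group_is_group)
  show "?D \<subseteq> ?C" by (rule generate_incl) auto
  have "word_eval (presented_group S R) (pgen S R) w \<in> ?D" if "wordS S w" for w
    using that by (induction w) (auto intro: generate.intros)
  then show "?C \<subseteq> ?D" by (auto simp: presented_group_carrier word_eval_pgen)
qed

text \<open>Induction that adds one letter on the left. It suits the collection arguments below,
  where only the effect of a single generator on a normal shape has to be understood.\<close>

lemma (in group) generate_closed_under_mult:
  assumes "x \<in> generate G S" "S \<subseteq> carrier G" "P \<one>"
    and "\<And>s g. s \<in> S \<Longrightarrow> g \<in> carrier G \<Longrightarrow> P g \<Longrightarrow> P (s \<otimes> g)"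
    and "\<And>s g. s \<in> S \<Longrightarrow> g \<in> carrier G \<Longrightarrow> P g \<Longrightarrow> P (inv s \<otimes> g)"
  shows "P x"
proof -
  \<comment> \<open>Strengthened to an arbitrary right factor, because the rule for
    \<open>generate\<close> splits a product into two unknown factors.\<close>
  have "P (x \<otimes> g)" if "g \<in> carrier G" "P g" for g
    using assms(1) that
  proof (induction arbitrary: g rule: generate.induct)
    case (eng h1 h2)
    then have "h1 \<in> carrier G" "h2 \<in> carrier G"
      using generate_in_carrier[OF assms(2)] by auto
    with eng show ?case by (simp add: m_assoc)
  qed (use assms in auto)
  from this[of \<one>] show ?thesis
    using assms(1,3) generate_in_carrier[OF assms(2)] by simp
qed

lemma hom_eq_on_generate:
  assumes "group G" "group H" "f \<in> hom G H" "g \<in> hom G H" "S \<subseteq> carrier G"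
    and "\<And>s. s \<in> S \<Longrightarrow> f s = g s" "x \<in> generate G S"
  shows "f x = g x"
proof -
  interpret f: group_hom G H f using assms by (simp add: group_hom_def group_hom_axioms_def)
  interpret g: group_hom G H g using assms by (simp add: group_hom_def group_hom_axioms_def)
  show ?thesis using assms(7)
  proof (induction rule: generate.induct)
    case (inv h) then show ?case using assms(5,6) by (metis f.hom_inv g.hom_inv subsetD)
  next
    case (eng h1 h2)
    then have "h1 \<in> carrier G" "h2 \<in> carrier G"
      using f.G.generate_in_carrier[OF assms(5)] by auto
    with eng show ?case by simp
  qed (use assms in auto)
qed

section \<open>Coxeter generators of the symmetric group\<close>

context group
begin

fun run_prod :: "(nat \<Rightarrow> 'a) \<Rightarrow> nat \<Rightarrow> nat \<Rightarrow> 'a" where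
  "run_prod e i 0 = \<one>"
| "run_prod e i (Suc k) = e i \<otimes> run_prod e (Suc i) k"

lemma run_prod_closed [simp]:
  "(\<And>j. i \<le> j \<Longrightarrow> j < i + k \<Longrightarrow> e j \<in> carrier G) \<Longrightarrow> run_prod e i k \<in> carrier G"
  by (induction k arbitrary: i) auto

lemma run_prod_commute:
  assumes "\<And>j. i \<le> j \<Longrightarrow> j < i + k \<Longrightarrow> e j \<in> carrier G \<and> c \<otimes> e j = e j \<otimes> c" "c \<in> carrier G"
  shows "c \<otimes> run_prod e i k = run_prod e i k \<otimes> c"
  using assms(1)
proof (induction k arbitrary: i)
  case (Suc k)
  have e: "e i \<in> carrier G" "c \<otimes> e i = e i \<otimes> c" using Suc.prems[of i] by auto
  have r: "run_prod e (Suc i) k \<in> carrier G" using Suc.prems by (intro run_prod_closed) auto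
  have "c \<otimes> run_prod e (Suc i) k = run_prod e (Suc i) k \<otimes> c" using Suc by auto
  with e r assms(2) show ?case by simp (metis m_assoc)
qed (use assms in simp)

lemma run_prod_append:
  assumes "\<And>j. i \<le> j \<Longrightarrow> j < i + k + l \<Longrightarrow> e j \<in> carrier G"
  shows "run_prod e i (k + l) = run_prod e i k \<otimes> run_prod e (i + k) l"
  using assms
proof (induction k arbitrary: i)
  case 0 then show ?case by simp
next
  case (Suc k)
  then have "run_prod e (Suc i) (k + l) = run_prod e (Suc i) k \<otimes> run_prod e (Suc i + k) l" by simp
  moreover have "e i \<in> carrier G" "run_prod e (Suc i) k \<in> carrier G" "run_prod e (Suc i + k) l \<in> carrier G"
    using Suc.prems by (auto intro!: run_prod_closed)
  ultimately show ?case by (simp add: m_assoc)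
qed

text \<open>Every element of the subgroup on \<open>n + 1\<close> generators is a run
  \<open>e\<^sub>i e\<^sub>i\<^sub>+\<^sub>1 \<dots> e\<^sub>n\<close> times an element of the subgroup on \<open>n\<close> generators.\<close>
lemma coxeter_generate_card_le:
  fixes e :: "nat \<Rightarrow> 'a"
  assumes "\<And>i. i < n \<Longrightarrow> e i \<in> carrier G" "\<And>i. i < n \<Longrightarrow> e i \<otimes> e i = \<one>"
    and "\<And>i j. i < n \<Longrightarrow> j < n \<Longrightarrow> Suc i < j \<Longrightarrow> e i \<otimes> e j = e j \<otimes> e i"
    and "\<And>i. Suc i < n \<Longrightarrow> e i \<otimes> (e (Suc i) \<otimes> e i) = e (Suc i) \<otimes> (e i \<otimes> e (Suc i))"
  shows "finite (generate G (e ` {..<n})) \<and> card (generate G (e ` {..<n})) \<le> fact (Suc n)"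
  using assms
proof (induction n)
  case 0
  then show ?case by (simp add: generate_empty)
next
  case (Suc n)
  let ?Q = "generate G (e ` {..<n})" and ?Q' = "generate G (e ` {..<Suc n})"
  define r where "r i = run_prod e i (Suc n - i)" for i
  note c = Suc.prems(1) and s = Suc.prems(2) and comm = Suc.prems(3) and br = Suc.prems(4)
  have "finite ?Q \<and> card ?Q \<le> fact (Suc n)"
    by (rule Suc.IH) (auto intro: c s comm br)
  then have Q: "finite ?Q" "card ?Q \<le> fact (Suc n)" by auto
  have Qc: "?Q \<subseteq> carrier G" using c by (intro generate_incl) auto
  have inv_e: "inv (e i) = e i" if "i \<le> n" for i using c s that by (simp add: inv_equality)
  have rc: "r i \<in> carrier G" if "i \<le> Suc n" for i
    unfolding r_def using c that by (intro run_prod_closed) auto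
  have r_step: "r i = e i \<otimes> r (Suc i)" if "i \<le> n" for i
    using that by (simp add: r_def Suc_diff_le)
  \<comment> \<open>Each generator permutes the cosets represented by the runs. The empty run
    \<open>r (Suc n)\<close> represents the trivial coset, so there are \<open>Suc (Suc n)\<close>
    runs, the factor by which the factorial grows.\<close>
  have main: "\<exists>i'\<le>Suc n. \<exists>q'\<in>?Q. e j \<otimes> (r i \<otimes> q) = r i' \<otimes> q'"
    if "j \<le> n" "i \<le> Suc n" "q \<in> ?Q" for i j q
  proof -
    have qc: "q \<in> carrier G" and jc: "e j \<in> carrier G" using that Qc c by auto
    consider "Suc j < i" | "i = Suc j" | "i = j" | "i < j" by linarith
    then show ?thesis
    proof cases
      case 1
      have "e j \<otimes> r i = r i \<otimes> e j" unfolding r_def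
        using c comm that 1 by (intro run_prod_commute) auto
      then have "e j \<otimes> (r i \<otimes> q) = r i \<otimes> (e j \<otimes> q)"
        using rc[OF that(2)] qc jc by (simp add: m_assoc[symmetric])
      moreover have "e j \<otimes> q \<in> ?Q" using 1 that by (auto intro!: generate.eng[OF generate.incl])
      ultimately show ?thesis using that by blast
    next
      case 2
      then have "e j \<otimes> (r i \<otimes> q) = r j \<otimes> q"
        using r_step[of j] rc[of i] jc qc that by (simp add: m_assoc)
      then show ?thesis using that 2 by (intro exI[of _ j]) auto
    next
      case 3
      then have "e j \<otimes> (r i \<otimes> q) = r (Suc j) \<otimes> q"
        using r_step[of j] rc[of "Suc j"] jc qc s that by (simp add: m_assoc[symmetric])
      then show ?thesis using that 3 by (intro exI[of _ "Suc j"]) auto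
    next
      \<comment> \<open>The letter \<open>e j\<close> slides to the consecutive letters
        \<open>e m\<close>, \<open>e j\<close> of the run, where \<open>j = Suc m\<close>. The braid
        relation turns it into \<open>e m\<close>, which slides out on the right and belongs to the
        smaller subgroup because \<open>m < n\<close>.\<close>
      case 4
      then obtain m where m: "j = Suc m" "i \<le> m" by (cases j) auto
      define a b where "a = run_prod e i (m - i)" and "b = r (Suc j)"
      have cm: "e m \<in> carrier G" "a \<in> carrier G" "b \<in> carrier G"
        using c m that rc by (auto simp: a_def b_def intro!: run_prod_closed)
      have "r i = a \<otimes> r m"
        using run_prod_append[of i "m - i" "Suc n - m" e] c m that by (simp add: r_def a_def)
      also have "r m = e m \<otimes> (e j \<otimes> b)"
        using r_step[of m] r_step[of j] m that by (simp add: b_def)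
      finally have ri: "r i = a \<otimes> (e m \<otimes> (e j \<otimes> b))" .
      have ja: "e j \<otimes> a = a \<otimes> e j" unfolding a_def
        using m that by (intro run_prod_commute conjI) (auto intro!: c comm[symmetric])
      have mb: "e m \<otimes> b = b \<otimes> e m" unfolding b_def r_def
        using c comm m that by (intro run_prod_commute) auto
      have br': "e j \<otimes> (e m \<otimes> e j) = e m \<otimes> (e j \<otimes> e m)" using br[of m] m that by simp
      have "e j \<otimes> (r i \<otimes> q) = (e j \<otimes> a) \<otimes> (e m \<otimes> (e j \<otimes> (b \<otimes> q)))"
        using cm jc qc by (simp add: ri m_assoc)
      also have "\<dots> = a \<otimes> ((e j \<otimes> (e m \<otimes> e j)) \<otimes> (b \<otimes> q))"
        using cm jc qc by (simp add: ja m_assoc)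
      also have "\<dots> = a \<otimes> (e m \<otimes> (e j \<otimes> ((e m \<otimes> b) \<otimes> q)))"
        using cm jc qc unfolding br' by (simp add: m_assoc)
      also have "\<dots> = r i \<otimes> (e m \<otimes> q)"
        using cm jc qc by (simp add: mb ri m_assoc)
      finally have "e j \<otimes> (r i \<otimes> q) = r i \<otimes> (e m \<otimes> q)" .
      moreover have "e m \<otimes> q \<in> ?Q" using m that by (auto intro!: generate.eng[OF generate.incl])
      ultimately show ?thesis using that by blast
    qed
  qed
  have "?Q' \<subseteq> (\<lambda>(i, q). r i \<otimes> q) ` ({..Suc n} \<times> ?Q)" (is "_ \<subseteq> ?f ` _")
  proof
    fix x assume "x \<in> ?Q'"
    then have "\<exists>i\<le>Suc n. \<exists>q\<in>?Q. x = r i \<otimes> q"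
    proof (rule generate_closed_under_mult)
      show "\<exists>i\<le>Suc n. \<exists>q\<in>?Q. \<one> = r i \<otimes> q"
        by (intro exI[of _ "Suc n"] conjI bexI[of _ \<one>]) (auto simp: r_def generate.one)
    qed (use c main inv_e in \<open>auto simp: less_Suc_eq_le\<close>)
    then show "x \<in> ?f ` ({..Suc n} \<times> ?Q)" by auto
  qed
  moreover have "finite ({..Suc n} \<times> ?Q)" using Q by simp
  ultimately have "finite ?Q'" "card ?Q' \<le> card ({..Suc n} \<times> ?Q)"
    by (auto intro: finite_surj surj_card_le)
  moreover have "card ({..Suc n} \<times> ?Q) \<le> Suc (Suc n) * fact (Suc n)"
    using Q(2) by (simp only: card_cartesian_product card_atMost mult_le_mono2)
  ultimately show ?case by (simp only: fact_Suc[of "Suc n"] of_nat_id) simp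
qed

section \<open>Hexagon relations\<close>

text \<open>Conjugation by \<open>x\<close> as soon as \<open>x\<close> is an involution, written
  without an inverse so that products of involutions can be normalized by cancellation
  alone.\<close>

definition cj :: "'a \<Rightarrow> 'a \<Rightarrow> 'a" where "cj x y = x \<otimes> (y \<otimes> x)"

lemma cj_closed [simp]: "x \<in> carrier G \<Longrightarrow> y \<in> carrier G \<Longrightarrow> cj x y \<in> carrier G"
  by (simp add: cj_def)

lemma involution_cancel:
  "x \<in> carrier G \<Longrightarrow> x \<otimes> x = \<one> \<Longrightarrow> y \<in> carrier G \<Longrightarrow> x \<otimes> (x \<otimes> y) = y"
  by (simp add: m_assoc[symmetric])

lemma cj_cj_distrib:
  assumes "x \<in> carrier G" "y \<in> carrier G" "z \<in> carrier G" "x \<otimes> x = \<one>"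
  shows "cj x (cj y z) = cj (cj x y) (cj x z)"
  using assms by (simp add: cj_def m_assoc involution_cancel)

lemma cj_cancel:
  assumes "x \<in> carrier G" "y \<in> carrier G" "x \<otimes> x = \<one>"
  shows "cj x (cj x y) = y"
  using assms by (simp add: cj_def m_assoc involution_cancel)

lemma cj_commute:
  assumes "x \<in> carrier G" "y \<in> carrier G" "x \<otimes> x = \<one>"
  shows "cj x y = y \<longleftrightarrow> x \<otimes> y = y \<otimes> x"
proof
  assume "cj x y = y"
  then have "x \<otimes> cj x y = x \<otimes> y" by simp
  then show "x \<otimes> y = y \<otimes> x" using assms by (simp add: cj_def involution_cancel)
next
  assume "x \<otimes> y = y \<otimes> x"
  then have "cj x y = x \<otimes> (x \<otimes> y)" by (simp add: cj_def)
  then show "cj x y = y" using assms by (simp add: involution_cancel)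
qed

definition braid :: "'a \<Rightarrow> 'a \<Rightarrow> bool" where "braid x y \<longleftrightarrow> cj x y = cj y x"
definition commutes :: "'a \<Rightarrow> 'a \<Rightarrow> bool" where "commutes x y \<longleftrightarrow> x \<otimes> y = y \<otimes> x"

text \<open>The last conjunct is the relation \<open>abcde = bcdef\<close>, solved for \<open>f\<close>.\<close>
definition hexagon :: "'a \<Rightarrow> 'a \<Rightarrow> 'a \<Rightarrow> 'a \<Rightarrow> 'a \<Rightarrow> 'a \<Rightarrow> bool" where
  "hexagon a b c d e f \<longleftrightarrow>
     {a, b, c, d, e, f} \<subseteq> carrier G \<and> (\<forall>x\<in>{a, b, c, d, e, f}. x \<otimes> x = \<one>) \<and>
     braid a b \<and> braid b c \<and> braid c d \<and> braid d e \<and> braid e f \<and> braid f a \<and>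
     commutes a c \<and> commutes a d \<and> commutes a e \<and> commutes b d \<and> commutes b e \<and> commutes b f \<and>
     commutes c e \<and> commutes c f \<and> commutes d f \<and>
     f = cj e (cj d (cj c (cj b a)))"

lemma hexagonD: "hexagon a b c d e f \<Longrightarrow> f = cj e (cj d (cj c (cj b a)))"
  by (simp add: hexagon_def)

text \<open>Along the path of edges \<open>b\<close>, \<open>c\<close>, \<open>d\<close>,
  \<open>e\<close>, \<open>f\<close> the transposition of the two far ends arises either by carrying
  \<open>b\<close> forward or by carrying \<open>f\<close> back. The braid relations identify the
  two, and the given relation says that the second one is \<open>a\<close>. A hexagon can therefore
  be solved for any of its six edges.\<close>

lemma hexagon_rotate:
  assumes "hexagon a b c d e f"
  shows "hexagon b c d e f a"
proof -
  have C: "a \<in> carrier G" "b \<in> carrier G" "c \<in> carrier G" "d \<in> carrier G" "e \<in> carrier G" "f \<in> carrier G"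
    and I: "a \<otimes> a = \<one>" "b \<otimes> b = \<one>" "c \<otimes> c = \<one>" "d \<otimes> d = \<one>" "e \<otimes> e = \<one>" "f \<otimes> f = \<one>"
    and R: "cj b c = cj c b" "cj c d = cj d c" "cj d e = cj e d" "cj e f = cj f e"
    and f: "f = cj e (cj d (cj c (cj b a)))"
    and K: "commutes b d" "commutes b e" "commutes b f" "commutes c e" "commutes c f" "commutes d f"
    using assms by (auto simp: hexagon_def braid_def)
  have K': "cj d b = b" "cj e b = b" "cj f b = b" "cj e c = c" "cj f c = c" "cj f d = d"
    using K C I by (simp_all add: cj_commute commutes_def)
  have a: "a = cj b (cj c (cj d (cj e f)))"
    unfolding f using C I by (simp add: cj_cancel)
  have pass: "cj x (cj y z) = cj y (cj x z)"
    if "cj x y = y" "x \<in> carrier G" "y \<in> carrier G" "z \<in> carrier G" "x \<otimes> x = \<one>" for x y z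
    using that by (simp add: cj_cj_distrib)
  \<comment> \<open>The identification of forward and backward transport is proved by lengthening
    the path one edge at a time.\<close>
  have "cj d (cj c b) = cj b (cj c d)"
    using C I K' R by (metis pass)
  then have "cj e (cj d (cj c b)) = cj b (cj c (cj d e))"
    using C I K' R by (metis pass cj_closed)
  then have "cj f (cj e (cj d (cj c b))) = cj b (cj c (cj d (cj f e)))"
    using C I K' by (simp add: pass)
  then show ?thesis using assms a C
    by (simp add: hexagon_def R(4)) (auto simp: commutes_def)
qed

text \<open>The fork relation: an edge attached to the common vertex of \<open>a\<close> and \<open>b\<close> commutes with
  the opposite edge \<open>f\<close>, and carrying \<open>f\<close> back along the hexagon gives \<open>bab\<close>.\<close>
lemma hexagon_fork:
  assumes "hexagon a b c d e f" "r \<in> carrier G"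
    and "commutes r c" "commutes r d" "commutes r e" "commutes r f"
  shows "commutes r (cj b a)"
proof -
  have C: "a \<in> carrier G" "b \<in> carrier G" "c \<in> carrier G" "d \<in> carrier G" "e \<in> carrier G" "f \<in> carrier G"
    and I: "c \<otimes> c = \<one>" "d \<otimes> d = \<one>" "e \<otimes> e = \<one>"
    and f: "f = cj e (cj d (cj c (cj b a)))"
    using assms by (auto simp: hexagon_def)
  have *: "commutes r (cj x y)" if "commutes r x" "commutes r y" "x \<in> carrier G" "y \<in> carrier G" for x y
    using that assms(2) unfolding commutes_def cj_def by (metis m_assoc m_closed)
  have "cj b a = cj c (cj d (cj e f))"
    unfolding f using C I by (simp add: cj_cancel)
  then show ?thesis using * C assms by simp
qed

end

section \<open>Permutations\<close>

text \<open>Conjugating \<open>(a v)\<close> by \<open>(v w)\<close> gives \<open>(a w)\<close>, so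
  one transposition linking \<open>w\<close> to \<open>W\<close> suffices to adjoin
  \<open>w\<close>.\<close>

lemma transpose_closure_insert:
  assumes "\<And>\<sigma> \<tau>. \<sigma> \<in> S \<Longrightarrow> \<tau> \<in> S \<Longrightarrow> \<sigma> \<circ> \<tau> \<in> S" "id \<in> S"
    and "\<forall>a\<in>W. \<forall>b\<in>W. transpose a b \<in> S" "v \<in> W" "transpose v w \<in> S"
  shows "\<forall>a\<in>insert w W. \<forall>b\<in>insert w W. transpose a b \<in> S"
proof -
  have *: "transpose a w \<in> S" if "a \<in> W" for a
  proof (cases "a = v \<or> a = w")
    case False
    then have "transpose a w = transpose v w \<circ> (transpose a v \<circ> transpose v w)"
      by (auto simp: fun_eq_iff transpose_def)
    then show ?thesis using assms that by metis
  qed (use assms in auto)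
  then show ?thesis using assms by (auto simp: transpose_commute[of w])
qed

text \<open>A certificate of connectedness that simplification can check on an explicit list of
  edges: each edge starts at a vertex already reached.\<close>

fun grows :: "'v set \<Rightarrow> ('v \<times> 'v) list \<Rightarrow> bool" where
  "grows W [] = True"
| "grows W ((v, w) # es) = (v \<in> W \<and> grows (insert w W) es)"

text \<open>Transpositions along a connected set of edges generate all transpositions, hence all
  permutations. Working with any set closed under composition covers both uses: the image of a
  subgroup under \<open>psi\<close>, and the permutations whose lift commutes with a given
  element.\<close>

lemma tree_generates_permutations:
  assumes cl: "\<And>\<sigma> \<tau>. \<sigma> \<in> S \<Longrightarrow> \<tau> \<in> S \<Longrightarrow> \<sigma> \<circ> \<tau> \<in> S" "id \<in> S"
    and "grows {v} es" "\<And>a b. (a, b) \<in> set es \<Longrightarrow> transpose a b \<in> S"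
    and "\<sigma> permutes insert v (snd ` set es)"
  shows "\<sigma> \<in> S"
proof -
  have gen: "\<forall>a\<in>W \<union> snd ` set es. \<forall>b\<in>W \<union> snd ` set es. transpose a b \<in> S"
    if "\<forall>a\<in>W. \<forall>b\<in>W. transpose a b \<in> S" "grows W es" "\<And>a b. (a, b) \<in> set es \<Longrightarrow> transpose a b \<in> S"
    for W and es
    using that
  proof (induction W es rule: grows.induct)
    case (2 W v w es)
    have "\<forall>a\<in>insert w W. \<forall>b\<in>insert w W. transpose a b \<in> S"
    proof (rule transpose_closure_insert[OF cl 2(2)])
      show "v \<in> W" using 2(3) by simp
      show "transpose v w \<in> S" by (rule 2(4)) simp
    qed
    moreover have "grows (insert w W) es" using 2(3) by simp
    moreover have "transpose a b \<in> S" if "(a, b) \<in> set es" for a b by (rule 2(4)) (simp add: that)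
    ultimately have "\<forall>a\<in>insert w W \<union> snd ` set es. \<forall>b\<in>insert w W \<union> snd ` set es. transpose a b \<in> S"
      by (rule 2(1))
    then show ?case by simp
  qed simp
  have "\<forall>a\<in>{v} \<union> snd ` set es. \<forall>b\<in>{v} \<union> snd ` set es. transpose a b \<in> S"
    using cl(2) by (intro gen[OF _ assms(3,4)]) auto
  then have all: "transpose a b \<in> S"
    if "a \<in> insert v (snd ` set es)" "b \<in> insert v (snd ` set es)" for a b
    using that by blast
  have "finite (insert v (snd ` set es))" by simp
  with assms(5) show ?thesis
    by (induction rule: permutes_induct) (use all cl in blast)+
qed

text \<open>High transitivity of the symmetric group, used to move a relation known for one tuple of
  vertices to all tuples. A permutation that is right on the tail is corrected by a swap of
  \<open>\<sigma> x\<close> and \<open>y\<close>, neither of which occurs in the tail of the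
  target.\<close>

lemma permutation_extending_lists:
  assumes "distinct xs" "distinct ys" "length xs = length ys" "set xs \<subseteq> V" "set ys \<subseteq> V"
  shows "\<exists>\<sigma>. \<sigma> permutes V \<and> map \<sigma> xs = ys"
  using assms
proof (induction xs arbitrary: ys)
  case Nil
  then show ?case by (auto intro: permutes_id)
next
  case (Cons x xs)
  then obtain y ys' where ys: "ys = y # ys'" by (cases ys) auto
  have "\<exists>\<sigma>. \<sigma> permutes V \<and> map \<sigma> xs = ys'"
    using Cons.prems ys by (intro Cons.IH) auto
  then obtain \<sigma> where \<sigma>: "\<sigma> permutes V" "map \<sigma> xs = ys'" by blast
  have "\<sigma> x \<notin> set ys'"
  proof
    assume "\<sigma> x \<in> set ys'"
    then obtain x' where "x' \<in> set xs" "\<sigma> x = \<sigma> x'" using \<sigma>(2) by auto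
    then show False using Cons.prems permutes_inj[OF \<sigma>(1)] by (auto dest: injD)
  qed
  moreover have "y \<notin> set ys'" using Cons.prems ys by simp
  ultimately have "map (transpose (\<sigma> x) y) ys' = ys'"
    by (intro map_idI) (auto simp: transpose_def)
  then have m: "map (transpose (\<sigma> x) y \<circ> \<sigma>) (x # xs) = y # ys'"
    using \<sigma>(2) by auto
  have "(transpose (\<sigma> x) y \<circ> \<sigma>) permutes V"
    using Cons.prems ys \<sigma>(1) permutes_in_image[OF \<sigma>(1), of x]
    by (intro permutes_compose permutes_swap_id) auto
  with m show ?case unfolding ys by (intro exI[of _ "transpose (\<sigma> x) y \<circ> \<sigma>"] conjI)
qed

lemma transpose_conjugate:
  assumes "bij \<sigma>"
  shows "\<sigma> \<circ> (transpose a b \<circ> inv_into UNIV \<sigma>) = transpose (\<sigma> a) (\<sigma> b)"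
proof
  fix x
  show "(\<sigma> \<circ> (transpose a b \<circ> inv_into UNIV \<sigma>)) x = transpose (\<sigma> a) (\<sigma> b) x"
    using assms by (auto simp: transpose_def bij_is_inj bij_is_surj surj_f_inv_f)
qed

section \<open>Families of lifted transpositions\<close>

text \<open>A homomorphism from the symmetric group of \<open>V\<close> into \<open>G\<close>. In
  the application it is the inverse of \<open>psi\<close> on the subgroup of the path.\<close>

locale sym_rep = group G for G (structure) +
  fixes V :: "'v set" and s :: "('v \<Rightarrow> 'v) \<Rightarrow> 'a"
  assumes finite_V: "finite V"
    and s_closed [simp]: "\<sigma> permutes V \<Longrightarrow> s \<sigma> \<in> carrier G"
    and s_comp: "\<sigma> permutes V \<Longrightarrow> \<tau> permutes V \<Longrightarrow> s (\<sigma> \<circ> \<tau>) = s \<sigma> \<otimes> s \<tau>"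
begin

lemma s_id [simp]: "s id = \<one>"
  using s_comp[OF permutes_id permutes_id] s_closed[OF permutes_id] by simp

lemma s_inv: "\<sigma> permutes V \<Longrightarrow> s (inv_into UNIV \<sigma>) = inv (s \<sigma>)"
  using s_comp[OF permutes_inv, of \<sigma> \<sigma>] permutes_inv[of \<sigma> V]
  by (intro inv_equality[symmetric]) (auto simp: permutes_inv_o)

definition ac :: "('v \<Rightarrow> 'v) \<Rightarrow> 'a \<Rightarrow> 'a" where "ac \<sigma> x = s \<sigma> \<otimes> (x \<otimes> inv (s \<sigma>))"

lemma ac_closed [simp]: "\<sigma> permutes V \<Longrightarrow> x \<in> carrier G \<Longrightarrow> ac \<sigma> x \<in> carrier G"
  by (simp add: ac_def)

lemma ac_mult: "\<sigma> permutes V \<Longrightarrow> x \<in> carrier G \<Longrightarrow> y \<in> carrier G \<Longrightarrow> ac \<sigma> (x \<otimes> y) = ac \<sigma> x \<otimes> ac \<sigma> y"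
  by (simp add: ac_def m_assoc inv_solve_left)

lemma ac_one: "\<sigma> permutes V \<Longrightarrow> ac \<sigma> \<one> = \<one>"
  by (simp add: ac_def)

lemma ac_inv: "\<sigma> permutes V \<Longrightarrow> x \<in> carrier G \<Longrightarrow> ac \<sigma> (inv x) = inv (ac \<sigma> x)"
  using ac_mult[of \<sigma> "inv x" x] by (intro inv_equality[symmetric]) (auto simp: ac_one)

lemma ac_comp: "\<sigma> permutes V \<Longrightarrow> \<tau> permutes V \<Longrightarrow> x \<in> carrier G \<Longrightarrow> ac (\<sigma> \<circ> \<tau>) x = ac \<sigma> (ac \<tau> x)"
  by (simp add: ac_def s_comp m_assoc inv_mult_group)

lemma ac_fixed_iff:
  "\<sigma> permutes V \<Longrightarrow> x \<in> carrier G \<Longrightarrow> ac \<sigma> x = x \<longleftrightarrow> s \<sigma> \<otimes> x = x \<otimes> s \<sigma>"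
  unfolding ac_def by (metis inv_closed inv_solve_right m_assoc m_closed s_closed)

lemma ac_id [simp]: "x \<in> carrier G \<Longrightarrow> ac id x = x"
  by (simp add: ac_def)

lemma ac_inv_cancel:
  assumes "\<sigma> permutes V" "x \<in> carrier G"
  shows "ac \<sigma> (ac (inv_into UNIV \<sigma>) x) = x" "ac (inv_into UNIV \<sigma>) (ac \<sigma> x) = x"
  using assms ac_comp[of \<sigma> "inv_into UNIV \<sigma>" x] ac_comp[of "inv_into UNIV \<sigma>" \<sigma> x]
  by (simp_all add: permutes_inv permutes_inv_o)

definition t :: "'v \<Rightarrow> 'v \<Rightarrow> 'a" where "t a b = s (transpose a b)"

lemma t_closed [simp]: "a \<in> V \<Longrightarrow> b \<in> V \<Longrightarrow> t a b \<in> carrier G"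
  by (simp add: t_def permutes_swap_id)

lemma t_invol [simp]: "a \<in> V \<Longrightarrow> b \<in> V \<Longrightarrow> t a b \<otimes> t a b = \<one>"
  unfolding t_def by (subst s_comp[symmetric]) (auto simp: permutes_swap_id)

lemma t_sym: "t a b = t b a" by (simp add: t_def transpose_commute)

lemma inv_t [simp]: "a \<in> V \<Longrightarrow> b \<in> V \<Longrightarrow> inv (t a b) = t a b"
  by (simp add: inv_equality)

lemma ac_t:
  assumes "\<sigma> permutes V" "a \<in> V" "b \<in> V"
  shows "ac \<sigma> (t a b) = t (\<sigma> a) (\<sigma> b)"
proof -
  have "ac \<sigma> (t a b) = s (\<sigma> \<circ> (transpose a b \<circ> inv_into UNIV \<sigma>))"
    unfolding ac_def t_def using assms
    by (simp add: s_comp s_inv permutes_inv permutes_compose permutes_swap_id)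
  then show ?thesis using assms by (simp add: transpose_conjugate permutes_bij t_def)
qed

lemma cj_t:
  assumes "a \<in> V" "b \<in> V" shows "cj (t a b) x = ac (transpose a b) x"
  unfolding cj_def ac_def using assms by (simp add: t_def[symmetric])

lemma cj_t_t:
  "\<lbrakk>a \<in> V; b \<in> V; c \<in> V; d \<in> V\<rbrakk> \<Longrightarrow> cj (t a b) (t c d) = t (transpose a b c) (transpose a b d)"
  by (simp add: cj_t ac_t permutes_swap_id)

lemma ac_cj: "\<sigma> permutes V \<Longrightarrow> x \<in> carrier G \<Longrightarrow> y \<in> carrier G \<Longrightarrow> ac \<sigma> (cj x y) = cj (ac \<sigma> x) (ac \<sigma> y)"
  by (simp add: cj_def ac_mult)

end

text \<open>\<open>P a b\<close> behaves like a transposition along an arc from \<open>a\<close> to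
  \<open>b\<close> that runs once around a period of the torus. Pairs are ordered because
  \<open>P b a\<close> runs around it backwards. The last two axioms say that prolonging such an arc
  at either end by an ordinary one gives an arc of the same kind.\<close>

locale lift_family = sym_rep G V s for G (structure) and V :: "'v set" and s :: "('v \<Rightarrow> 'v) \<Rightarrow> 'a" +
  fixes P :: "'v \<Rightarrow> 'v \<Rightarrow> 'a"
  assumes P_closed [simp]: "a \<in> V \<Longrightarrow> b \<in> V \<Longrightarrow> a \<noteq> b \<Longrightarrow> P a b \<in> carrier G"
    and P_invol [simp]: "a \<in> V \<Longrightarrow> b \<in> V \<Longrightarrow> a \<noteq> b \<Longrightarrow> P a b \<otimes> P a b = \<one>"
    and ac_P: "\<sigma> permutes V \<Longrightarrow> a \<in> V \<Longrightarrow> b \<in> V \<Longrightarrow> a \<noteq> b \<Longrightarrow> ac \<sigma> (P a b) = P (\<sigma> a) (\<sigma> b)"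
    and cj_P_t: "\<lbrakk>a \<in> V; b \<in> V; c \<in> V; distinct [a, b, c]\<rbrakk> \<Longrightarrow> cj (P a b) (t b c) = P a c"
    and cj_P_t': "\<lbrakk>a \<in> V; b \<in> V; c \<in> V; distinct [a, b, c]\<rbrakk> \<Longrightarrow> cj (P a b) (t a c) = P c b"
begin

lemma cj_t_P:
  "\<lbrakk>a \<in> V; b \<in> V; c \<in> V; d \<in> V; c \<noteq> d\<rbrakk> \<Longrightarrow> cj (t a b) (P c d) = P (transpose a b c) (transpose a b d)"
  by (simp add: cj_t ac_P permutes_swap_id)

text \<open>The translation carried by the arc. In the model, up to a central factor, it is the
  diagonal element with one generator of the Heisenberg group at \<open>a\<close> and its inverse at
  \<open>b\<close>.\<close>

definition Tr :: "'v \<Rightarrow> 'v \<Rightarrow> 'a" where "Tr a b = P a b \<otimes> t a b"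

lemma Tr_closed [simp]: "a \<in> V \<Longrightarrow> b \<in> V \<Longrightarrow> a \<noteq> b \<Longrightarrow> Tr a b \<in> carrier G"
  by (simp add: Tr_def)

lemma ac_Tr: "\<sigma> permutes V \<Longrightarrow> a \<in> V \<Longrightarrow> b \<in> V \<Longrightarrow> a \<noteq> b \<Longrightarrow> ac \<sigma> (Tr a b) = Tr (\<sigma> a) (\<sigma> b)"
  by (simp add: Tr_def ac_mult ac_P ac_t)

lemma P_eq: "a \<in> V \<Longrightarrow> b \<in> V \<Longrightarrow> a \<noteq> b \<Longrightarrow> P a b = Tr a b \<otimes> t a b"
  by (simp add: Tr_def m_assoc)

lemma Tr_swap: assumes "a \<in> V" "b \<in> V" "a \<noteq> b" shows "Tr b a = inv (Tr a b)"
proof -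
  have "P b a = t a b \<otimes> (P a b \<otimes> t a b)"
    using assms cj_t_P[of a b a b] by (simp add: cj_def)
  then have "Tr b a = t a b \<otimes> P a b"
    using assms by (simp add: Tr_def m_assoc t_sym[of b a])
  moreover have "inv (P a b) = P a b" using assms by (simp add: inv_equality)
  ultimately show ?thesis using assms by (simp add: Tr_def inv_mult_group)
qed

text \<open>Equivariance moves the ordinary transpositions to the right, and the prolongation axiom
  replaces \<open>P a c\<close> by a conjugate of an ordinary transposition; what remains is a
  conjugate of a single \<open>Tr\<close>. The two prolongation axioms give the two orders of the
  product, and their agreement is the source of commutativity among translations.\<close>

lemma Tr_cocycle:
  assumes "a \<in> V" "b \<in> V" "c \<in> V" "distinct [a, b, c]"
  shows "Tr a b \<otimes> Tr b c = Tr a c" "Tr b c \<otimes> Tr a b = Tr a c"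
proof -
  have "t a b \<otimes> cj (t a b) (P a c) = t a b \<otimes> P b c" "t b c \<otimes> cj (t b c) (P a c) = t b c \<otimes> P a b"
    using cj_t_P[of a b a c] cj_t_P[of b c a c] assms by auto
  then have 1: "t a b \<otimes> P b c = P a c \<otimes> t a b" "t b c \<otimes> P a b = P a c \<otimes> t b c"
    using assms by (simp_all add: cj_def involution_cancel)
  have "Tr a b \<otimes> Tr b c = P a b \<otimes> ((t a b \<otimes> P b c) \<otimes> t b c)"
    using assms by (simp add: Tr_def m_assoc)
  also have "\<dots> = P a b \<otimes> (P a c \<otimes> (t a b \<otimes> t b c))" using assms by (simp add: 1 m_assoc)
  also have "\<dots> = P a b \<otimes> (cj (P a b) (t b c) \<otimes> (t a b \<otimes> t b c))" using assms by (simp add: cj_P_t)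
  also have "\<dots> = cj (t b c) (Tr a b)" using assms by (simp add: cj_def Tr_def m_assoc involution_cancel)
  also have "\<dots> = Tr a c" using assms by (auto simp: cj_t ac_Tr permutes_swap_id transpose_def)
  finally show "Tr a b \<otimes> Tr b c = Tr a c" .
  have "Tr b c \<otimes> Tr a b = P b c \<otimes> ((t b c \<otimes> P a b) \<otimes> t a b)"
    using assms by (simp add: Tr_def m_assoc)
  also have "\<dots> = P b c \<otimes> (P a c \<otimes> (t b c \<otimes> t a b))" using assms by (simp add: 1 m_assoc)
  also have "\<dots> = P b c \<otimes> (cj (P b c) (t a b) \<otimes> (t b c \<otimes> t a b))"
    using assms cj_P_t'[of b c a] by (auto simp: t_sym[of a b])
  also have "\<dots> = cj (t a b) (Tr b c)" using assms by (simp add: cj_def Tr_def m_assoc involution_cancel)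
  also have "\<dots> = Tr a c" using assms by (auto simp: cj_t ac_Tr permutes_swap_id transpose_def)
  finally show "Tr b c \<otimes> Tr a b = Tr a c" .
qed

end

text \<open>The family is the orbit of \<open>p\<close> under conjugation. It is indexed by ordered
  pairs because the stabilizer of the pair \<open>\<alpha>\<close>, \<open>\<beta>\<close> commutes
  with \<open>p\<close>, and one braid relation at each end of \<open>p\<close> spreads to all
  triples by transitivity.\<close>

lemma (in sym_rep) lift_family_exists:
  assumes p: "p \<in> carrier G" "p \<otimes> p = \<one>" and ab: "\<alpha> \<in> V" "\<beta> \<in> V" "\<alpha> \<noteq> \<beta>"
    and stab: "\<And>\<sigma>. \<sigma> permutes (V - {\<alpha>, \<beta>}) \<Longrightarrow> s \<sigma> \<otimes> p = p \<otimes> s \<sigma>"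
    and "c \<in> V - {\<alpha>, \<beta>}" "braid p (t \<beta> c)" and "d \<in> V - {\<alpha>, \<beta>}" "braid p (t \<alpha> d)"
  obtains P where "lift_family G V s P" "P \<alpha> \<beta> = p"
proof -
  have stab': "ac \<sigma> p = p" if "\<sigma> permutes V" "\<sigma> \<alpha> = \<alpha>" "\<sigma> \<beta> = \<beta>" for \<sigma>
  proof -
    have "\<sigma> permutes (V - {\<alpha>, \<beta>})" using that unfolding permutes_def by (metis Diff_iff empty_iff insert_iff)
    then show ?thesis using stab that p by (simp add: ac_fixed_iff)
  qed
  \<comment> \<open>Any permutation that moves the base pair to \<open>(a, b)\<close> would do;
    \<open>stab'\<close> shows below that the conjugate depends only on the pair.\<close>
  define pick where "pick a b = (SOME \<sigma>. \<sigma> permutes V \<and> \<sigma> \<alpha> = a \<and> \<sigma> \<beta> = b)" for a b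
  have pick: "pick a b permutes V" "pick a b \<alpha> = a" "pick a b \<beta> = b"
    if "a \<in> V" "b \<in> V" "a \<noteq> b" for a b
  proof -
    have "\<exists>\<sigma>. \<sigma> permutes V \<and> map \<sigma> [\<alpha>, \<beta>] = [a, b]"
      by (rule permutation_extending_lists) (use ab that in auto)
    then have "\<exists>\<sigma>. \<sigma> permutes V \<and> \<sigma> \<alpha> = a \<and> \<sigma> \<beta> = b" by auto
    from someI_ex[OF this] show "pick a b permutes V" "pick a b \<alpha> = a" "pick a b \<beta> = b"
      by (auto simp: pick_def)
  qed
  define P where "P a b = ac (pick a b) p" for a b
  have acP': "ac \<sigma> p = P (\<sigma> \<alpha>) (\<sigma> \<beta>)" if "\<sigma> permutes V" for \<sigma>
  proof -
    let ?\<rho> = "pick (\<sigma> \<alpha>) (\<sigma> \<beta>)"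
    have r: "\<sigma> \<alpha> \<in> V" "\<sigma> \<beta> \<in> V" "\<sigma> \<alpha> \<noteq> \<sigma> \<beta>"
      using that ab permutes_in_image[OF that] permutes_inj[OF that] by (auto dest: injD)
    note \<rho> = pick[OF r]
    have i: "inv_into UNIV ?\<rho> permutes V" using \<rho> by (simp add: permutes_inv)
    have "ac (inv_into UNIV ?\<rho> \<circ> \<sigma>) p = p"
    proof (rule stab')
      show "(inv_into UNIV ?\<rho> \<circ> \<sigma>) permutes V" using that i by (rule permutes_compose)
    qed (use \<rho> in \<open>auto simp: permutes_inv_eq\<close>)
    then have "ac ?\<rho> (ac (inv_into UNIV ?\<rho>) (ac \<sigma> p)) = ac ?\<rho> p"
      using that i p by (simp add: ac_comp)
    moreover have "ac ?\<rho> (ac (inv_into UNIV ?\<rho>) (ac \<sigma> p)) = ac \<sigma> p"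
      using that p \<rho> by (simp add: ac_inv_cancel)
    ultimately show ?thesis by (simp add: P_def)
  qed
  have Pb: "P \<alpha> \<beta> = p" using acP'[OF permutes_id] p by (simp add: ac_def)
  have acP: "ac \<sigma> (P a b) = P (\<sigma> a) (\<sigma> b)" if "\<sigma> permutes V" "a \<in> V" "b \<in> V" "a \<noteq> b" for \<sigma> a b
    using pick[OF that(2-4)] that p acP'[of "\<sigma> \<circ> pick a b"]
    by (simp add: P_def ac_comp permutes_compose)
  have cP: "P a b \<in> carrier G" if "a \<in> V" "b \<in> V" "a \<noteq> b" for a b
    using pick[OF that] p by (simp add: P_def)
  have transfer: "cj (P a b) (t b e) = P a e \<and> cj (P a b) (t a e) = P e b"
    if abe: "a \<in> V" "b \<in> V" "e \<in> V" "distinct [a, b, e]" for a b e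
  proof
    obtain \<sigma> where \<sigma>: "\<sigma> permutes V" "map \<sigma> [\<alpha>, \<beta>, c] = [a, b, e]"
      using permutation_extending_lists[of "[\<alpha>, \<beta>, c]" "[a, b, e]" V] assms abe by auto
    \<comment> \<open>The braid relation exchanges the roles: \<open>p\<close> conjugating
      \<open>t \<beta> c\<close> equals \<open>t \<beta> c\<close> conjugating \<open>p\<close>, and
      the latter is given by equivariance.\<close>
    have "cj p (t \<beta> c) = P \<alpha> c"
      using assms acP[of "transpose \<beta> c" \<alpha> \<beta>] by (auto simp: braid_def cj_t Pb permutes_swap_id)
    then have "ac \<sigma> (cj p (t \<beta> c)) = ac \<sigma> (P \<alpha> c)" by simp
    moreover have "\<alpha> \<noteq> c" "c \<in> V" using assms by auto
    ultimately show "cj (P a b) (t b e) = P a e"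
      using \<sigma> assms by (simp add: ac_cj ac_t acP acP' p ab)
    obtain \<tau> where \<tau>: "\<tau> permutes V" "map \<tau> [\<alpha>, \<beta>, d] = [a, b, e]"
      using permutation_extending_lists[of "[\<alpha>, \<beta>, d]" "[a, b, e]" V] assms abe by auto
    have "cj p (t \<alpha> d) = P d \<beta>"
      using assms acP[of "transpose \<alpha> d" \<alpha> \<beta>] by (auto simp: braid_def cj_t Pb permutes_swap_id)
    then have "ac \<tau> (cj p (t \<alpha> d)) = ac \<tau> (P d \<beta>)" by simp
    moreover have "d \<noteq> \<beta>" "d \<in> V" using assms by auto
    ultimately show "cj (P a b) (t a e) = P e b"
      using \<tau> assms by (simp add: ac_cj ac_t acP acP' p ab)
  qed
  have "lift_family G V s P"
  proof
    fix a b assume "a \<in> V" "b \<in> V" "a \<noteq> b"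
    then show "P a b \<otimes> P a b = \<one>"
      using pick p by (simp add: P_def ac_mult[symmetric] ac_one)
  qed (use acP cP transfer in auto)
  with Pb that show thesis by blast
qed

section \<open>Cocycles and the central element\<close>

context group
begin

lemma commutes_sym: "commutes x y \<Longrightarrow> commutes y x"
  by (simp add: commutes_def)

lemma commutes_mult:
  "\<lbrakk>commutes x y; commutes x z; x \<in> carrier G; y \<in> carrier G; z \<in> carrier G\<rbrakk> \<Longrightarrow> commutes x (y \<otimes> z)"
  unfolding commutes_def by (metis m_assoc)

lemma commutes_inv:
  "\<lbrakk>commutes x y; x \<in> carrier G; y \<in> carrier G\<rbrakk> \<Longrightarrow> commutes x (inv y)"
  unfolding commutes_def by (metis inv_closed inv_solve_left inv_solve_right m_assoc m_closed)

lemma centralizer_subgroup: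
  assumes "x \<in> carrier G" shows "subgroup {y \<in> carrier G. commutes x y} G"
proof (rule subgroupI)
  have "\<one> \<in> {y \<in> carrier G. commutes x y}" using assms by (simp add: commutes_def)
  then show "{y \<in> carrier G. commutes x y} \<noteq> {}" by blast
qed (use assms in \<open>auto simp: commutes_mult commutes_inv\<close>)

lemma inv_mult_cancel: "x \<in> carrier G \<Longrightarrow> y \<in> carrier G \<Longrightarrow> x \<otimes> (inv x \<otimes> y) = y"
  by (simp add: m_assoc[symmetric])

lemma swap_sides:
  assumes "a \<otimes> b = c \<otimes> d" "a \<in> carrier G" "b \<in> carrier G" "c \<in> carrier G" "d \<in> carrier G"
  shows "inv c \<otimes> a = d \<otimes> inv b"
proof -
  have "inv c \<otimes> a = inv c \<otimes> (a \<otimes> b) \<otimes> inv b" using assms(2-) by (simp add: m_assoc)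
  also have "\<dots> = d \<otimes> inv b" unfolding assms(1) using assms(2-) by (simp add: m_assoc[symmetric])
  finally show ?thesis .
qed

lemma commutator_flip:
  assumes "y \<otimes> g = g \<otimes> (y \<otimes> w)" "y \<in> carrier G" "g \<in> carrier G" "w \<in> carrier G"
  shows "g \<otimes> y = y \<otimes> (g \<otimes> inv w)"
proof -
  have "y \<otimes> (g \<otimes> inv w) = (y \<otimes> g) \<otimes> inv w" using assms(2-) by (simp add: m_assoc)
  also have "\<dots> = g \<otimes> y" unfolding assms(1) using assms(2-) by (simp add: m_assoc)
  finally show ?thesis by simp
qed

lemma commutes_int_pow:
  "\<lbrakk>commutes x y; x \<in> carrier G; y \<in> carrier G\<rbrakk> \<Longrightarrow> commutes x (y [^] (k::int))"
  using subgroup_int_pow_closed[OF centralizer_subgroup, of x y k] by simp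

text \<open>Additivity is demanded for both orders of the product, since the group is not abelian;
  comparing the two orders is what gives \<open>cocycle_commutes\<close>.\<close>

definition cocycle :: "'v set \<Rightarrow> ('v \<Rightarrow> 'v \<Rightarrow> 'a) \<Rightarrow> bool" where
  "cocycle V d \<longleftrightarrow>
     (\<forall>a\<in>V. \<forall>b\<in>V. a \<noteq> b \<longrightarrow> d a b \<in> carrier G \<and> d b a = inv (d a b)) \<and>
     (\<forall>a\<in>V. \<forall>b\<in>V. \<forall>c\<in>V. distinct [a, b, c] \<longrightarrow> d a b \<otimes> d b c = d a c \<and> d b c \<otimes> d a b = d a c)"

lemma cocycleD:
  assumes "cocycle V d"
  shows "a \<in> V \<Longrightarrow> b \<in> V \<Longrightarrow> a \<noteq> b \<Longrightarrow> d a b \<in> carrier G"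
    and "a \<in> V \<Longrightarrow> b \<in> V \<Longrightarrow> a \<noteq> b \<Longrightarrow> d b a = inv (d a b)"
    and "a \<in> V \<Longrightarrow> b \<in> V \<Longrightarrow> c \<in> V \<Longrightarrow> distinct [a, b, c] \<Longrightarrow> d a b \<otimes> d b c = d a c"
    and "a \<in> V \<Longrightarrow> b \<in> V \<Longrightarrow> c \<in> V \<Longrightarrow> distinct [a, b, c] \<Longrightarrow> d b c \<otimes> d a b = d a c"
  using assms unfolding cocycle_def by blast+

text \<open>Consecutive values commute because both orders have the same product. Reversing one
  value handles pairs with a common start, and a detour through \<open>b\<close> handles disjoint
  pairs.\<close>

lemma cocycle_commutes:
  assumes d: "cocycle V d" and "a \<in> V" "b \<in> V" "c \<in> V" "e \<in> V" "distinct [a, b, c, e]"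
  shows "commutes (d a b) (d a c)" "commutes (d a b) (d c e)"
proof -
  have 1: "commutes (d a b) (d b c)" if "a \<in> V" "b \<in> V" "c \<in> V" "distinct [a, b, c]" for a b c
    unfolding commutes_def using cocycleD(3,4)[OF d] that by metis
  have "commutes (d a c) (d b a)" using 1[of b a c] assms by (auto intro: commutes_sym)
  then have "commutes (d a c) (inv (d b a))" using assms cocycleD(1)[OF d] by (intro commutes_inv) auto
  then show "commutes (d a b) (d a c)"
    using cocycleD(2)[OF d, of b a] assms by (auto intro: commutes_sym)
  have 2: "commutes (d a b) (d b e)" using 1 assms by simp
  have "commutes (d a b) (inv (d b c))"
    using assms cocycleD(1)[OF d] by (intro commutes_inv 1) auto
  then have "commutes (d a b) (d c b)" using cocycleD(2)[OF d, of b c] assms by auto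
  then have "commutes (d a b) (d c b \<otimes> d b e)"
    using 2 assms cocycleD(1)[OF d] by (intro commutes_mult) auto
  then show "commutes (d a b) (d c e)" using cocycleD(3)[OF d, of c b e] assms by auto
qed

lemma fresh_element:
  assumes "finite V" "length xs < card V"
  obtains v where "v \<in> V" "v \<notin> set xs"
  using assms card_length[of xs] card_mono[of "set xs" V]
  by (metis List.finite_set leD le_less_trans subsetI)

text \<open>The hypothesis on \<open>dy b a \<otimes> dy c d\<close> says that the commutator of \<open>dx\<close> and \<open>dy\<close> at the vertex \<open>a\<close>
  equals that at \<open>d\<close>; a commutator that does not depend on the vertex commutes with everything
  supported away from some vertex, hence with everything.\<close>
lemma central_commutator_exists:
  fixes V :: "'v set"
  assumes V: "finite V" "7 \<le> card V" and dx: "cocycle V dx" and dy: "cocycle V dy"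
    and comm: "\<And>a b c d. \<lbrakk>a \<in> V; b \<in> V; c \<in> V; d \<in> V; distinct [a, b, c, d]\<rbrakk> \<Longrightarrow> commutes (dx a b) (dy c d)"
    and final: "\<And>a b c d. \<lbrakk>a \<in> V; b \<in> V; c \<in> V; d \<in> V; distinct [a, b, c, d]\<rbrakk> \<Longrightarrow>
       commutes (dx a d) (dy b a \<otimes> dy c d)"
  obtains z where "z \<in> carrier G"
    "\<And>a b. \<lbrakk>a \<in> V; b \<in> V; a \<noteq> b\<rbrakk> \<Longrightarrow> commutes z (dx a b) \<and> commutes z (dy a b)"
    "\<And>a b c. \<lbrakk>a \<in> V; b \<in> V; c \<in> V; distinct [a, b, c]\<rbrakk> \<Longrightarrow>
       dx a c \<otimes> dy b a = dy b a \<otimes> dx a c \<otimes> z"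
proof -
  note Xc [simp] = cocycleD(1)[OF dx] and Yc [simp] = cocycleD(1)[OF dy]
  \<comment> \<open>The commutator of an x-translation and a y-translation that share the single
    vertex \<open>a\<close>; the other ends \<open>e\<close> and \<open>b\<close> are
    auxiliary.\<close>
  define \<zeta> where "\<zeta> a e b = inv (dy b a \<otimes> dx a e) \<otimes> (dx a e \<otimes> dy b a)" for a e b
  have \<zeta>c: "\<zeta> a e b \<in> carrier G" if "a \<in> V" "e \<in> V" "b \<in> V" "distinct [a, e, b]" for a e b
    using that by (auto simp: \<zeta>_def)
  \<comment> \<open>Splitting \<open>dx a d\<close> at \<open>e\<close> turns the hypothesis
    \<open>final\<close> into an exchange between the commutator at \<open>a\<close> and the one at
    \<open>d\<close>. The right-hand side no longer mentions \<open>a\<close> or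
    \<open>b\<close>.\<close>
  have step: "\<zeta> a e b = (dy c d \<otimes> dx e d) \<otimes> inv (dx e d \<otimes> dy c d)"
    if *: "a \<in> V" "e \<in> V" "b \<in> V" "c \<in> V" "d \<in> V" "distinct [a, e, b, c, d]" for a e b c d
  proof -
    have C: "dx a e \<in> carrier G" "dx e d \<in> carrier G" "dy b a \<in> carrier G" "dy c d \<in> carrier G"
      using * by auto
    have "commutes (dx e d) (dy b a)" "commutes (dx a e) (dy c d)" "dx a d = dx a e \<otimes> dx e d"
      "commutes (dx a d) (dy b a \<otimes> dy c d)"
      using comm[of e d b a] comm[of a e c d] cocycleD(3)[OF dx, of a e d] final[of a b c d] * by auto
    then have h: "dx e d \<otimes> dy b a = dy b a \<otimes> dx e d" "dx a e \<otimes> dy c d = dy c d \<otimes> dx a e"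
      "(dx a e \<otimes> dx e d) \<otimes> (dy b a \<otimes> dy c d) = (dy b a \<otimes> dy c d) \<otimes> (dx a e \<otimes> dx e d)"
      by (simp_all add: commutes_def)
    have "(dx a e \<otimes> dy b a) \<otimes> (dx e d \<otimes> dy c d) = dx a e \<otimes> (dy b a \<otimes> dx e d) \<otimes> dy c d"
      using C by (simp add: m_assoc)
    also have "\<dots> = (dx a e \<otimes> dx e d) \<otimes> (dy b a \<otimes> dy c d)"
      unfolding h(1)[symmetric] using C by (simp add: m_assoc)
    also have "\<dots> = dy b a \<otimes> (dy c d \<otimes> dx a e) \<otimes> dx e d"
      unfolding h(3) using C by (simp add: m_assoc)
    also have "\<dots> = (dy b a \<otimes> dx a e) \<otimes> (dy c d \<otimes> dx e d)"
      unfolding h(2)[symmetric] using C by (simp add: m_assoc)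
    finally show ?thesis unfolding \<zeta>_def using C by (intro swap_sides) auto
  qed
  have indep1: "\<zeta> a e b = \<zeta> a' e b'"
    if *: "a \<in> V" "e \<in> V" "b \<in> V" "distinct [a, e, b]" "a' \<in> V" "b' \<in> V" "distinct [a', e, b']" for a e b a' b'
  proof -
    \<comment> \<open>Up to five vertices are in play and two more are taken outside them, whence
      the bound \<open>7 \<le> card V\<close>.\<close>
    obtain c where c: "c \<in> V" "c \<notin> set [a, e, b, a', b']"
      using fresh_element[OF V(1), of "[a, e, b, a', b']"] V(2) by auto
    obtain d where d: "d \<in> V" "d \<notin> set [a, e, b, a', b', c]"
      using fresh_element[OF V(1), of "[a, e, b, a', b', c]"] V(2) by auto
    show ?thesis using step[of a e b c d] step[of a' e b' c d] c d * by auto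
  qed
  \<comment> \<open>Moving the far end from \<open>e\<close> to \<open>e'\<close> multiplies by
    \<open>dx e e'\<close>, which commutes with \<open>dy b a\<close> and cancels from the
    commutator.\<close>
  have indep2: "\<zeta> a e b = \<zeta> a e' b"
    if *: "a \<in> V" "e \<in> V" "b \<in> V" "e' \<in> V" "distinct [a, e, b, e']" for a e b e'
  proof -
    have C: "dx a e \<in> carrier G" "dx e e' \<in> carrier G" "dy b a \<in> carrier G" using * by auto
    have 1: "dx e e' \<otimes> dy b a = dy b a \<otimes> dx e e'" "dx a e' = dx e e' \<otimes> dx a e"
      using comm[of e e' b a] cocycleD(4)[OF dx, of a e e'] * by (auto simp: commutes_def)
    then have 2: "dy b a \<otimes> dx a e' = dx e e' \<otimes> (dy b a \<otimes> dx a e)" "dx a e' \<otimes> dy b a = dx e e' \<otimes> (dx a e \<otimes> dy b a)"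
      using C by (metis m_assoc)+
    have "inv (g \<otimes> h) \<otimes> (g \<otimes> k) = inv h \<otimes> k" if "g \<in> carrier G" "h \<in> carrier G" "k \<in> carrier G" for g h k
    proof -
      have "inv (g \<otimes> h) \<otimes> (g \<otimes> k) = inv h \<otimes> (inv g \<otimes> g) \<otimes> k"
        using that by (simp only: inv_mult_group m_assoc m_closed inv_closed)
      then show ?thesis using that by simp
    qed
    then show ?thesis unfolding \<zeta>_def 2 using C by simp
  qed
  have indep: "\<zeta> a e b = \<zeta> a' e' b'"
    if *: "a \<in> V" "e \<in> V" "b \<in> V" "distinct [a, e, b]" "a' \<in> V" "e' \<in> V" "b' \<in> V" "distinct [a', e', b']"
    for a e b a' e' b'
  proof -
    obtain c where c: "c \<in> V" "c \<notin> set [e, e']"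
      using fresh_element[OF V(1), of "[e, e']"] V(2) by auto
    obtain d where d: "d \<in> V" "d \<notin> set [e, e', c]"
      using fresh_element[OF V(1), of "[e, e', c]"] V(2) by auto
    have "\<zeta> a e b = \<zeta> c e d" "\<zeta> a' e' b' = \<zeta> c e' d"
      by (rule indep1; use * c d in auto)+
    moreover have "\<zeta> c e d = \<zeta> c e' d" using indep2[of c e d e'] * c d by (cases "e = e'") auto
    ultimately show ?thesis by simp
  qed
  obtain a where a: "a \<in> V" "a \<notin> set []" using fresh_element[OF V(1), of "[]"] V(2) by auto
  obtain b where b: "b \<in> V" "b \<notin> set [a]" using fresh_element[OF V(1), of "[a]"] V(2) by auto
  obtain e where e: "e \<in> V" "e \<notin> set [a, b]" using fresh_element[OF V(1), of "[a, b]"] V(2) by auto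
  define z where "z = \<zeta> a e b"
  have z: "\<zeta> a' e' b' = z" if "a' \<in> V" "e' \<in> V" "b' \<in> V" "distinct [a', e', b']" for a' e' b'
    unfolding z_def by (rule indep; use that a b e in auto)
  show thesis
  proof
    show "z \<in> carrier G" unfolding z_def using \<zeta>c a b e by auto
  next
    fix f g assume fg: "f \<in> V" "g \<in> V" "f \<noteq> g"
    \<comment> \<open>The commutator can be written with vertices away from \<open>f\<close> and
      \<open>g\<close>; every factor then commutes with the translations between \<open>f\<close>
      and \<open>g\<close>.\<close>
    obtain a where a: "a \<in> V" "a \<notin> set [f, g]" using fresh_element[OF V(1), of "[f, g]"] V(2) by auto
    obtain b where b: "b \<in> V" "b \<notin> set [f, g, a]" using fresh_element[OF V(1), of "[f, g, a]"] V(2) by auto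
    obtain e where e: "e \<in> V" "e \<notin> set [f, g, a, b]" using fresh_element[OF V(1), of "[f, g, a, b]"] V(2) by auto
    have ze: "z = inv (dy b a \<otimes> dx a e) \<otimes> (dx a e \<otimes> dy b a)"
      using z[of a e b] a b e by (auto simp: \<zeta>_def)
    have C: "dx a e \<in> carrier G" "dy b a \<in> carrier G" "dx f g \<in> carrier G" "dy f g \<in> carrier G"
      using a b e fg by auto
    have "commutes (dx f g) (dx a e)" "commutes (dx f g) (dy b a)"
      "commutes (dy f g) (dx a e)" "commutes (dy f g) (dy b a)"
      using cocycle_commutes(2)[OF dx, of f g a e] comm[of f g b a] comm[of a e f g, THEN commutes_sym]
        cocycle_commutes(2)[OF dy, of f g b a] a b e fg by auto
    then have "commutes (dx f g) z" "commutes (dy f g) z" unfolding ze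
      using C by (auto intro!: commutes_mult commutes_inv)
    then show "commutes z (dx f g) \<and> commutes z (dy f g)" by (auto intro: commutes_sym)
  next
    fix a b c assume *: "a \<in> V" "b \<in> V" "c \<in> V" "distinct [a, b, c]"
    then have "z = inv (dy b a \<otimes> dx a c) \<otimes> (dx a c \<otimes> dy b a)"
      using z[of a c b] by (auto simp: \<zeta>_def)
    then show "dx a c \<otimes> dy b a = dy b a \<otimes> dx a c \<otimes> z"
      using * by (auto simp: inv_mult_cancel)
  qed
qed

section \<open>Normal forms\<close>

definition pp :: "('i \<Rightarrow> 'a) \<Rightarrow> ('i \<Rightarrow> int) \<Rightarrow> 'i list \<Rightarrow> 'a" where
  "pp x f is = foldr (\<lambda>i g. x i [^] f i \<otimes> g) is \<one>"

lemma pp_simps [simp]: "pp x f [] = \<one>" "pp x f (i # is) = x i [^] f i \<otimes> pp x f is"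
  by (simp_all add: pp_def)

lemma pp_closed [simp]: "x \<in> set is \<rightarrow> carrier G \<Longrightarrow> pp x f is \<in> carrier G"
  by (induction "is") auto

lemma pp_cong: "(\<And>i. i \<in> set is \<Longrightarrow> f i = g i) \<Longrightarrow> pp x f is = pp x g is"
  by (induction "is") auto

lemma pp_zero: "(\<And>i. i \<in> set is \<Longrightarrow> f i = 0) \<Longrightarrow> pp x f is = \<one>"
  by (induction "is") auto

lemma pp_in_subgroup: "subgroup H G \<Longrightarrow> (\<And>i. i \<in> set is \<Longrightarrow> x i \<in> H) \<Longrightarrow> pp x f is \<in> H"
  by (induction "is") (auto simp: subgroup.one_closed subgroup.m_closed subgroup_int_pow_closed)

lemma pp_update:
  assumes "x \<in> set is \<rightarrow> carrier G" "\<And>i j. i \<in> set is \<Longrightarrow> j \<in> set is \<Longrightarrow> commutes (x i) (x j)"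
    and "distinct is" "i \<in> set is"
  shows "x i [^] k \<otimes> pp x f is = pp x (f(i := k + f i)) is"
  using assms
proof (induction "is")
  case (Cons j "is")
  have C: "x i \<in> carrier G" "x j \<in> carrier G" "pp x f is \<in> carrier G" using Cons.prems by (auto simp: Pi_iff)
  show ?case
  proof (cases "i = j")
    case True
    then have "pp x (f(i := k + f i)) is = pp x f is" using Cons.prems by (intro pp_cong) auto
    then have "pp x (f(i := k + f i)) (j # is) = x i [^] (k + f i) \<otimes> pp x f is" using True by simp
    also have "\<dots> = x i [^] k \<otimes> pp x f (j # is)" using True C by (simp add: m_assoc int_pow_mult)
    finally show ?thesis ..
  next
    case False
    have "commutes (x j) (x i)" using Cons.prems(2)[of j i] Cons.prems(4) by simp
    then have "commutes (x j) (x i [^] k)" using C by (intro commutes_int_pow) auto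
    then have "commutes (x i [^] k) (x j)" by (rule commutes_sym)
    then have "commutes (x i [^] k) (x j [^] f j)" using C by (intro commutes_int_pow) auto
    then have "x i [^] k \<otimes> (x j [^] f j \<otimes> pp x f is) = x j [^] f j \<otimes> (x i [^] k \<otimes> pp x f is)"
      using C by (simp add: commutes_def m_assoc[symmetric])
    also have "x i [^] k \<otimes> pp x f is = pp x (f(i := k + f i)) is"
      using Cons.prems False by (intro Cons.IH) auto
    finally show ?thesis using False by (simp add: fun_upd_def)
  qed
qed simp

text \<open>Commutation up to a power of \<open>z\<close> with a fixed \<open>y\<close> is inherited
  by products and inverses because \<open>z\<close> commutes with everything involved; the exponents
  add up.\<close>

lemma commutator_power_subgroup:
  assumes "y \<in> carrier G" "z \<in> carrier G" "commutes z y"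
  shows "subgroup {g \<in> carrier G. commutes z g \<and> (\<exists>k::int. y \<otimes> g = g \<otimes> (y \<otimes> z [^] k))} G" (is "subgroup ?H G")
proof (rule subgroupI)
  have "\<one> \<in> ?H" using assms by (auto simp: commutes_def intro: exI[of _ 0])
  then show "?H \<noteq> {}" by blast
next
  fix g assume "g \<in> ?H"
  then obtain k :: int where g: "g \<in> carrier G" "commutes z g" "y \<otimes> g = g \<otimes> (y \<otimes> z [^] k)" by auto
  have c: "inv (z [^] k) \<otimes> g = g \<otimes> inv (z [^] k)"
    using commutes_inv[OF commutes_int_pow[of g z k]] g assms by (simp add: commutes_def)
  have "inv g \<otimes> (y \<otimes> inv (z [^] k)) \<otimes> g = inv g \<otimes> (y \<otimes> (inv (z [^] k) \<otimes> g))"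
    using g assms by (simp add: m_assoc)
  also have "\<dots> = inv g \<otimes> (y \<otimes> g) \<otimes> inv (z [^] k)"
    unfolding c using g(1) assms by (simp add: m_assoc)
  also have "\<dots> = (inv g \<otimes> g) \<otimes> (y \<otimes> (z [^] k \<otimes> inv (z [^] k)))"
    unfolding g(3) using g(1) assms by (simp only: m_assoc m_closed inv_closed int_pow_closed)
  also have "\<dots> = y" using g assms by simp
  finally have "(inv g \<otimes> (y \<otimes> inv (z [^] k)) \<otimes> g) \<otimes> inv g = y \<otimes> inv g" by simp
  then have "y \<otimes> inv g = inv g \<otimes> (y \<otimes> z [^] (- k))"
    using g(1) assms by (simp add: int_pow_neg m_assoc)
  then show "inv g \<in> ?H" using g assms by (auto intro: commutes_inv)
next
  fix g h assume "g \<in> ?H" "h \<in> ?H"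
  then obtain k l :: int where g: "g \<in> carrier G" "commutes z g" "y \<otimes> g = g \<otimes> (y \<otimes> z [^] k)"
    and h: "h \<in> carrier G" "commutes z h" "y \<otimes> h = h \<otimes> (y \<otimes> z [^] l)" by auto
  have c: "z [^] k \<otimes> h = h \<otimes> z [^] k"
    using h assms commutes_int_pow[of h z k] by (auto simp: commutes_def)
  have "y \<otimes> (g \<otimes> h) = (y \<otimes> g) \<otimes> h" using g(1) h(1) assms by (simp add: m_assoc)
  also have "\<dots> = g \<otimes> (y \<otimes> (z [^] k \<otimes> h))"
    unfolding g(3) using g(1) h(1) assms by (simp add: m_assoc)
  also have "\<dots> = g \<otimes> ((y \<otimes> h) \<otimes> z [^] k)" unfolding c using g(1) h(1) assms by (simp add: m_assoc)
  also have "\<dots> = (g \<otimes> h) \<otimes> (y \<otimes> z [^] (l + k))"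
    unfolding h(3) using g(1) h(1) assms by (simp add: int_pow_mult m_assoc)
  finally show "g \<otimes> h \<in> ?H" using g h assms by (auto intro: commutes_mult)
qed auto

text \<open>Collection from the left: multiplying a normal form by one generator restores it, a
  power of \<open>y i\<close> being moved through the x-part at the cost of an unspecified power of
  \<open>z\<close>. Leaving that power unspecified is what allows generators such as differences of
  basis vectors, whose commutators need not be \<open>z\<close> itself.\<close>

lemma heisenberg_normal_form:
  assumes x: "x \<in> set is \<rightarrow> carrier G" "\<And>i j. i \<in> set is \<Longrightarrow> j \<in> set is \<Longrightarrow> commutes (x i) (x j)"
    and y: "y \<in> set is \<rightarrow> carrier G" "\<And>i j. i \<in> set is \<Longrightarrow> j \<in> set is \<Longrightarrow> commutes (y i) (y j)"
    and z: "z \<in> carrier G" "\<And>i. i \<in> set is \<Longrightarrow> commutes z (x i) \<and> commutes z (y i)"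
    and xy: "\<And>i j. i \<in> set is \<Longrightarrow> j \<in> set is \<Longrightarrow> \<exists>k::int. y j \<otimes> x i = x i \<otimes> (y j \<otimes> z [^] k)"
    and "distinct is" and g: "g \<in> generate G (x ` set is \<union> y ` set is \<union> {z})"
  shows "\<exists>f h k. g = pp x f is \<otimes> (pp y h is \<otimes> z [^] (k::int))"
proof -
  have gens: "x ` set is \<union> y ` set is \<union> {z} \<subseteq> carrier G" using x y z by auto
  note C [simp] = pp_closed[OF x(1)] pp_closed[OF y(1)]
  have zpp: "commutes z (pp x f is)" "commutes z (pp y f is)" for f
    using pp_in_subgroup[OF centralizer_subgroup[OF z(1)], of "is" x f]
      pp_in_subgroup[OF centralizer_subgroup[OF z(1)], of "is" y f] x(1) y(1) z(2) by (auto simp: Pi_iff)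
  have left_x: "\<exists>f' h' k'. x i [^] (l::int) \<otimes> (pp x f is \<otimes> (pp y h is \<otimes> z [^] (k::int)))
      = pp x f' is \<otimes> (pp y h' is \<otimes> z [^] (k'::int))" if "i \<in> set is" for i l f h k
  proof -
    have "x i \<in> carrier G" using x that by auto
    then have "x i [^] l \<otimes> (pp x f is \<otimes> (pp y h is \<otimes> z [^] k)) =
        pp x (f(i := l + f i)) is \<otimes> (pp y h is \<otimes> z [^] k)"
      using z(1) by (simp add: m_assoc[symmetric] pp_update[OF x \<open>distinct is\<close> that])
    then show ?thesis by blast
  qed
  have left_y: "\<exists>f' h' k'. y i [^] (l::int) \<otimes> (pp x f is \<otimes> (pp y h is \<otimes> z [^] (k::int)))
      = pp x f' is \<otimes> (pp y h' is \<otimes> z [^] (k'::int))" if i: "i \<in> set is" for i l f h k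
  proof -
    have yc: "y i \<in> carrier G" and zy: "commutes z (y i)" using y z i by auto
    have "pp x f is \<in> {g \<in> carrier G. commutes z g \<and> (\<exists>k::int. y i \<otimes> g = g \<otimes> (y i \<otimes> z [^] k))}"
      by (rule pp_in_subgroup[OF commutator_power_subgroup]) (use yc zy z x xy i in auto)
    then obtain k0 :: int where "y i \<otimes> pp x f is = pp x f is \<otimes> (y i \<otimes> z [^] k0)" by auto
    then have "pp x f is \<otimes> y i = y i \<otimes> (pp x f is \<otimes> z [^] (- k0))"
      using commutator_flip[of "y i" "pp x f is" "z [^] k0"] yc z by (simp add: int_pow_neg)
    moreover have "commutes z (pp x f is)" by (rule zpp)
    \<comment> \<open>The subgroup of \<open>commutator_power_subgroup\<close> is used a second time
      with the roles exchanged: the x-part is now the fixed element, and membership passes from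
      \<open>y i\<close> to its powers.\<close>
    ultimately have "y i \<in> {g \<in> carrier G. commutes z g \<and> (\<exists>k::int. pp x f is \<otimes> g = g \<otimes> (pp x f is \<otimes> z [^] k))}"
      using yc zy by blast
    then have "y i [^] l \<in> {g \<in> carrier G. commutes z g \<and> (\<exists>k::int. pp x f is \<otimes> g = g \<otimes> (pp x f is \<otimes> z [^] k))}"
      by (rule subgroup_int_pow_closed[OF commutator_power_subgroup[OF C(1) z(1) zpp(1)]])
    then obtain k1 :: int where k1: "pp x f is \<otimes> y i [^] l = y i [^] l \<otimes> (pp x f is \<otimes> z [^] k1)" by auto
    have Z': "z [^] (-k1) \<otimes> (pp y h' is) = pp y h' is \<otimes> z [^] (-k1)" for h'
      using commutes_int_pow[OF commutes_sym[OF zpp(2)], of h' "-k1"] z by (simp add: commutes_def)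
    have flip: "y i [^] l \<otimes> pp x f is = pp x f is \<otimes> (y i [^] l \<otimes> z [^] (- k1))"
      using commutator_flip[OF k1] yc z by (simp add: int_pow_neg)
    have "y i [^] l \<otimes> (pp x f is \<otimes> (pp y h is \<otimes> z [^] k)) =
        (y i [^] l \<otimes> pp x f is) \<otimes> (pp y h is \<otimes> z [^] k)"
      using yc z by (simp add: m_assoc)
    also have "\<dots> = pp x f is \<otimes> (y i [^] l \<otimes> (z [^] (- k1) \<otimes> pp y h is) \<otimes> z [^] k)"
      unfolding flip using yc z by (simp add: m_assoc)
    also have "\<dots> = pp x f is \<otimes> ((y i [^] l \<otimes> pp y h is) \<otimes> z [^] (- k1 + k))"
      unfolding Z' int_pow_mult[OF z(1)] using yc z by (simp add: m_assoc)
    also have "\<dots> = pp x f is \<otimes> (pp y (h(i := l + h i)) is \<otimes> z [^] (- k1 + k))"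
      by (simp add: pp_update[OF y \<open>distinct is\<close> i])
    finally show ?thesis by blast
  qed
  have left_z: "\<exists>f' h' k'. z [^] (l::int) \<otimes> (pp x f is \<otimes> (pp y h is \<otimes> z [^] (k::int)))
      = pp x f' is \<otimes> (pp y h' is \<otimes> z [^] (k'::int))" for l f h k
  proof -
    have "commutes (pp x f is \<otimes> pp y h is) (z [^] l)"
      using z zpp by (intro commutes_int_pow commutes_sym[OF commutes_mult]) auto
    then have "z [^] l \<otimes> (pp x f is \<otimes> (pp y h is \<otimes> z [^] k)) = pp x f is \<otimes> (pp y h is \<otimes> z [^] (l + k))"
      using z by (simp add: commutes_def int_pow_mult m_assoc[symmetric])
    then show ?thesis by blast
  qed
  have pow1: "a [^] (1::int) = a" "a [^] (-1::int) = inv a" if "a \<in> carrier G" for a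
    using that int_pow_neg[of a 1] by (simp_all add: int_pow_1)
  show ?thesis
  proof (rule generate_closed_under_mult[OF g gens], goal_cases)
    case 1
    show ?case by (intro exI[of _ "\<lambda>_. 0"] exI[of _ 0]) (simp add: pp_zero)
  next
    case (2 s g)
    then have "s [^] (1::int) = s" using gens pow1 by blast
    with 2 show ?case using left_x[of _ 1] left_y[of _ 1] left_z[of 1] by fastforce
  next
    case (3 s g)
    then have "s [^] (-1::int) = inv s" using gens pow1 by blast
    with 3 show ?case using left_x[of _ "-1"] left_y[of _ "-1"] left_z[of "-1"] by fastforce
  qed
qed

end

section \<open>The Heisenberg model\<close>

lemma group_sdprod:
  assumes "group G" "group N"
    and closed: "\<And>g n. g \<in> carrier G \<Longrightarrow> n \<in> carrier N \<Longrightarrow> \<phi> g n \<in> carrier N"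
    and mult: "\<And>g m n. \<lbrakk>g \<in> carrier G; m \<in> carrier N; n \<in> carrier N\<rbrakk> \<Longrightarrow>
       \<phi> g (m \<otimes>\<^bsub>N\<^esub> n) = \<phi> g m \<otimes>\<^bsub>N\<^esub> \<phi> g n"
    and comp: "\<And>g h n. \<lbrakk>g \<in> carrier G; h \<in> carrier G; n \<in> carrier N\<rbrakk> \<Longrightarrow>
       \<phi> (g \<otimes>\<^bsub>G\<^esub> h) n = \<phi> g (\<phi> h n)"
    and one: "\<And>n. n \<in> carrier N \<Longrightarrow> \<phi> \<one>\<^bsub>G\<^esub> n = n"
  shows "group (sdprod G N \<phi>)"
proof -
  interpret G: group G by fact
  interpret N: group N by fact
  show ?thesis
  proof (rule groupI, goal_cases)
    case (5 x)
    then obtain g n where x: "x = (g, n)" "g \<in> carrier G" "n \<in> carrier N" by (auto simp: sdprod_def)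
    let ?y = "(inv\<^bsub>G\<^esub> g, \<phi> (inv\<^bsub>G\<^esub> g) (inv\<^bsub>N\<^esub> n))"
    have "\<phi> (inv\<^bsub>G\<^esub> g) (inv\<^bsub>N\<^esub> n) \<otimes>\<^bsub>N\<^esub> \<phi> (inv\<^bsub>G\<^esub> g) n = \<phi> (inv\<^bsub>G\<^esub> g) \<one>\<^bsub>N\<^esub>"
      using x by (simp add: mult[symmetric])
    also have "\<phi> (inv\<^bsub>G\<^esub> g) \<one>\<^bsub>N\<^esub> = \<one>\<^bsub>N\<^esub>"
    proof -
      have "\<phi> (inv\<^bsub>G\<^esub> g) \<one>\<^bsub>N\<^esub> \<otimes>\<^bsub>N\<^esub> \<phi> (inv\<^bsub>G\<^esub> g) \<one>\<^bsub>N\<^esub> = \<phi> (inv\<^bsub>G\<^esub> g) \<one>\<^bsub>N\<^esub>"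
        using x by (simp add: mult[symmetric])
      then show ?thesis using x closed by simp
    qed
    finally have "?y \<otimes>\<^bsub>sdprod G N \<phi>\<^esub> x = \<one>\<^bsub>sdprod G N \<phi>\<^esub>"
      using x by (simp add: sdprod_def)
    moreover have "?y \<in> carrier (sdprod G N \<phi>)" using x closed by (simp add: sdprod_def)
    ultimately show ?case by blast
  qed (auto simp: sdprod_def closed mult comp one G.m_assoc N.m_assoc)
qed

type_synonym heis_elt = "(nat \<Rightarrow> int) \<times> (nat \<Rightarrow> int) \<times> int"

text \<open>Read \<open>(a, b, c)\<close> as the monomial \<open>y^b x^a z^c\<close> in multi-index
  notation. In a product the left x-part must pass the right y-part, which contributes the sum of
  \<open>a i * b' i\<close> to the exponent of \<open>z\<close>.\<close>

definition heis :: "heis_elt monoid" where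
  "heis = \<lparr> carrier = {(a, b, c). \<forall>i. i \<notin> {1..18} \<longrightarrow> a i = 0 \<and> b i = 0},
     monoid.mult = (\<lambda>(a, b, c) (a', b', c').
       (\<lambda>i. a i + a' i, \<lambda>i. b i + b' i, c + c' + (\<Sum>i\<in>{1..18}. a i * b' i))),
     one = (\<lambda>_. 0, \<lambda>_. 0, 0) \<rparr>"

lemma heis_simps:
  "(a, b, c) \<in> carrier heis \<longleftrightarrow> (\<forall>i. i \<notin> {1..18} \<longrightarrow> a i = 0 \<and> b i = 0)"
  "(a, b, c) \<otimes>\<^bsub>heis\<^esub> (a', b', c') =
     (\<lambda>i. a i + a' i, \<lambda>i. b i + b' i, c + c' + (\<Sum>i\<in>{1..18}. a i * b' i))"
  "\<one>\<^bsub>heis\<^esub> = (\<lambda>_. 0, \<lambda>_. 0, 0)"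
  by (auto simp: heis_def)

lemma heis_group: "group heis"
proof (rule groupI, goal_cases)
  case (5 x)
  obtain a b c where x: "x = (a, b, c)" by (cases x)
  have "(\<lambda>i. - a i, \<lambda>i. - b i, (\<Sum>i\<in>{1..18}. a i * b i) - c) \<otimes>\<^bsub>heis\<^esub> x = \<one>\<^bsub>heis\<^esub>"
    by (simp add: x heis_simps sum_negf)
  moreover have "(\<lambda>i. - a i, \<lambda>i. - b i, (\<Sum>i\<in>{1..18}. a i * b i) - c) \<in> carrier heis"
    using 5 by (simp add: x heis_simps)
  ultimately show ?case by blast
qed (auto simp: heis_simps fun_eq_iff algebra_simps sum.distrib)

text \<open>The inverse makes this a left action: the entry at \<open>i\<close> moves to
  \<open>\<sigma> i\<close>, in accordance with sending the i-th generator to the one at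
  \<open>\<sigma> i\<close>.\<close>

definition hperm :: "(nat \<Rightarrow> nat) \<Rightarrow> heis_elt \<Rightarrow> heis_elt" where
  "hperm \<sigma> = (\<lambda>(a, b, c). (a \<circ> inv_into UNIV \<sigma>, b \<circ> inv_into UNIV \<sigma>, c))"

lemma hperm_simp: "hperm \<sigma> (a, b, c) = (a \<circ> inv_into UNIV \<sigma>, b \<circ> inv_into UNIV \<sigma>, c)"
  by (simp add: hperm_def)

definition MM :: "((nat \<Rightarrow> nat) \<times> heis_elt) monoid" where
  "MM = sdprod (sym_group 18) heis hperm"

lemma MM_simps:
  "(\<sigma>, n) \<in> carrier MM \<longleftrightarrow> \<sigma> permutes {1..18} \<and> n \<in> carrier heis"
  "(\<sigma>, n) \<otimes>\<^bsub>MM\<^esub> (\<tau>, m) = (\<sigma> \<circ> \<tau>, n \<otimes>\<^bsub>heis\<^esub> hperm \<sigma> m)"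
  "\<one>\<^bsub>MM\<^esub> = (id, \<one>\<^bsub>heis\<^esub>)"
  by (auto simp: MM_def sdprod_def sym_group_carrier sym_group_mult sym_group_one)

lemma hperm_heis:
  assumes "\<sigma> permutes {1..18}"
  shows "n \<in> carrier heis \<Longrightarrow> hperm \<sigma> n \<in> carrier heis"
    and "hperm \<sigma> (m \<otimes>\<^bsub>heis\<^esub> n) = hperm \<sigma> m \<otimes>\<^bsub>heis\<^esub> hperm \<sigma> n"
proof -
  have i: "inv_into UNIV \<sigma> permutes {1..18}" using assms by (rule permutes_inv)
  show "n \<in> carrier heis \<Longrightarrow> hperm \<sigma> n \<in> carrier heis"
    using permutes_in_image[OF i] by (cases n) (auto simp: hperm_simp heis_simps)
  obtain a b c a' b' c' where "m = (a, b, c)" "n = (a', b', c')" by (cases m, cases n) auto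
  then show "hperm \<sigma> (m \<otimes>\<^bsub>heis\<^esub> n) = hperm \<sigma> m \<otimes>\<^bsub>heis\<^esub> hperm \<sigma> n"
    using sum.permute[OF i, of "\<lambda>i. a i * b' i"]
    by (auto simp: hperm_simp heis_simps fun_eq_iff comp_def)
qed

lemma hperm_comp:
  assumes "\<sigma> permutes {1..18}" "\<tau> permutes {1..18}"
  shows "hperm (\<sigma> \<circ> \<tau>) n = hperm \<sigma> (hperm \<tau> n)"
  using assms by (cases n) (simp add: hperm_simp o_inv_distrib permutes_bij comp_assoc)

lemma hperm_id [simp]: "hperm id n = n"
  by (cases n) (simp add: hperm_simp)

lemma MM_group: "group MM"
  unfolding MM_def
  by (rule group_sdprod[OF sym_group_is_group heis_group])
     (auto simp: sym_group_carrier sym_group_mult sym_group_one hperm_heis hperm_comp)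

interpretation MM: group MM by (rule MM_group)

text \<open>In matrix terms this is the monomial transposition matrix with entries \<open>h\<close> and \<open>h\<inverse>\<close>, for a lift
  \<open>h\<close> of \<open>(m, n)\<close> to the Heisenberg group; the central ambiguity of the lift cancels.\<close>
definition lift_transp :: "nat \<Rightarrow> nat \<Rightarrow> int \<Rightarrow> int \<Rightarrow> (nat \<Rightarrow> nat) \<times> heis_elt" where
  "lift_transp \<alpha> \<beta> m n = (transpose \<alpha> \<beta>,
     \<lambda>i. if i = \<alpha> then m else if i = \<beta> then - m else 0,
     \<lambda>i. if i = \<alpha> then n else if i = \<beta> then - n else 0, m * n)"

lemma lift_transp_closed [simp]:
  "\<alpha> \<in> {1..18} \<Longrightarrow> \<beta> \<in> {1..18} \<Longrightarrow> lift_transp \<alpha> \<beta> m n \<in> carrier MM"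
  by (auto simp: lift_transp_def MM_simps heis_simps permutes_swap_id)

lemma lift_transp_swap: "\<alpha> \<noteq> \<beta> \<Longrightarrow> lift_transp \<alpha> \<beta> m n = lift_transp \<beta> \<alpha> (- m) (- n)"
  by (auto simp: lift_transp_def fun_eq_iff transpose_commute)

lemma lift_transp_mult:
  assumes "\<alpha> \<in> {1..18}" "\<beta> \<in> {1..18}" "\<alpha> \<noteq> \<beta>"
  shows "lift_transp \<alpha> \<beta> m n \<otimes>\<^bsub>MM\<^esub> (\<sigma>, a, b, c) = (transpose \<alpha> \<beta> \<circ> \<sigma>,
     \<lambda>i. (if i = \<alpha> then m else if i = \<beta> then - m else 0) + a (transpose \<alpha> \<beta> i),
     \<lambda>i. (if i = \<alpha> then n else if i = \<beta> then - n else 0) + b (transpose \<alpha> \<beta> i),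
     m * n + c + m * (b \<beta> - b \<alpha>))"
proof -
  have "(\<Sum>i\<in>{1..18}. (if i = \<alpha> then m else if i = \<beta> then - m else 0) * b (transpose \<alpha> \<beta> i))
      = (\<Sum>i\<in>{1..18}. (if i = \<alpha> then m * b \<beta> else 0) - (if i = \<beta> then m * b \<alpha> else 0))"
    using assms by (intro sum.cong) auto
  also have "\<dots> = m * b \<beta> - m * b \<alpha>"
    using assms by (simp add: sum_subtractf)
  finally show ?thesis
    by (simp add: lift_transp_def MM_simps heis_simps hperm_simp comp_def algebra_simps)
qed

text \<open>The central coordinate of the square is \<open>2 * (m * n) + m * (- n - n)\<close>,
  which vanishes; \<open>m * n\<close> is the only choice with this effect.\<close>

lemma lift_transp_invol [simp]:
  assumes "\<alpha> \<in> {1..18}" "\<beta> \<in> {1..18}" "\<alpha> \<noteq> \<beta>"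
  shows "lift_transp \<alpha> \<beta> m n \<otimes>\<^bsub>MM\<^esub> lift_transp \<alpha> \<beta> m n = \<one>\<^bsub>MM\<^esub>"
  unfolding lift_transp_def[of \<alpha> \<beta> m n, THEN arg_cong[where f = "\<lambda>y. x \<otimes>\<^bsub>MM\<^esub> y" for x]] lift_transp_mult[OF assms]
  using assms by (auto simp: MM_simps heis_simps fun_eq_iff transpose_def)

lemma lift_transp_commute:
  assumes "\<alpha> \<in> {1..18}" "\<beta> \<in> {1..18}" "\<gamma> \<in> {1..18}" "\<delta> \<in> {1..18}" "distinct [\<alpha>, \<beta>, \<gamma>, \<delta>]"
  shows "lift_transp \<alpha> \<beta> m n \<otimes>\<^bsub>MM\<^esub> lift_transp \<gamma> \<delta> m' n' = lift_transp \<gamma> \<delta> m' n' \<otimes>\<^bsub>MM\<^esub> lift_transp \<alpha> \<beta> m n"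
proof -
  have "lift_transp \<alpha> \<beta> m n \<otimes>\<^bsub>MM\<^esub> lift_transp \<gamma> \<delta> m' n' =
    (transpose \<alpha> \<beta> \<circ> transpose \<gamma> \<delta>,
     \<lambda>i. if i = \<alpha> then m else if i = \<beta> then - m else if i = \<gamma> then m' else if i = \<delta> then - m' else 0,
     \<lambda>i. if i = \<alpha> then n else if i = \<beta> then - n else if i = \<gamma> then n' else if i = \<delta> then - n' else 0,
     m * n + m' * n')" if "\<alpha> \<in> {1..18}" "\<beta> \<in> {1..18}" "distinct [\<alpha>, \<beta>, \<gamma>, \<delta>]" for \<alpha> \<beta> \<gamma> \<delta> m n m' n'
    unfolding lift_transp_def[of \<gamma>] using that
    by (subst lift_transp_mult) (auto simp: fun_eq_iff transpose_def)
  note * = this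
  show ?thesis
    unfolding *[OF assms(1,2,5)]
    by (subst *) (use assms in \<open>auto simp: fun_eq_iff transpose_def\<close>)
qed

text \<open>Concatenating two arcs adds their periods, and the central coordinate again becomes the
  product of the two sums. Lifted transpositions are thus closed under transport along edges, and a
  hexagon relation reduces to an equation between sums of cocycle values.\<close>

lemma lift_transp_conj:
  assumes "\<alpha> \<in> {1..18}" "\<beta> \<in> {1..18}" "\<gamma> \<in> {1..18}" "distinct [\<alpha>, \<beta>, \<gamma>]"
  shows "MM.cj (lift_transp \<alpha> \<beta> m n) (lift_transp \<beta> \<gamma> m' n') = lift_transp \<alpha> \<gamma> (m + m') (n + n')"
proof -
  have 1: "lift_transp \<beta> \<gamma> m' n' \<otimes>\<^bsub>MM\<^esub> lift_transp \<alpha> \<beta> m n =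
    (transpose \<beta> \<gamma> \<circ> transpose \<alpha> \<beta>,
     \<lambda>i. if i = \<alpha> then m else if i = \<beta> then m' else if i = \<gamma> then - m' - m else 0,
     \<lambda>i. if i = \<alpha> then n else if i = \<beta> then n' else if i = \<gamma> then - n' - n else 0,
     m' * n' + m * n + m' * n)"
    unfolding lift_transp_def[of \<alpha>] using assms
    by (subst lift_transp_mult) (auto simp: fun_eq_iff transpose_def)
  show ?thesis
    unfolding MM.cj_def 1 using assms
    by (subst lift_transp_mult) (auto simp: lift_transp_def fun_eq_iff transpose_def algebra_simps)
qed

text \<open>All four orientations of two edges that meet at \<open>\<beta>\<close>, so that
  transport around an explicit hexagon can be computed by rewriting.\<close>

lemma lift_transp_conj_simps:
  assumes "\<alpha> \<in> {1..18}" "\<beta> \<in> {1..18}" "\<gamma> \<in> {1..18}" "\<alpha> \<noteq> \<beta>" "\<beta> \<noteq> \<gamma>" "\<alpha> \<noteq> \<gamma>"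
  shows "MM.cj (lift_transp \<alpha> \<beta> m n) (lift_transp \<beta> \<gamma> m' n') = lift_transp \<alpha> \<gamma> (m + m') (n + n')"
    and "MM.cj (lift_transp \<alpha> \<beta> m n) (lift_transp \<gamma> \<beta> m' n') = lift_transp \<alpha> \<gamma> (m - m') (n - n')"
    and "MM.cj (lift_transp \<beta> \<alpha> m n) (lift_transp \<beta> \<gamma> m' n') = lift_transp \<alpha> \<gamma> (m' - m) (n' - n)"
    and "MM.cj (lift_transp \<beta> \<alpha> m n) (lift_transp \<gamma> \<beta> m' n') = lift_transp \<alpha> \<gamma> (- m - m') (- n - n')"
  using lift_transp_conj[of \<alpha> \<beta> \<gamma>] assms
  by (simp_all add: lift_transp_swap[of \<beta> \<alpha>] lift_transp_swap[of \<gamma> \<beta>])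

lemma lift_transp_braid:
  assumes "\<alpha> \<in> {1..18}" "\<beta> \<in> {1..18}" "\<gamma> \<in> {1..18}" "\<alpha> \<noteq> \<beta>" "\<beta> \<noteq> \<gamma>" "\<alpha> \<noteq> \<gamma>"
  shows "MM.cj (lift_transp \<alpha> \<beta> m n) (lift_transp \<beta> \<gamma> m' n') = MM.cj (lift_transp \<beta> \<gamma> m' n') (lift_transp \<alpha> \<beta> m n)"
  using assms by (simp add: lift_transp_conj_simps lift_transp_swap[of \<gamma> \<alpha>])

section \<open>Reading off exponents\<close>

context group
begin

text \<open>Homomorphisms to the integers defined only on a part of the group: the coordinates of
  the model are additive on the kernel of \<open>psi\<close> but not on the whole of
  \<open>C_grp\<close>.\<close>

definition additive_on :: "'a set \<Rightarrow> ('a \<Rightarrow> int) \<Rightarrow> bool" where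
  "additive_on H A \<longleftrightarrow> (\<forall>g\<in>H. \<forall>h\<in>H. A (g \<otimes> h) = A g + A h)"

lemma additive_int_pow:
  assumes "subgroup H G" "additive_on H A" "x \<in> H"
  shows "A (x [^] (k::int)) = k * A x"
proof -
  interpret H: subgroup H G by fact
  have x: "x \<in> carrier G" using assms by auto
  have "A (\<one> \<otimes> \<one>) = A \<one> + A \<one>"
    using assms(2) H.one_closed unfolding additive_on_def by blast
  then have one: "A \<one> = 0" by simp
  have nat: "x [^] n \<in> H \<and> A (x [^] n) = int n * A x" for n :: nat
  proof (induction n)
    case (Suc n)
    then have "A (x [^] n \<otimes> x) = A (x [^] n) + A x"
      using assms unfolding additive_on_def by blast
    with Suc assms(3) show ?case by (simp add: algebra_simps)
  qed (simp add: one)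
  have inv: "A (inv y) = - A y" if "y \<in> H" for y
  proof -
    have "A (inv y \<otimes> y) = A (inv y) + A y"
      using assms(2) that H.m_inv_closed unfolding additive_on_def by blast
    then show ?thesis using one that by auto
  qed
  show ?thesis
  proof (cases k rule: int_cases2)
    case (nonneg n)
    then show ?thesis using nat[of n] by (simp add: int_pow_int)
  next
    case (nonpos n)
    then show ?thesis using nat[of n] inv[of "x [^] n"] x by (simp add: int_pow_neg int_pow_int)
  qed
qed

text \<open>This reads an exponent off a normal form. An additive function that sees only the
  generator with index \<open>j\<close> returns \<open>f j\<close>, scaled by its value
  \<open>d\<close> there; \<open>d = 0\<close> expresses that it sees none of them.\<close>

lemma additive_pp:
  assumes H: "subgroup H G" "additive_on H A" and "\<And>i. i \<in> set is \<Longrightarrow> x i \<in> H"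
    and "\<And>i. i \<in> set is \<Longrightarrow> A (x i) = (if i = j then d else 0)" "distinct is"
  shows "A (pp x f is) = (if j \<in> set is then f j * d else 0)"
  using assms(3-)
proof (induction "is")
  case Nil
  have "A (\<one> \<otimes> \<one>) = A \<one> + A \<one>"
    using H(2) subgroup.one_closed[OF H(1)] unfolding additive_on_def by blast
  then show ?case by simp
next
  case (Cons i "is")
  have "x i [^] f i \<in> H" "pp x f is \<in> H"
    using Cons.prems H by (auto intro!: subgroup_int_pow_closed pp_in_subgroup)
  then have "A (pp x f (i # is)) = f i * A (x i) + A (pp x f is)"
    using H Cons.prems unfolding additive_on_def by (simp add: additive_int_pow[OF H])
  also have "A (pp x f is) = (if j \<in> set is then f j * d else 0)"
    using Cons.prems by (intro Cons.IH) auto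
  finally show ?case using Cons.prems(2)[of i] Cons.prems(3) by auto
qed

lemma commutes_refl: "commutes x x" by (simp add: commutes_def)

lemma word_eval_comm_word:
  assumes "\<phi> \<in> S \<rightarrow> carrier G" "a \<in> S" "b \<in> S"
  shows "word_eval G \<phi> (comm_word a b) = \<one> \<longleftrightarrow> commutes (\<phi> a) (\<phi> b)"
proof -
  have C: "\<phi> a \<in> carrier G" "\<phi> b \<in> carrier G" using assms by auto
  have "word_eval G \<phi> (comm_word a b) = (\<phi> a \<otimes> \<phi> b) \<otimes> inv (\<phi> b \<otimes> \<phi> a)"
    using C by (simp add: comm_word_def m_assoc inv_mult_group)
  then show ?thesis using C unfolding commutes_def by (metis inv_closed inv_equality inv_inv m_closed r_inv)
qed

lemma word_eval_eq_rel:
  assumes "\<phi> \<in> S \<rightarrow> carrier G" "wordS S l" "wordS S r"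
  shows "word_eval G \<phi> (eq_rel l r) = \<one> \<longleftrightarrow> word_eval G \<phi> l = word_eval G \<phi> r"
proof -
  have C: "word_eval G \<phi> l \<in> carrier G" "word_eval G \<phi> r \<in> carrier G" using assms by auto
  have "word_eval G \<phi> (eq_rel l r) = word_eval G \<phi> l \<otimes> inv (word_eval G \<phi> r)"
    using assms by (simp add: eq_rel_def word_eval_append word_eval_inv_word)
  then show ?thesis using C by (metis inv_closed inv_equality inv_inv r_inv)
qed

end

interpretation heis: group heis by (rule heis_group)

lemma heis_coords:
  "fst (m \<otimes>\<^bsub>heis\<^esub> n) j = fst m j + fst n j"
  "fst (snd (m \<otimes>\<^bsub>heis\<^esub> n)) j = fst (snd m) j + fst (snd n) j"
  by (simp_all add: heis_def case_prod_unfold)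

lemma heis_central_pow: "(\<lambda>_. 0, \<lambda>_. 0, c) [^]\<^bsub>heis\<^esub> (k::int) = (\<lambda>_. 0, \<lambda>_. 0, k * c)"
proof -
  have nat: "(\<lambda>_. 0, \<lambda>_. 0, c) [^]\<^bsub>heis\<^esub> n = (\<lambda>_. 0, \<lambda>_. 0, int n * c)" for n :: nat and c
    by (induction n) (auto simp: heis_simps algebra_simps)
  have inv: "inv\<^bsub>heis\<^esub> (\<lambda>_. 0, \<lambda>_. 0, c) = (\<lambda>_. 0, \<lambda>_. 0, - c)" for c
    by (intro heis.inv_equality) (auto simp: heis_simps)
  show ?thesis
    by (cases k rule: int_cases2)
      (auto simp: int_pow_int nat heis.int_pow_neg heis_simps inv)
qed

lemma MM_central_pow:
  "(id, \<lambda>_. 0, \<lambda>_. 0, c) [^]\<^bsub>MM\<^esub> (k::int) = (id, \<lambda>_. 0, \<lambda>_. 0, k * c)"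
proof -
  have "(\<lambda>n. (id, n)) \<in> hom heis MM"
    by (rule homI) (auto simp: MM_simps)
  then interpret \<iota>: group_hom heis MM "\<lambda>n. (id, n)" by unfold_locales
  show ?thesis
    using \<iota>.hom_int_pow[of "(\<lambda>_. 0, \<lambda>_. 0, c)" k] by (simp add: heis_simps heis_central_pow)
qed

section \<open>The presented Heisenberg group\<close>

interpretation H: group H_grp unfolding H_grp_def by (rule presented_group_is_group)

fun hval :: "hgen \<Rightarrow> heis_elt" where
  "hval (HX i) = (\<lambda>j. if j = i then 1 else 0, \<lambda>_. 0, 0)"
| "hval (HY i) = (\<lambda>_. 0, \<lambda>j. if j = i then 1 else 0, 0)"
| "hval HZ = (\<lambda>_. 0, \<lambda>_. 0, 1)"

lemma SH_simps [simp]: "HX i \<in> SH \<longleftrightarrow> i \<in> {1..18}" "HY i \<in> SH \<longleftrightarrow> i \<in> {1..18}" "HZ \<in> SH"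
  by (auto simp: SH_def)

lemma SH_cases:
  assumes "g \<in> SH"
  obtains i where "g = HX i" "i \<in> {1..18}" | i where "g = HY i" "i \<in> {1..18}" | "g = HZ"
  using assms by (cases g) auto

lemma hval_closed: "hval \<in> SH \<rightarrow> carrier heis"
  by (auto elim!: SH_cases simp: heis_simps)

lemma hval_commutes:
  "heis.commutes (hval (HX i)) (hval (HX j))" "heis.commutes (hval (HY i)) (hval (HY j))"
  "i \<noteq> j \<Longrightarrow> heis.commutes (hval (HX i)) (hval (HY j))"
  "g \<in> SH \<Longrightarrow> heis.commutes (hval HZ) (hval g)"
  by (auto elim!: SH_cases simp: heis.commutes_def heis_simps fun_eq_iff algebra_simps intro!: sum.neutral)

lemma relH_heis:
  assumes "r \<in> relH" shows "word_eval heis hval r = \<one>\<^bsub>heis\<^esub>"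
proof -
  note comm = heis.word_eval_comm_word[OF hval_closed]
  consider i j where "r = comm_word (HX i) (HX j)" "i \<in> {1..18}" "j \<in> {1..18}"
    | i j where "r = comm_word (HY i) (HY j)" "i \<in> {1..18}" "j \<in> {1..18}"
    | i j where "r = comm_word (HX i) (HY j)" "i \<in> {1..18}" "j \<in> {1..18}" "i \<noteq> j"
    | i where "r = eq_rel (comm_word (HX i) (HY i)) [(HZ, True)]" "i \<in> {1..18}"
    | g where "r = comm_word HZ g" "g \<in> SH"
    using assms unfolding relH_def by blast
  then show ?thesis
  proof cases
    case (4 i)
    let ?x = "hval (HX i)" and ?y = "hval (HY i)" and ?z = "hval HZ"
    have C: "?x \<in> carrier heis" "?y \<in> carrier heis" "?z \<in> carrier heis"
      using hval_closed 4 by (auto simp: Pi_iff simp del: hval.simps)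
    have "(\<Sum>k\<in>{1..18}. (if k = i then 1 else 0) * (if k = i then 1 else (0::int))) = (\<Sum>k\<in>{1..18}. if k = i then 1 else 0)"
      by (intro sum.cong) auto
    then have "?x \<otimes>\<^bsub>heis\<^esub> ?y = ?z \<otimes>\<^bsub>heis\<^esub> (?y \<otimes>\<^bsub>heis\<^esub> ?x)"
      using 4 by (simp add: heis_simps fun_eq_iff)
    moreover have "word_eval heis hval (comm_word (HX i) (HY i)) = (?x \<otimes>\<^bsub>heis\<^esub> ?y) \<otimes>\<^bsub>heis\<^esub> inv\<^bsub>heis\<^esub> (?y \<otimes>\<^bsub>heis\<^esub> ?x)"
      using C by (simp add: comm_word_def heis.m_assoc heis.inv_mult_group del: hval.simps)
    ultimately have "word_eval heis hval (comm_word (HX i) (HY i)) = ?z"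
      using C by (simp add: heis.m_assoc del: hval.simps)
    then show ?thesis
      using 4 C by (simp add: heis.word_eval_eq_rel[OF hval_closed] comm_word_def del: hval.simps)
  qed (simp_all add: comm hval_commutes del: hval.simps)
qed

lemma xH_closed [simp]: "i \<in> {1..18} \<Longrightarrow> xH i \<in> carrier H_grp" "i \<in> {1..18} \<Longrightarrow> yH i \<in> carrier H_grp" "zH \<in> carrier H_grp"
  by (simp_all add: xH_def yH_def zH_def H_grp_def)

lemma pgen_H_commutes:
  assumes "comm_word a b \<in> relH" "a \<in> SH" "b \<in> SH"
  shows "H.commutes (pgen SH relH a) (pgen SH relH b)"
proof -
  have "word_eval H_grp (pgen SH relH) (comm_word a b) = \<one>\<^bsub>H_grp\<^esub>"
    unfolding H_grp_def using assms by (intro presented_group_relator) (auto simp: comm_word_def)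
  then show ?thesis
    using H.word_eval_comm_word[of "pgen SH relH" SH a b] assms by (simp add: H_grp_def Pi_iff)
qed

lemma H_commutes:
  assumes "i \<in> {1..18}" "j \<in> {1..18}"
  shows "H.commutes (xH i) (xH j)" "H.commutes (yH i) (yH j)" "i \<noteq> j \<Longrightarrow> H.commutes (xH i) (yH j)"
proof -
  have "comm_word (HX i) (HX j) \<in> relH" "comm_word (HY i) (HY j) \<in> relH" "comm_word (HX i) (HY j) \<in> relH" if "i \<noteq> j"
    using assms that unfolding relH_def by blast+
  then show "H.commutes (xH i) (xH j)" "H.commutes (yH i) (yH j)" "i \<noteq> j \<Longrightarrow> H.commutes (xH i) (yH j)"
    unfolding xH_def yH_def using assms
    by (cases "i = j"; simp add: pgen_H_commutes H.commutes_refl)+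
qed

lemma H_commutes_z:
  assumes "i \<in> {1..18}"
  shows "H.commutes zH (xH i)" "H.commutes zH (yH i)"
proof -
  have "comm_word HZ (HX i) \<in> relH" "comm_word HZ (HY i) \<in> relH"
    using assms unfolding relH_def by (auto simp: SH_def)
  then show "H.commutes zH (xH i)" "H.commutes zH (yH i)"
    unfolding xH_def yH_def zH_def using assms by (simp_all add: pgen_H_commutes)
qed

lemma H_comm_z:
  assumes "i \<in> {1..18}"
  shows "xH i \<otimes>\<^bsub>H_grp\<^esub> yH i = yH i \<otimes>\<^bsub>H_grp\<^esub> (xH i \<otimes>\<^bsub>H_grp\<^esub> zH)"
proof -
  have "eq_rel (comm_word (HX i) (HY i)) [(HZ, True)] \<in> relH" using assms unfolding relH_def by blast
  then have "word_eval H_grp (pgen SH relH) (comm_word (HX i) (HY i)) = word_eval H_grp (pgen SH relH) [(HZ, True)]"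
    unfolding H_grp_def by (rule presented_group_relation) (use assms in \<open>auto simp: comm_word_def\<close>)
  then have *: "xH i \<otimes>\<^bsub>H_grp\<^esub> yH i \<otimes>\<^bsub>H_grp\<^esub> inv\<^bsub>H_grp\<^esub> (yH i \<otimes>\<^bsub>H_grp\<^esub> xH i) = zH"
    using assms by (simp add: comm_word_def xH_def[symmetric] yH_def[symmetric] zH_def[symmetric]
        H.m_assoc H.inv_mult_group)
  have "xH i \<otimes>\<^bsub>H_grp\<^esub> yH i = zH \<otimes>\<^bsub>H_grp\<^esub> (yH i \<otimes>\<^bsub>H_grp\<^esub> xH i)"
    unfolding *[symmetric] using assms by (simp add: H.m_assoc)
  also have "\<dots> = yH i \<otimes>\<^bsub>H_grp\<^esub> xH i \<otimes>\<^bsub>H_grp\<^esub> zH"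
    using H.commutes_mult[OF H_commutes_z(2,1)[OF assms]] assms by (simp add: H.commutes_def)
  finally show ?thesis using assms by (simp add: H.m_assoc)
qed

definition vlist :: "nat list" where "vlist = [1..<19]"

lemma set_vlist: "set vlist = {1..18}" and distinct_vlist: "distinct vlist"
  by (auto simp: vlist_def)

lemma H_normal_form:
  assumes "h \<in> carrier H_grp"
  obtains f g and k :: int where
    "h = H.pp xH f vlist \<otimes>\<^bsub>H_grp\<^esub> (H.pp yH g vlist \<otimes>\<^bsub>H_grp\<^esub> zH [^]\<^bsub>H_grp\<^esub> k)"
proof -
  have gen: "h \<in> generate H_grp (xH ` set vlist \<union> yH ` set vlist \<union> {zH})"
  proof -
    have "xH ` set vlist \<union> yH ` set vlist \<union> {zH} = pgen SH relH ` SH"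
      unfolding set_vlist SH_def xH_def yH_def zH_def by auto
    then show ?thesis using assms presented_group_generate[of SH relH] by (simp add: H_grp_def)
  qed
  have "\<exists>f g k. h = H.pp xH f vlist \<otimes>\<^bsub>H_grp\<^esub> (H.pp yH g vlist \<otimes>\<^bsub>H_grp\<^esub> zH [^]\<^bsub>H_grp\<^esub> (k::int))"
  proof (rule H.heisenberg_normal_form[OF _ _ _ _ _ _ _ _ gen])
    fix i j :: nat assume "i \<in> set vlist" "j \<in> set vlist"
    then have ij: "i \<in> {1..18}" "j \<in> {1..18}" by (simp_all add: set_vlist)
    show "\<exists>k::int. yH j \<otimes>\<^bsub>H_grp\<^esub> xH i = xH i \<otimes>\<^bsub>H_grp\<^esub> (yH j \<otimes>\<^bsub>H_grp\<^esub> zH [^]\<^bsub>H_grp\<^esub> k)"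
    proof (cases "i = j")
      case True
      then have "yH i \<otimes>\<^bsub>H_grp\<^esub> xH i = xH i \<otimes>\<^bsub>H_grp\<^esub> (yH i \<otimes>\<^bsub>H_grp\<^esub> inv\<^bsub>H_grp\<^esub> zH)"
        using ij by (intro H.commutator_flip[OF H_comm_z]) auto
      then show ?thesis using True by (intro exI[of _ "-1"]) (simp add: H.int_pow_neg)
    next
      case False
      then show ?thesis using H_commutes(3)[of i j] ij
        by (intro exI[of _ 0]) (auto simp: H.commutes_def)
    qed
  qed (auto simp: H_commutes H_commutes_z set_vlist distinct_vlist)
  then show thesis using that by blast
qed

text \<open>A bijection of the indices maps the set of relators into itself, so relabelling descends
  to classes of words.\<close>

lemma pres_rel_relabel:
  assumes "pres_rel SH relH v w" "\<sigma> permutes {1..18}"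
  shows "pres_rel SH relH (map (\<lambda>(g, b). (hrelabel \<sigma> g, b)) v) (map (\<lambda>(g, b). (hrelabel \<sigma> g, b)) w)"
proof -
  let ?m = "map (\<lambda>(g, b). (hrelabel \<sigma> g, b))"
  have im: "\<sigma> i \<in> {1..18} \<longleftrightarrow> i \<in> {1..18}" for i using permutes_in_image[OF assms(2)] .
  have ne: "\<sigma> i \<noteq> \<sigma> j" if "i \<noteq> j" for i j using that permutes_inj[OF assms(2)] by (auto dest: injD)
  have SH: "g \<in> SH \<Longrightarrow> hrelabel \<sigma> g \<in> SH" for g using im by (cases g) (simp_all del: atLeastAtMost_iff)
  have wS: "wordS SH w \<Longrightarrow> wordS SH (?m w)" for w by (induction w) (auto simp: SH)
  have cw: "?m (comm_word a b) = comm_word (hrelabel \<sigma> a) (hrelabel \<sigma> b)" for a b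
    by (simp add: comm_word_def)
  have rel: "?m r \<in> relH" if r: "r \<in> relH" for r
  proof -
    consider i j where "r = comm_word (HX i) (HX j)" "i \<in> {1..18}" "j \<in> {1..18}" "i \<noteq> j"
    | i j where "r = comm_word (HY i) (HY j)" "i \<in> {1..18}" "j \<in> {1..18}" "i \<noteq> j"
    | i j where "r = comm_word (HX i) (HY j)" "i \<in> {1..18}" "j \<in> {1..18}" "i \<noteq> j"
    | i where "r = eq_rel (comm_word (HX i) (HY i)) [(HZ, True)]" "i \<in> {1..18}"
    | g where "r = comm_word HZ g" "g \<in> SH"
      using r unfolding relH_def by blast
    then show ?thesis
    proof cases
      case 1 then show ?thesis using im ne unfolding relH_def by (simp add: cw) blast
    next
      case 2 then show ?thesis using im ne unfolding relH_def by (simp add: cw) blast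
    next
      case 3 then show ?thesis using im ne unfolding relH_def by (simp add: cw) blast
    next
      case (4 i)
      then have "?m r = eq_rel (comm_word (HX (\<sigma> i)) (HY (\<sigma> i))) [(HZ, True)]"
        by (simp add: eq_rel_def cw)
      then show ?thesis using 4 im unfolding relH_def by blast
    next
      case 5 then show ?thesis using SH unfolding relH_def by (simp add: cw) blast
    qed
  qed
  show ?thesis using assms(1)
  proof (induction rule: pres_rel.induct)
    case (cancel xs ys a b)
    then show ?case using pres_rel.cancel[of SH "?m xs" "?m ys" "hrelabel \<sigma> a" relH b] wS SH by simp
  next
    case (relator r xs ys)
    then show ?case using pres_rel.relator[of "?m r" relH SH "?m xs" "?m ys"] wS rel by simp
  qed (auto intro: pres_rel.intros wS)
qed

lemma hact_class:
  assumes "\<sigma> permutes {1..18}" "wordS SH w"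
  shows "hact \<sigma> (pres_class SH relH w) = pres_class SH relH (map (\<lambda>(g, b). (hrelabel \<sigma> g, b)) w)"
proof -
  have "w \<in> pres_class SH relH w" using assms by (simp add: pres_class_def pres_rel.refl)
  then show ?thesis unfolding hact_def using pres_rel_relabel[OF _ assms(1)]
    by (auto simp: pres_class_def intro: pres_rel.trans)
qed

text \<open>The exponents of a normal form in \<open>H_grp\<close> are recovered from the
  coordinates of its image, so the normal form is unique and the map injective. Together with
  equivariance this replaces the presented group by explicit coordinates in all later
  computations.\<close>

lemma H_iso_heis:
  obtains \<theta> where "\<theta> \<in> iso H_grp heis"
    "\<And>i. i \<in> {1..18} \<Longrightarrow> \<theta> (xH i) = hval (HX i) \<and> \<theta> (yH i) = hval (HY i)" "\<theta> zH = hval HZ"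
    "\<And>\<sigma> h. \<sigma> permutes {1..18} \<Longrightarrow> h \<in> carrier H_grp \<Longrightarrow>
       hact \<sigma> h \<in> carrier H_grp \<and> \<theta> (hact \<sigma> h) = hperm \<sigma> (\<theta> h)"
proof -
  obtain \<theta> where \<theta>: "\<theta> \<in> hom H_grp heis"
    and ev: "\<And>w. wordS SH w \<Longrightarrow> \<theta> (pres_class SH relH w) = word_eval heis hval w"
    using heis.presented_group_hom_exists[OF hval_closed relH_heis] unfolding H_grp_def by blast
  interpret \<theta>: group_hom H_grp heis \<theta> using \<theta> by unfold_locales
  have gens: "\<theta> (xH i) = hval (HX i) \<and> \<theta> (yH i) = hval (HY i)" if "i \<in> {1..18}" for i
    using that ev[of "[(HX i, True)]"] ev[of "[(HY i, True)]"]
    by (simp add: xH_def yH_def pgen_def heis_simps)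
  have z: "\<theta> zH = hval HZ"
    using ev[of "[(HZ, True)]"] by (simp add: zH_def pgen_def heis_simps)
  have add: "H.additive_on (carrier H_grp) (\<lambda>h. fst (\<theta> h) j)" "H.additive_on (carrier H_grp) (\<lambda>h. fst (snd (\<theta> h)) j)" for j
    unfolding H.additive_on_def by (auto simp: heis_def case_prod_unfold)
  have sub: "subgroup (carrier H_grp) H_grp" by (rule H.subgroup_self)
  let ?x = "\<lambda>f. H.pp xH f vlist" and ?y = "\<lambda>f. H.pp yH f vlist"
  have C [simp]: "?x f \<in> carrier H_grp" "?y f \<in> carrier H_grp" for f
    by (auto intro!: H.pp_closed simp: set_vlist)
  have px: "fst (\<theta> (?x f)) j = (if j \<in> {1..18} then f j else 0)" "fst (snd (\<theta> (?x f))) j = 0" for f j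
  proof -
    have "fst (\<theta> (?x f)) j = (if j \<in> set vlist then f j * 1 else 0)"
      by (rule H.additive_pp[OF sub add(1)]) (auto simp: gens set_vlist distinct_vlist)
    moreover have "fst (snd (\<theta> (?x f))) j = (if j \<in> set vlist then f j * 0 else 0)"
      by (rule H.additive_pp[OF sub add(2)]) (auto simp: gens set_vlist distinct_vlist)
    ultimately show "fst (\<theta> (?x f)) j = (if j \<in> {1..18} then f j else 0)" "fst (snd (\<theta> (?x f))) j = 0"
      by (simp_all add: set_vlist)
  qed
  have py: "fst (snd (\<theta> (?y f))) j = (if j \<in> {1..18} then f j else 0)" "fst (\<theta> (?y f)) j = 0" for f j
  proof -
    have "fst (snd (\<theta> (?y f))) j = (if j \<in> set vlist then f j * 1 else 0)"
      by (rule H.additive_pp[OF sub add(2)]) (auto simp: gens set_vlist distinct_vlist)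
    moreover have "fst (\<theta> (?y f)) j = (if j \<in> set vlist then f j * 0 else 0)"
      by (rule H.additive_pp[OF sub add(1)]) (auto simp: gens set_vlist distinct_vlist)
    ultimately show "fst (snd (\<theta> (?y f))) j = (if j \<in> {1..18} then f j else 0)" "fst (\<theta> (?y f)) j = 0"
      by (simp_all add: set_vlist)
  qed
  have zk: "\<theta> (zH [^]\<^bsub>H_grp\<^esub> k) = (\<lambda>_. 0, \<lambda>_. 0, k)" for k :: int
    using \<theta>.hom_int_pow[of zH k] by (simp add: z heis_central_pow)
  \<comment> \<open>Only the x- and y-coordinates are recorded. For injectivity the central one
    matters only after these vanish; for surjectivity it is corrected afterwards by a power of
    \<open>zH\<close>.\<close>
  have nf: "fst (\<theta> (?x f \<otimes>\<^bsub>H_grp\<^esub> (?y g \<otimes>\<^bsub>H_grp\<^esub> zH [^]\<^bsub>H_grp\<^esub> k))) = (\<lambda>j. if j \<in> {1..18} then f j else 0)"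
    "fst (snd (\<theta> (?x f \<otimes>\<^bsub>H_grp\<^esub> (?y g \<otimes>\<^bsub>H_grp\<^esub> zH [^]\<^bsub>H_grp\<^esub> k)))) = (\<lambda>j. if j \<in> {1..18} then g j else 0)"
    for f g and k :: int
    using zk[of k] px py by (simp_all add: fun_eq_iff heis_coords)
  have inj: "h = \<one>\<^bsub>H_grp\<^esub>" if h1: "h \<in> carrier H_grp" "\<theta> h = \<one>\<^bsub>heis\<^esub>" for h
  proof -
    obtain f g and k :: int where h: "h = ?x f \<otimes>\<^bsub>H_grp\<^esub> (?y g \<otimes>\<^bsub>H_grp\<^esub> zH [^]\<^bsub>H_grp\<^esub> k)"
      using H_normal_form[OF h1(1)] by blast
    then have "(\<lambda>j. if j \<in> {1..18} then f j else 0) = (\<lambda>_. 0)" "(\<lambda>j. if j \<in> {1..18} then g j else 0) = (\<lambda>_. 0)"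
      using nf[of f g k] h1(2) by (simp_all add: heis_simps)
    then have "f j = 0" "g j = 0" if "j \<in> {1..18}" for j using that by (auto simp: fun_eq_iff split: if_splits)
    then have "?x f = \<one>\<^bsub>H_grp\<^esub>" "?y g = \<one>\<^bsub>H_grp\<^esub>" by (auto intro!: H.pp_zero simp: set_vlist)
    then have "h = zH [^]\<^bsub>H_grp\<^esub> k" using h by simp
    with zk[of k] h1(2) show ?thesis by (simp add: heis_simps)
  qed
  have surj: "\<exists>h\<in>carrier H_grp. \<theta> h = n" if "n \<in> carrier heis" for n
  proof -
    obtain a b c where n: "n = (a, b, c)" by (cases n)
    define h where "h = ?x a \<otimes>\<^bsub>H_grp\<^esub> (?y b \<otimes>\<^bsub>H_grp\<^esub> zH [^]\<^bsub>H_grp\<^esub> (0::int))"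
    have hc: "h \<in> carrier H_grp" by (simp add: h_def)
    have "fst (\<theta> h) = a" "fst (snd (\<theta> h)) = b"
      using nf[of a b 0] that unfolding n h_def by (auto simp: heis_simps fun_eq_iff)
    then obtain c0 where "\<theta> h = (a, b, c0)" by (cases "\<theta> h") auto
    then have "\<theta> (h \<otimes>\<^bsub>H_grp\<^esub> zH [^]\<^bsub>H_grp\<^esub> (c - c0)) = n"
      using hc zk by (simp add: n heis_simps)
    moreover have "h \<otimes>\<^bsub>H_grp\<^esub> zH [^]\<^bsub>H_grp\<^esub> (c - c0) \<in> carrier H_grp" using hc by simp
    ultimately show ?thesis by blast
  qed
  have iso: "\<theta> \<in> iso H_grp heis"
  proof -
    have "inj_on \<theta> (carrier H_grp)"
      unfolding \<theta>.inj_on_one_iff using inj by blast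
    moreover have "\<theta> ` carrier H_grp = carrier heis"
    proof
      show "carrier heis \<subseteq> \<theta> ` carrier H_grp" using surj by blast
    qed auto
    ultimately show ?thesis using \<theta> by (simp add: iso_def bij_betw_def)
  qed
  have act: "hact \<sigma> h \<in> carrier H_grp \<and> \<theta> (hact \<sigma> h) = hperm \<sigma> (\<theta> h)"
    if \<sigma>: "\<sigma> permutes {1..18}" and hc: "h \<in> carrier H_grp" for \<sigma> h
  proof -
    let ?m = "map (\<lambda>(g, b). (hrelabel \<sigma> g, b))"
    obtain w where w: "h = pres_class SH relH w" "wordS SH w"
      using hc by (auto simp: H_grp_def presented_group_carrier)
    have SH: "g \<in> SH \<Longrightarrow> hrelabel \<sigma> g \<in> SH" for g
      using permutes_in_image[OF \<sigma>] by (cases g) (simp_all del: atLeastAtMost_iff)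
    have mw: "wordS SH (?m w)" using w(2) by (induction w) (auto simp: SH)
    have hv: "hval (hrelabel \<sigma> g) = hperm \<sigma> (hval g)" if "g \<in> SH" for g
      using that permutes_inv_eq[OF \<sigma>] by (auto elim!: SH_cases simp: hperm_simp fun_eq_iff)
    have hp: "hperm \<sigma> \<in> hom heis heis" by (rule homI) (simp_all add: hperm_heis[OF \<sigma>])
    interpret hp: group_hom heis heis "hperm \<sigma>" using hp by unfold_locales
    have "word_eval heis hval (?m w) = hperm \<sigma> (word_eval heis hval w)" using w(2)
    proof (induction w)
      case (Cons x w)
      then have "hval (fst x) \<in> carrier heis" "word_eval heis hval w \<in> carrier heis"
        using hval_closed heis.word_eval_closed[OF hval_closed] by auto
      with Cons show ?case by (auto simp: hv case_prod_unfold)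
    qed simp
    then show ?thesis using w mw ev \<sigma> by (simp add: hact_class) (auto simp: H_grp_def presented_group_carrier)
  qed
  show thesis by (rule that[OF iso gens z act])
qed

section \<open>Two families of lifted transpositions and their commutators\<close>

context lift_family
begin

lemma cocycle_Tr: "cocycle V Tr"
  unfolding cocycle_def by (blast intro: Tr_closed Tr_swap Tr_cocycle)

lemma cj_P_t_disjoint:
  assumes "a \<in> V" "b \<in> V" "c \<in> V" "d \<in> V" "distinct [a, b, c, d]"
  shows "cj (P a b) (t c d) = t c d"
proof -
  have "cj (t c d) (P a b) = P a b"
    using assms cj_t_P[of c d a b] by (auto simp: transpose_def)
  then have "commutes (t c d) (P a b)"
    using assms by (simp add: cj_commute commutes_def)
  then show ?thesis using assms by (simp add: cj_commute commutes_def)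
qed

end

lemma (in sym_rep) t_move: "\<lbrakk>a \<in> V; b \<in> V; x \<in> carrier G; y \<in> carrier G\<rbrakk> \<Longrightarrow>
    t a b \<otimes> (x \<otimes> y) = ac (transpose a b) x \<otimes> (t a b \<otimes> y)"
  using cj_t[of a b x, symmetric] by (simp add: cj_def m_assoc involution_cancel)

lemma (in sym_rep) ac_commutes:
  "\<lbrakk>\<sigma> permutes V; x \<in> carrier G; y \<in> carrier G; commutes x y\<rbrakk> \<Longrightarrow> commutes (ac \<sigma> x) (ac \<sigma> y)"
  unfolding commutes_def by (metis ac_mult)

locale lift_pair = sym_rep G V s + P: lift_family G V s P + Q: lift_family G V s Q
  for G (structure) and V :: "'v set" and s :: "('v \<Rightarrow> 'v) \<Rightarrow> 'a" and P Q
begin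

text \<open>Pushing the ordinary transpositions to the right leaves a word in translations times
  \<open>t a d\<close>. The position of the x-translation between two y-translations is the
  information that the ninth hexagon will use.\<close>

lemma cj_Q_P:
  assumes "a \<in> V" "b \<in> V" "d \<in> V" "distinct [a, b, d]"
  shows "cj (Q b a) (P b d) = (Q.Tr b a \<otimes> (P.Tr a d \<otimes> Q.Tr d b)) \<otimes> t a d"
proof -
  have [simp]: "a \<noteq> b" "b \<noteq> a" "a \<noteq> d" "d \<noteq> a" "b \<noteq> d" "d \<noteq> b" using assms by auto
  have tt: "t b a \<otimes> (t b d \<otimes> t b a) = t a d"
    using assms cj_t_t[of b a b d] by (simp add: cj_def transpose_def)
  have "cj (Q b a) (P b d) = Q.Tr b a \<otimes> (t b a \<otimes> (P.Tr b d \<otimes> (t b d \<otimes> (Q.Tr b a \<otimes> t b a))))"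
    using assms by (simp add: cj_def Q.P_eq P.P_eq m_assoc)
  also have "\<dots> = Q.Tr b a \<otimes> (P.Tr a d \<otimes> (Q.Tr d b \<otimes> (t b a \<otimes> (t b d \<otimes> t b a))))"
    using assms by (simp add: t_move P.ac_Tr Q.ac_Tr permutes_swap_id transpose_def)
  finally show ?thesis using assms by (simp add: tt m_assoc)
qed

lemma cj_Q_P':
  assumes "a \<in> V" "c \<in> V" "d \<in> V" "distinct [a, c, d]"
  shows "cj (Q d c) (P a c) = (Q.Tr d c \<otimes> (P.Tr a d \<otimes> Q.Tr c a)) \<otimes> t a d"
proof -
  have [simp]: "a \<noteq> c" "c \<noteq> a" "a \<noteq> d" "d \<noteq> a" "c \<noteq> d" "d \<noteq> c" using assms by auto
  have tt: "t d c \<otimes> (t a c \<otimes> t d c) = t a d"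
    using assms cj_t_t[of d c a c] by (simp add: cj_def transpose_def)
  have "cj (Q d c) (P a c) = Q.Tr d c \<otimes> (t d c \<otimes> (P.Tr a c \<otimes> (t a c \<otimes> (Q.Tr d c \<otimes> t d c))))"
    using assms by (simp add: cj_def Q.P_eq P.P_eq m_assoc)
  also have "\<dots> = Q.Tr d c \<otimes> (P.Tr a d \<otimes> (Q.Tr c a \<otimes> (t d c \<otimes> (t a c \<otimes> t d c))))"
    using assms by (simp add: t_move P.ac_Tr Q.ac_Tr permutes_swap_id transpose_def)
  finally show ?thesis using assms by (simp add: tt m_assoc)
qed

text \<open>Both mixed words have the form y-translation, \<open>P.Tr a d\<close>, y-translation.
  Bringing the y-parts to opposite sides gives two products of y-translations, both equal to
  \<open>Q.Tr b a \<otimes> Q.Tr c d\<close> by additivity.\<close>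

lemma Tr_commutes_if_mixed_eq:
  assumes V: "a \<in> V" "b \<in> V" "c \<in> V" "d \<in> V" "distinct [a, b, c, d]"
    and eq: "cj (Q b a) (P b d) = cj (Q d c) (P a c)"
  shows "commutes (P.Tr a d) (Q.Tr b a \<otimes> Q.Tr c d)"
proof -
  have [simp]: "a \<noteq> b" "b \<noteq> a" "a \<noteq> d" "d \<noteq> a" "b \<noteq> d" "d \<noteq> b" "a \<noteq> c" "c \<noteq> a" "c \<noteq> d" "d \<noteq> c" "b \<noteq> c" "c \<noteq> b"
    using V by auto
  note C = V(1-4) P.Tr_closed Q.Tr_closed
  have "(Q.Tr b a \<otimes> (P.Tr a d \<otimes> Q.Tr d b)) \<otimes> t a d = (Q.Tr d c \<otimes> (P.Tr a d \<otimes> Q.Tr c a)) \<otimes> t a d"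
    using eq V by (simp add: cj_Q_P cj_Q_P')
  then have "Q.Tr b a \<otimes> (P.Tr a d \<otimes> Q.Tr d b) = Q.Tr d c \<otimes> (P.Tr a d \<otimes> Q.Tr c a)"
    using V by simp
  then have "(Q.Tr b a \<otimes> P.Tr a d) \<otimes> Q.Tr d b = Q.Tr d c \<otimes> (P.Tr a d \<otimes> Q.Tr c a)"
    using C by (simp add: m_assoc)
  then have "inv (Q.Tr d c) \<otimes> (Q.Tr b a \<otimes> P.Tr a d) = (P.Tr a d \<otimes> Q.Tr c a) \<otimes> inv (Q.Tr d b)"
    using C by (intro swap_sides) simp_all
  then have "(Q.Tr c d \<otimes> Q.Tr b a) \<otimes> P.Tr a d = P.Tr a d \<otimes> (Q.Tr c a \<otimes> Q.Tr b d)"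
    using C Q.Tr_swap[of d c] Q.Tr_swap[of d b] by (simp add: m_assoc)
  moreover have "Q.Tr c d \<otimes> Q.Tr b a = Q.Tr b a \<otimes> Q.Tr c d"
    using cocycle_commutes(2)[OF Q.cocycle_Tr, of b a c d] V by (simp add: commutes_def)
  moreover have "Q.Tr c a \<otimes> Q.Tr b d = Q.Tr b a \<otimes> Q.Tr c d"
  proof -
    have "Q.Tr b d = Q.Tr a d \<otimes> Q.Tr b a" "Q.Tr c d = Q.Tr c a \<otimes> Q.Tr a d"
      using Q.Tr_cocycle V by simp_all
    then have "Q.Tr c a \<otimes> Q.Tr b d = Q.Tr c d \<otimes> Q.Tr b a" using C by (simp add: m_assoc)
    also have "\<dots> = Q.Tr b a \<otimes> Q.Tr c d"
      using cocycle_commutes(2)[OF Q.cocycle_Tr, of b a c d] V by (simp add: commutes_def)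
    finally show ?thesis .
  qed
  ultimately show ?thesis by (simp add: commutes_def)
qed

text \<open>One mixed equation and one commuting disjoint pair are enough: conjugation by the
  symmetric group carries them to all quadruples of distinct vertices, which supplies both
  hypotheses of \<open>central_commutator_exists\<close>.\<close>

lemma central_element_exists:
  assumes "7 \<le> card V"
    and V: "set [a, b, c, d] \<subseteq> V" "distinct [a, b, c, d]"
    and eq: "cj (Q b a) (P b d) = cj (Q d c) (P a c)"
    and V': "set [a', b', c', d'] \<subseteq> V" "distinct [a', b', c', d']"
    and comm: "commutes (P a' b') (Q c' d')"
  obtains z where "z \<in> carrier G"
    "\<And>a b. \<lbrakk>a \<in> V; b \<in> V; a \<noteq> b\<rbrakk> \<Longrightarrow> commutes z (P.Tr a b) \<and> commutes z (Q.Tr a b)"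
    "\<And>a b c. \<lbrakk>a \<in> V; b \<in> V; c \<in> V; distinct [a, b, c]\<rbrakk> \<Longrightarrow>
       P.Tr a c \<otimes> Q.Tr b a = Q.Tr b a \<otimes> P.Tr a c \<otimes> z"
proof (rule central_commutator_exists[OF finite_V assms(1) P.cocycle_Tr Q.cocycle_Tr])
  fix e f g h assume *: "e \<in> V" "f \<in> V" "g \<in> V" "h \<in> V" "distinct [e, f, g, h]"
  obtain \<sigma> where \<sigma>: "\<sigma> permutes V" "map \<sigma> [a', b', c', d'] = [e, f, g, h]"
    using permutation_extending_lists[of "[a', b', c', d']" "[e, f, g, h]" V] V' * by auto
  have "commutes (ac \<sigma> (P a' b')) (ac \<sigma> (Q c' d'))"
    using comm V' \<sigma> by (intro ac_commutes) auto
  then have PQ: "commutes (P e f) (Q g h)" using \<sigma> V' by (auto simp: P.ac_P Q.ac_P)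
  have 1: "commutes (P e f) (t g h)"
    using P.cj_P_t_disjoint[OF *] * by (auto simp: cj_commute commutes_def)
  have 2: "commutes (t e f) (Q g h)"
    using Q.cj_P_t_disjoint[of g h e f] * by (auto simp: cj_commute commutes_def)
  have 3: "commutes (t e f) (t g h)"
  proof -
    have "cj (t e f) (t g h) = t g h" using cj_t_t[of e f g h] * by (auto simp: transpose_def)
    then show ?thesis using * by (simp add: cj_commute commutes_def)
  qed
  have "commutes (Q.Tr g h) (P e f)" unfolding Q.Tr_def
    using * PQ 1 by (intro commutes_sym[OF commutes_mult]) auto
  moreover have "commutes (Q.Tr g h) (t e f)" unfolding Q.Tr_def
    using * 2 3 by (intro commutes_sym[OF commutes_mult]) auto
  ultimately have "commutes (Q.Tr g h) (P.Tr e f)" unfolding P.Tr_def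
    using * by (intro commutes_mult) auto
  then show "commutes (P.Tr e f) (Q.Tr g h)" by (rule commutes_sym)
  obtain \<tau> where \<tau>: "\<tau> permutes V" "map \<tau> [a, b, c, d] = [e, f, g, h]"
    using permutation_extending_lists[of "[a, b, c, d]" "[e, f, g, h]" V] V * by auto
  have "ac \<tau> (cj (Q b a) (P b d)) = ac \<tau> (cj (Q d c) (P a c))" using eq by simp
  then have "cj (Q f e) (P f h) = cj (Q h g) (P e g)"
    using \<tau> V by (auto simp: ac_cj P.ac_P Q.ac_P)
  with * show "commutes (P.Tr e h) (Q.Tr f e \<otimes> Q.Tr g h)"
    by (intro Tr_commutes_if_mixed_eq)
qed (rule that)

end

section \<open>The graph and the group\<close>

interpretation C: group C_grp unfolding C_grp_def by (rule presented_group_is_group)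

lemma edgeT_eq: "edgeT j = {eA j, eB j}"
  by (simp add: edgeT_def eA_def eB_def)

lemma edge_bounds:
  assumes "j \<in> {1..27}"
  shows "eA j \<in> {1..18}" "eB j \<in> {1..18}" "eA j < eB j"
proof -
  have "\<forall>e\<in>set edge_list. fst e \<in> {1..18} \<and> snd e \<in> {1..18} \<and> fst e < snd e"
    by (simp add: edge_list_def)
  moreover have "edge_list ! (j - 1) \<in> set edge_list"
    using assms by (intro nth_mem) (auto simp: edge_list_def)
  ultimately show "eA j \<in> {1..18}" "eB j \<in> {1..18}" "eA j < eB j"
    unfolding eA_def eB_def by blast+
qed

text \<open>The graph has no multiple edges, so two distinct edges that meet have exactly one common
  vertex.\<close>

lemma edgeT_inj:
  assumes "i \<in> {1..27}" "j \<in> {1..27}" "edgeT i = edgeT j"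
  shows "i = j"
proof -
  have "eA i = eA j" "eB i = eB j"
    using assms edge_bounds(3)[of i] edge_bounds(3)[of j] by (auto simp: edgeT_eq doubleton_eq_iff)
  then have "edge_list ! (i - 1) = edge_list ! (j - 1)" by (simp add: eA_def eB_def prod_eq_iff)
  moreover have "distinct edge_list" by (simp add: edge_list_def)
  moreover have "i - 1 < length edge_list" "j - 1 < length edge_list"
    using assms by (auto simp: edge_list_def)
  ultimately have "i - 1 = j - 1" by (simp add: nth_eq_iff_index_eq)
  then show ?thesis using assms by auto
qed

text \<open>A cocycle on \<open>T\<close> with values in \<open>\<int>\<^sup>2\<close>: it vanishes on \<open>T0\<close>, has trivial holonomy around the nine
  hexagons, and generates the first cohomology of the torus.\<close>
definition hm :: "nat \<Rightarrow> int" where "hm j = (if j \<in> {1, 2, 3} then - 1 else 0)"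
definition hn :: "nat \<Rightarrow> int" where
  "hn j = (if j \<in> {1, 2, 3} then 2 else if j \<in> {4, 15} then - 1 else if j = 13 then 1 else 0)"

definition uval :: "nat \<Rightarrow> (nat \<Rightarrow> nat) \<times> heis_elt" where
  "uval j = lift_transp (eA j) (eB j) (hm j) (hn j)"

lemma uval_closed: "uval \<in> {1..27} \<rightarrow> carrier MM"
  using edge_bounds by (auto simp: uval_def simp del: atLeastAtMost_iff)

lemma uval_invol: "j \<in> {1..27} \<Longrightarrow> uval j \<otimes>\<^bsub>MM\<^esub> uval j = \<one>\<^bsub>MM\<^esub>"
  using edge_bounds[of j] by (simp add: uval_def del: atLeastAtMost_iff)

lemma uval_commute:
  assumes "i \<in> {1..27}" "j \<in> {1..27}" "edgeT i \<inter> edgeT j = {}"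
  shows "uval i \<otimes>\<^bsub>MM\<^esub> uval j = uval j \<otimes>\<^bsub>MM\<^esub> uval i"
  unfolding uval_def
  using edge_bounds[OF assms(1)] edge_bounds[OF assms(2)] assms(3)
  by (intro lift_transp_commute) (auto simp: edgeT_eq)

lemma uval_braid:
  assumes "i \<in> {1..27}" "j \<in> {1..27}" "i \<noteq> j" "edgeT i \<inter> edgeT j \<noteq> {}"
  shows "MM.cj (uval i) (uval j) = MM.cj (uval j) (uval i)"
proof -
  \<comment> \<open>An edge may be read in either direction at the price of the signs of its cocycle
    values, so both edges can be oriented through the common vertex.\<close>
  have star: "\<exists>m n. uval k = lift_transp v w m n"
    if "k \<in> {1..27}" "edgeT k = {v, w}" "v \<noteq> w" for k v w
  proof -
    have "eA k = v \<and> eB k = w \<or> eA k = w \<and> eB k = v" using that by (auto simp: edgeT_eq doubleton_eq_iff)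
    then show ?thesis using that unfolding uval_def by (metis lift_transp_swap)
  qed
  obtain v where v: "v \<in> edgeT i" "v \<in> edgeT j" using assms by blast
  have other: "\<exists>w. edgeT k = {w, v} \<and> w \<noteq> v" if "k \<in> {1..27}" "v \<in> edgeT k" for k
  proof -
    have "v = eA k \<or> v = eB k" using that(2) by (simp add: edgeT_eq)
    moreover have "edgeT k = {eB k, eA k}" by (auto simp: edgeT_eq)
    ultimately show ?thesis using edge_bounds(3)[OF that(1)] edgeT_eq[of k] by force
  qed
  obtain w where w: "edgeT i = {w, v}" "w \<noteq> v" using other[OF assms(1) v(1)] by blast
  obtain x where "edgeT j = {x, v}" "x \<noteq> v" using other[OF assms(2) v(2)] by blast
  then have x: "edgeT j = {v, x}" "v \<noteq> x" by auto
  have "w \<noteq> x" using w x edgeT_inj[OF assms(1,2)] assms(3) by blast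
  moreover have "w \<in> {1..18}" "v \<in> {1..18}" "x \<in> {1..18}"
  proof -
    have "edgeT i \<subseteq> {1..18}" "edgeT j \<subseteq> {1..18}"
      using edge_bounds[OF assms(1)] edge_bounds[OF assms(2)] by (auto simp: edgeT_eq)
    then show "w \<in> {1..18}" "v \<in> {1..18}" "x \<in> {1..18}" using w x by auto
  qed
  moreover obtain m n m' n' where "uval i = lift_transp w v m n" "uval j = lift_transp v x m' n'"
    using star[OF assms(1) w] star[OF assms(2) x] by blast
  ultimately show ?thesis using w x lift_transp_braid by simp
qed

text \<open>Multiplying both sides on the left by \<open>e\<close>, \<open>d\<close>,
  \<open>c\<close>, \<open>b\<close> in this order from the outside isolates \<open>f\<close> and
  leaves the palindrome around \<open>a\<close>.\<close>

lemma (in group) hexagon_relation_iff: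
  assumes "a \<in> carrier G" "b \<in> carrier G" "c \<in> carrier G" "d \<in> carrier G" "e \<in> carrier G" "f \<in> carrier G"
    and "b \<otimes> b = \<one>" "c \<otimes> c = \<one>" "d \<otimes> d = \<one>" "e \<otimes> e = \<one>"
  shows "a \<otimes> (b \<otimes> (c \<otimes> (d \<otimes> e))) = b \<otimes> (c \<otimes> (d \<otimes> (e \<otimes> f))) \<longleftrightarrow> f = cj e (cj d (cj c (cj b a)))" (is "?l = ?r \<longleftrightarrow> _")
proof
  assume "?l = ?r"
  then have "e \<otimes> (d \<otimes> (c \<otimes> (b \<otimes> ?l))) = e \<otimes> (d \<otimes> (c \<otimes> (b \<otimes> ?r)))" by simp
  then show "f = cj e (cj d (cj c (cj b a)))"
    using assms by (simp add: cj_def m_assoc involution_cancel)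
next
  assume "f = cj e (cj d (cj c (cj b a)))"
  then show "?l = ?r" using assms by (simp add: cj_def m_assoc involution_cancel)
qed

lemma lift_transp_sort: "\<beta> < \<alpha> \<Longrightarrow> lift_transp \<alpha> \<beta> m n = lift_transp \<beta> \<alpha> (- m) (- n)"
  by (rule lift_transp_swap) simp

lemma hexagon_edges:
  assumes "(a, b, c, d, e, f) \<in> set hexagons"
  shows "set [a, b, c, d, e, f] \<subseteq> {1..27}" "distinct [a, b, c, d, e, f]"
    and "edgeT a \<inter> edgeT b \<noteq> {}" "edgeT b \<inter> edgeT c \<noteq> {}" "edgeT c \<inter> edgeT d \<noteq> {}"
    "edgeT d \<inter> edgeT e \<noteq> {}" "edgeT e \<inter> edgeT f \<noteq> {}" "edgeT f \<inter> edgeT a \<noteq> {}"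
    and "edgeT a \<inter> edgeT c = {}" "edgeT a \<inter> edgeT d = {}" "edgeT a \<inter> edgeT e = {}"
    "edgeT b \<inter> edgeT d = {}" "edgeT b \<inter> edgeT e = {}" "edgeT b \<inter> edgeT f = {}"
    "edgeT c \<inter> edgeT e = {}" "edgeT c \<inter> edgeT f = {}" "edgeT d \<inter> edgeT f = {}"
proof -
  have "\<forall>(a, b, c, d, e, f)\<in>set hexagons. set [a, b, c, d, e, f] \<subseteq> {1..27} \<and> distinct [a, b, c, d, e, f]"
    by (simp add: hexagons_def)
  from bspec[OF this assms] show "set [a, b, c, d, e, f] \<subseteq> {1..27}" "distinct [a, b, c, d, e, f]" by (simp_all only: prod.case not_False_eq_True)
  have "\<forall>(a, b, c, d, e, f)\<in>set hexagons.
      edgeT a \<inter> edgeT b \<noteq> {} \<and> edgeT b \<inter> edgeT c \<noteq> {} \<and> edgeT c \<inter> edgeT d \<noteq> {} \<and>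
      edgeT d \<inter> edgeT e \<noteq> {} \<and> edgeT e \<inter> edgeT f \<noteq> {} \<and> edgeT f \<inter> edgeT a \<noteq> {}"
    by (simp add: hexagons_def edgeT_def edge_list_def)
  from bspec[OF this assms] show "edgeT a \<inter> edgeT b \<noteq> {}" "edgeT b \<inter> edgeT c \<noteq> {}" "edgeT c \<inter> edgeT d \<noteq> {}"
    "edgeT d \<inter> edgeT e \<noteq> {}" "edgeT e \<inter> edgeT f \<noteq> {}" "edgeT f \<inter> edgeT a \<noteq> {}"
    by (simp_all only: prod.case not_False_eq_True)
  have "\<forall>(a, b, c, d, e, f)\<in>set hexagons.
      edgeT a \<inter> edgeT c = {} \<and> edgeT a \<inter> edgeT d = {} \<and> edgeT a \<inter> edgeT e = {} \<and>
      edgeT b \<inter> edgeT d = {} \<and> edgeT b \<inter> edgeT e = {} \<and> edgeT b \<inter> edgeT f = {} \<and>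
      edgeT c \<inter> edgeT e = {} \<and> edgeT c \<inter> edgeT f = {} \<and> edgeT d \<inter> edgeT f = {}"
    by (simp add: hexagons_def edgeT_def edge_list_def)
  from bspec[OF this assms] show "edgeT a \<inter> edgeT c = {}" "edgeT a \<inter> edgeT d = {}" "edgeT a \<inter> edgeT e = {}"
    "edgeT b \<inter> edgeT d = {}" "edgeT b \<inter> edgeT e = {}" "edgeT b \<inter> edgeT f = {}"
    "edgeT c \<inter> edgeT e = {}" "edgeT c \<inter> edgeT f = {}" "edgeT d \<inter> edgeT f = {}"
    by (simp_all only: prod.case not_False_eq_True)
qed

text \<open>Transport adds the cocycle values along the first five edges, with signs given by the
  direction of traversal, and the equation holds because the holonomy of each hexagon is
  zero.\<close>

lemma uval_hexagon:
  assumes "(a, b, c, d, e, f) \<in> set hexagons"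
  shows "uval f = MM.cj (uval e) (MM.cj (uval d) (MM.cj (uval c) (MM.cj (uval b) (uval a))))"
proof -
  have "\<forall>(a, b, c, d, e, f)\<in>set hexagons.
      uval f = MM.cj (uval e) (MM.cj (uval d) (MM.cj (uval c) (MM.cj (uval b) (uval a))))"
    by (simp add: hexagons_def uval_def eA_def eB_def edge_list_def hm_def hn_def
        lift_transp_conj_simps lift_transp_sort)
  from bspec[OF this assms] show ?thesis by (simp only: prod.case)
qed

lemma relC_MM:
  assumes "r \<in> relC" shows "word_eval MM uval r = \<one>\<^bsub>MM\<^esub>"
proof -
  have C [simp]: "j \<in> {1..27} \<Longrightarrow> uval j \<in> carrier MM" for j using uval_closed by auto
  consider j where "r = [gC j, gC j]" "j \<in> {1..27}"
    | i j where "r = eq_rel [gC i, gC j] [gC j, gC i]" "i \<in> {1..27}" "j \<in> {1..27}" "edgeT i \<inter> edgeT j = {}"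
    | i j where "r = eq_rel [gC i, gC j, gC i] [gC j, gC i, gC j]" "i \<in> {1..27}" "j \<in> {1..27}" "i \<noteq> j" "edgeT i \<inter> edgeT j \<noteq> {}"
    | a b c d e f where "r = eq_rel [gC a, gC b, gC c, gC d, gC e] [gC b, gC c, gC d, gC e, gC f]"
        "(a, b, c, d, e, f) \<in> set hexagons"
    using assms unfolding relC_def by blast
  then show ?thesis
  proof cases
    case 1 then show ?thesis by (simp add: gC_def uval_invol del: atLeastAtMost_iff)
  next
    case 2
    then show ?thesis using uval_commute[of i j]
      by (simp add: MM.word_eval_eq_rel[OF uval_closed] gC_def del: atLeastAtMost_iff)
  next
    case 3
    then show ?thesis using uval_braid[of i j]
      by (simp add: MM.word_eval_eq_rel[OF uval_closed] gC_def MM.cj_def del: atLeastAtMost_iff)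
  next
    case 4
    then have m: "a \<in> {1..27}" "b \<in> {1..27}" "c \<in> {1..27}" "d \<in> {1..27}" "e \<in> {1..27}" "f \<in> {1..27}"
      using hexagon_edges(1)[OF 4(2)] by auto
    then have "uval a \<otimes>\<^bsub>MM\<^esub> (uval b \<otimes>\<^bsub>MM\<^esub> (uval c \<otimes>\<^bsub>MM\<^esub> (uval d \<otimes>\<^bsub>MM\<^esub> uval e))) =
        uval b \<otimes>\<^bsub>MM\<^esub> (uval c \<otimes>\<^bsub>MM\<^esub> (uval d \<otimes>\<^bsub>MM\<^esub> (uval e \<otimes>\<^bsub>MM\<^esub> uval f)))"
      using uval_hexagon[OF 4(2)] by (subst MM.hexagon_relation_iff) (simp_all add: uval_invol del: atLeastAtMost_iff)
    then show ?thesis using 4 m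
      by (simp add: MM.word_eval_eq_rel[OF uval_closed] gC_def del: atLeastAtMost_iff)
  qed
qed

lemma uC_closed [simp]: "j \<in> {1..27} \<Longrightarrow> uC j \<in> carrier C_grp"
  by (simp add: uC_def C_grp_def)

lemma C_generate: "carrier C_grp = generate C_grp (uC ` {1..27})"
  using presented_group_generate[of "{1..27}" relC] by (simp add: C_grp_def uC_def image_def)

lemma C_hom_MM:
  obtains F where "F \<in> hom C_grp MM" "\<And>j. j \<in> {1..27} \<Longrightarrow> F (uC j) = uval j"
proof -
  obtain F where F: "F \<in> hom C_grp MM"
    "\<And>w. wordS {1..27} w \<Longrightarrow> F (pres_class {1..27} relC w) = word_eval MM uval w"
    using MM.presented_group_hom_exists[OF uval_closed relC_MM] unfolding C_grp_def by blast
  have "F (uC j) = uval j" if "j \<in> {1..27}" for j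
    using F(2)[of "[(j, True)]"] uval_closed that by (auto simp: uC_def pgen_def Pi_iff)
  with F that show thesis by blast
qed

lemma uC_relation:
  assumes "eq_rel (map gC l) (map gC r) \<in> relC" "set l \<subseteq> {1..27}" "set r \<subseteq> {1..27}"
  shows "word_eval C_grp uC (map gC l) = word_eval C_grp uC (map gC r)"
proof -
  have "wordS {1..27} (map gC l)" "wordS {1..27} (map gC r)"
    using assms by (auto simp: wordS_def gC_def)
  from presented_group_relation[OF assms(1) this] show ?thesis
    by (simp add: C_grp_def uC_def[abs_def])
qed

lemma uC_invol [simp]: assumes "j \<in> {1..27}" shows "uC j \<otimes>\<^bsub>C_grp\<^esub> uC j = \<one>\<^bsub>C_grp\<^esub>"
proof -
  have "[gC j, gC j] \<in> relC" unfolding relC_def using assms by blast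
  then have "word_eval C_grp uC [gC j, gC j] = \<one>\<^bsub>C_grp\<^esub>"
    using presented_group_relator[of "[gC j, gC j]" relC "{1..27}"] assms
    by (simp add: C_grp_def uC_def[abs_def] gC_def)
  then show ?thesis using assms by (simp add: gC_def)
qed

lemma uC_commutes:
  assumes "i \<in> {1..27}" "j \<in> {1..27}" "edgeT i \<inter> edgeT j = {}"
  shows "C.commutes (uC i) (uC j)"
proof -
  have "eq_rel (map gC [i, j]) (map gC [j, i]) \<in> relC" unfolding relC_def using assms by simp blast
  from uC_relation[OF this] show ?thesis using assms
    by (simp add: gC_def C.commutes_def del: atLeastAtMost_iff)
qed

lemma uC_braid:
  assumes "i \<in> {1..27}" "j \<in> {1..27}" "i \<noteq> j" "edgeT i \<inter> edgeT j \<noteq> {}"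
  shows "C.braid (uC i) (uC j)"
proof -
  have "eq_rel (map gC [i, j, i]) (map gC [j, i, j]) \<in> relC" unfolding relC_def using assms by simp blast
  from uC_relation[OF this] show ?thesis using assms
    by (simp add: gC_def C.braid_def C.cj_def del: atLeastAtMost_iff)
qed

lemma uC_hexagon:
  assumes "(a, b, c, d, e, f) \<in> set hexagons"
  shows "C.hexagon (uC a) (uC b) (uC c) (uC d) (uC e) (uC f)"
proof -
  note h = hexagon_edges[OF assms]
  have m: "a \<in> {1..27}" "b \<in> {1..27}" "c \<in> {1..27}" "d \<in> {1..27}" "e \<in> {1..27}" "f \<in> {1..27}"
    using h(1) by auto
  have "eq_rel (map gC [a, b, c, d, e]) (map gC [b, c, d, e, f]) \<in> relC"
    unfolding relC_def using assms by simp blast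
  from uC_relation[OF this] have
    "uC a \<otimes>\<^bsub>C_grp\<^esub> (uC b \<otimes>\<^bsub>C_grp\<^esub> (uC c \<otimes>\<^bsub>C_grp\<^esub> (uC d \<otimes>\<^bsub>C_grp\<^esub> uC e))) =
      uC b \<otimes>\<^bsub>C_grp\<^esub> (uC c \<otimes>\<^bsub>C_grp\<^esub> (uC d \<otimes>\<^bsub>C_grp\<^esub> (uC e \<otimes>\<^bsub>C_grp\<^esub> uC f)))"
    using m by (simp add: gC_def del: atLeastAtMost_iff)
  then have "uC f = C.cj (uC e) (C.cj (uC d) (C.cj (uC c) (C.cj (uC b) (uC a))))"
    using m by (subst (asm) C.hexagon_relation_iff) (simp_all del: atLeastAtMost_iff)
  moreover have "C.braid (uC a) (uC b)" "C.braid (uC b) (uC c)" "C.braid (uC c) (uC d)"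
    "C.braid (uC d) (uC e)" "C.braid (uC e) (uC f)" "C.braid (uC f) (uC a)"
    using h(2) by (intro uC_braid m h(3-8); auto)+
  moreover have "C.commutes (uC a) (uC c)" "C.commutes (uC a) (uC d)" "C.commutes (uC a) (uC e)"
    "C.commutes (uC b) (uC d)" "C.commutes (uC b) (uC e)" "C.commutes (uC b) (uC f)"
    "C.commutes (uC c) (uC e)" "C.commutes (uC c) (uC f)" "C.commutes (uC d) (uC f)"
    by (intro uC_commutes m h(9-17))+
  moreover have "{uC a, uC b, uC c, uC d, uC e, uC f} \<subseteq> carrier C_grp"
    using m uC_closed by blast
  moreover have "\<forall>x\<in>{uC a, uC b, uC c, uC d, uC e, uC f}. x \<otimes>\<^bsub>C_grp\<^esub> x = \<one>\<^bsub>C_grp\<^esub>"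
    using m uC_invol by blast
  ultimately show ?thesis unfolding C.hexagon_def by (intro conjI)
qed

context lift_family
begin

lemma cj_P_t_simps:
  assumes "a \<in> V" "b \<in> V" "c \<in> V" "a \<noteq> b" "b \<noteq> c" "a \<noteq> c"
  shows "cj (P a b) (t b c) = P a c" "cj (P a b) (t c b) = P a c"
    "cj (P a b) (t a c) = P c b" "cj (P a b) (t c a) = P c b"
  using cj_P_t[of a b c] cj_P_t'[of a b c] assms by (simp_all add: t_sym[of c])

end

section \<open>A Hamiltonian path\<close>

text \<open>Edge 12 closes the path to a Hamiltonian cycle and edge 2 is a chord disjoint from it: lifted to all
  ordered pairs of vertices, these two edges give the two families of translations that generate the
  kernel.\<close>
definition path_vertices :: "nat list" where
  "path_vertices = [6, 4, 5, 1, 3, 2, 7, 11, 9, 17, 13, 15, 16, 8, 12, 10, 18, 14]"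

definition path_edges :: "nat list" where
  "path_edges = [9, 10, 5, 4, 6, 1, 14, 17, 18, 23, 22, 26, 16, 15, 19, 20, 24]"

text \<open>Turns the interval of vertices into an explicit finite set, so that equalities between
  vertex sets can be decided by simplification.\<close>

lemma vertices_eq_path: "{1..18} = set path_vertices"
proof (rule card_subset_eq[symmetric])
  have "distinct path_vertices" "length path_vertices = 18" by (simp_all add: path_vertices_def)
  then show "card (set path_vertices) = card {1..18::nat}" by (simp add: distinct_card)
qed (simp_all add: path_vertices_def)

lemma path_length [simp]: "length path_vertices = 18" "length path_edges = 17"
  by (simp_all add: path_vertices_def path_edges_def)

lemma path_edges_range: "set path_edges \<subseteq> {1..27}"
  by (simp add: path_edges_def)

lemma path_edge:
  assumes "i < 17"
  shows "path_edges ! i \<in> {1..27}" "edgeT (path_edges ! i) = {path_vertices ! i, path_vertices ! Suc i}"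
proof -
  show "path_edges ! i \<in> {1..27}"
    using subsetD[OF path_edges_range nth_mem[of i path_edges]] assms by simp
  have "list_all2 (\<lambda>j (v, w). edgeT j = {v, w}) path_edges (zip path_vertices (tl path_vertices))"
    by (simp add: path_edges_def path_vertices_def edgeT_def edge_list_def doubleton_eq_iff)
  from list_all2_nthD[OF this, of i] assms
  show "edgeT (path_edges ! i) = {path_vertices ! i, path_vertices ! Suc i}"
    by (simp add: nth_tl)
qed

text \<open>Edges of a path are disjoint unless consecutive, so (R1)-(R3) are the Coxeter relations
  of type A with 17 generators. No hexagon is involved.\<close>

lemma path_subgroup_card:
  "finite (generate C_grp (uC ` set path_edges))" "card (generate C_grp (uC ` set path_edges)) \<le> fact 18"
proof -
  let ?e = "\<lambda>i. uC (path_edges ! i)"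
  have dist: "distinct path_vertices" and len: "length path_vertices = 18" by (simp_all add: path_vertices_def)
  have ne: "path_vertices ! i \<noteq> path_vertices ! j" if "i < 18" "j < 18" "i \<noteq> j" for i j
    using that dist len by (simp add: nth_eq_iff_index_eq)
  have "finite (generate C_grp (?e ` {..<17})) \<and> card (generate C_grp (?e ` {..<17})) \<le> fact (Suc 17)"
  proof (rule C.coxeter_generate_card_le)
    fix i j :: nat assume ij: "i < 17" "j < 17" "Suc i < j"
    have "edgeT (path_edges ! i) \<inter> edgeT (path_edges ! j) = {}"
      using ij path_edge(2)[of i] path_edge(2)[of j] ne[of i j] ne[of i "Suc j"] ne[of "Suc i" j] ne[of "Suc i" "Suc j"]
      by auto
    then show "?e i \<otimes>\<^bsub>C_grp\<^esub> ?e j = ?e j \<otimes>\<^bsub>C_grp\<^esub> ?e i"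
      using uC_commutes[of "path_edges ! i" "path_edges ! j"] path_edge(1) ij by (simp add: C.commutes_def)
  next
    fix i :: nat assume i: "Suc i < 17"
    have "path_edges ! i \<noteq> path_edges ! Suc i"
    proof -
      have "distinct path_edges" "length path_edges = 17" by (simp_all add: path_edges_def)
      then show ?thesis using i by (simp add: nth_eq_iff_index_eq)
    qed
    moreover have "edgeT (path_edges ! i) \<inter> edgeT (path_edges ! Suc i) \<noteq> {}"
      using i path_edge(2)[of i] path_edge(2)[of "Suc i"] by auto
    ultimately show "?e i \<otimes>\<^bsub>C_grp\<^esub> (?e (Suc i) \<otimes>\<^bsub>C_grp\<^esub> ?e i) = ?e (Suc i) \<otimes>\<^bsub>C_grp\<^esub> (?e i \<otimes>\<^bsub>C_grp\<^esub> ?e (Suc i))"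
      using uC_braid[of "path_edges ! i" "path_edges ! Suc i"] path_edge(1)[of i] path_edge(1)[of "Suc i"] i
      by (simp add: C.braid_def C.cj_def)
  qed (use path_edge(1) in \<open>auto simp del: atLeastAtMost_iff\<close>)
  moreover have "?e ` {..<17} = uC ` set path_edges"
  proof -
    have "(\<lambda>i. path_edges ! i) ` {..<17} = set path_edges"
      by (auto simp: set_conv_nth path_edges_def)
    then show ?thesis by (metis image_image)
  qed
  ultimately show "finite (generate C_grp (uC ` set path_edges))" "card (generate C_grp (uC ` set path_edges)) \<le> fact 18"
    by simp_all
qed

section \<open>The copy of the symmetric group generated by the path\<close>

locale C_model =
  fixes F
  assumes F_hom: "F \<in> hom C_grp MM" and F_u: "\<And>j. j \<in> {1..27} \<Longrightarrow> F (uC j) = uval j"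
begin

sublocale F: group_hom C_grp MM F using F_hom by unfold_locales

definition psi :: "nat word set \<Rightarrow> nat \<Rightarrow> nat" where "psi c = fst (F c)"

lemma fst_MM_mult: "fst (x \<otimes>\<^bsub>MM\<^esub> y) = fst x \<circ> fst y"
  by (cases x, cases y) (simp add: MM_simps)

lemma psi_permutes: "c \<in> carrier C_grp \<Longrightarrow> psi c permutes {1..18}"
  using F.hom_closed[of c] by (cases "F c") (auto simp: psi_def MM_simps)

lemma psi_mult: "c \<in> carrier C_grp \<Longrightarrow> d \<in> carrier C_grp \<Longrightarrow> psi (c \<otimes>\<^bsub>C_grp\<^esub> d) = psi c \<circ> psi d"
  by (simp add: psi_def fst_MM_mult)

lemma psi_one: "psi \<one>\<^bsub>C_grp\<^esub> = id" by (simp add: psi_def MM_simps)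

lemma psi_u: "j \<in> {1..27} \<Longrightarrow> psi (uC j) = transpose (eA j) (eB j)"
  by (simp add: psi_def F_u uval_def lift_transp_def)

lemma psi_hom: "psi \<in> hom C_grp (sym_group 18)"
  using psi_permutes by (intro homI) (auto simp: psi_mult sym_group_carrier sym_group_mult)

lemma psi_kernel:
  "subgroup {c \<in> carrier C_grp. psi c = id} C_grp" "{c \<in> carrier C_grp. psi c = id} \<lhd> C_grp"
proof -
  interpret ps: group_hom C_grp "sym_group 18" psi
    using psi_hom sym_group_is_group by (simp add: group_hom_def group_hom_axioms_def C.group_axioms)
  have "kernel C_grp (sym_group 18) psi = {c \<in> carrier C_grp. psi c = id}"
    by (simp add: kernel_def sym_group_one)
  then show "subgroup {c \<in> carrier C_grp. psi c = id} C_grp" "{c \<in> carrier C_grp. psi c = id} \<lhd> C_grp"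
    using ps.subgroup_kernel ps.normal_kernel by simp_all
qed

lemma psi_generate_tree:
  assumes "S \<subseteq> {1..27}" "grows {v} es" "insert v (snd ` set es) = {1..18}"
    and "\<And>a b. (a, b) \<in> set es \<Longrightarrow> \<exists>j\<in>S. edgeT j = {a, b}"
  shows "psi ` generate C_grp (uC ` S) = carrier (sym_group 18)"
proof
  have S: "uC ` S \<subseteq> carrier C_grp" using assms(1) uC_closed by blast
  note Sc = C.generate_in_carrier[OF S]
  show "psi ` generate C_grp (uC ` S) \<subseteq> carrier (sym_group 18)"
    using Sc psi_permutes by (auto simp: sym_group_carrier)
  show "carrier (sym_group 18) \<subseteq> psi ` generate C_grp (uC ` S)"
  proof
    fix \<sigma> assume "\<sigma> \<in> carrier (sym_group 18)"
    then have \<sigma>: "\<sigma> permutes insert v (snd ` set es)" by (simp add: sym_group_carrier assms(3))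
    show "\<sigma> \<in> psi ` generate C_grp (uC ` S)"
    proof (rule tree_generates_permutations[OF _ _ assms(2) _ \<sigma>])
      fix \<sigma> \<tau> assume "\<sigma> \<in> psi ` generate C_grp (uC ` S)" "\<tau> \<in> psi ` generate C_grp (uC ` S)"
      then obtain c d where cd: "c \<in> generate C_grp (uC ` S)" "d \<in> generate C_grp (uC ` S)" "\<sigma> = psi c" "\<tau> = psi d"
        by blast
      then have "\<sigma> \<circ> \<tau> = psi (c \<otimes>\<^bsub>C_grp\<^esub> d)" using Sc by (simp add: psi_mult)
      moreover have "c \<otimes>\<^bsub>C_grp\<^esub> d \<in> generate C_grp (uC ` S)" using cd(1,2) by (rule generate.eng)
      ultimately show "\<sigma> \<circ> \<tau> \<in> psi ` generate C_grp (uC ` S)" by blast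
    next
      show "id \<in> psi ` generate C_grp (uC ` S)" using psi_one generate.one by (metis imageI)
    next
      fix a b assume "(a, b) \<in> set es"
      then obtain j where j: "j \<in> S" "{eA j, eB j} = {a, b}" using assms(4)[of a b] by (auto simp: edgeT_eq)
      then have "transpose a b = psi (uC j)"
        using assms(1) psi_u[of j] by (auto simp: doubleton_eq_iff transpose_commute)
      then show "transpose a b \<in> psi ` generate C_grp (uC ` S)" using j by (auto intro: generate.incl)
    qed
  qed
qed

definition QP :: "nat word set set" where "QP = generate C_grp (uC ` set path_edges)"

lemma QP_carrier: "c \<in> QP \<Longrightarrow> c \<in> carrier C_grp"
proof -
  have "uC ` set path_edges \<subseteq> carrier C_grp" using path_edges_range uC_closed by blast
  then show "c \<in> QP \<Longrightarrow> c \<in> carrier C_grp" unfolding QP_def by (rule C.generate_in_carrier)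
qed

text \<open>The image of the path subgroup is the whole symmetric group because the path is
  spanning, while the Coxeter bound says that the subgroup has at most \<open>fact 18\<close>
  elements; a surjection between such sets is injective.\<close>

lemma psi_QP: "bij_betw psi QP {\<sigma>. \<sigma> permutes {1..18}}"
proof -
  have "psi ` QP = carrier (sym_group 18)"
    unfolding QP_def
  proof (rule psi_generate_tree[OF path_edges_range])
    show "grows {6} (zip path_vertices (tl path_vertices))" by (simp add: path_vertices_def)
    show "insert 6 (snd ` set (zip path_vertices (tl path_vertices))) = {1..18}"
      unfolding vertices_eq_path by (simp add: path_vertices_def)
    fix a b assume "(a, b) \<in> set (zip path_vertices (tl path_vertices))"
    then obtain i where i: "i < 17" "a = path_vertices ! i" "b = tl path_vertices ! i"
      by (auto simp: set_zip)
    then have "b = path_vertices ! Suc i" by (simp add: nth_tl)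
    moreover have "path_edges ! i \<in> set path_edges" using i by simp
    ultimately show "\<exists>j\<in>set path_edges. edgeT j = {a, b}" using path_edge(2)[OF i(1)] i by blast
  qed
  moreover have "card QP \<le> card (carrier (sym_group 18))" "finite QP"
    unfolding QP_def using path_subgroup_card by (simp_all add: sym_group_card_carrier)
  ultimately have "inj_on psi QP" using card_image_le[of QP psi] by (intro eq_card_imp_inj_on) auto
  with \<open>psi ` QP = _\<close> show ?thesis by (auto simp: bij_betw_def sym_group_carrier)
qed

definition s :: "(nat \<Rightarrow> nat) \<Rightarrow> nat word set" where "s = inv_into QP psi"

lemma s_QP: "\<sigma> permutes {1..18} \<Longrightarrow> s \<sigma> \<in> QP"
  and psi_s: "\<sigma> permutes {1..18} \<Longrightarrow> psi (s \<sigma>) = \<sigma>"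
  using psi_QP unfolding s_def bij_betw_def by (auto intro: inv_into_into f_inv_into_f)

lemma s_psi: "c \<in> QP \<Longrightarrow> s (psi c) = c"
  using psi_QP unfolding s_def bij_betw_def by (auto intro: inv_into_f_f)

sublocale sym_rep C_grp "{1..18}" s
proof
  fix \<sigma> \<tau> :: "nat \<Rightarrow> nat" assume *: "\<sigma> permutes {1..18}" "\<tau> permutes {1..18}"
  have "s \<sigma> \<otimes>\<^bsub>C_grp\<^esub> s \<tau> \<in> QP" using s_QP[OF *(1)] s_QP[OF *(2)] unfolding QP_def by (rule generate.eng)
  moreover have "psi (s \<sigma> \<otimes>\<^bsub>C_grp\<^esub> s \<tau>) = \<sigma> \<circ> \<tau>"
    using * s_QP QP_carrier by (simp add: psi_mult psi_s)
  ultimately show "s (\<sigma> \<circ> \<tau>) = s \<sigma> \<otimes>\<^bsub>C_grp\<^esub> s \<tau>" using s_psi by metis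
qed (use s_QP QP_carrier in auto)

lemma uC_path:
  assumes "j \<in> set path_edges" "edgeT j = {a, b}"
  shows "uC j = t a b"
proof -
  have j: "j \<in> {1..27}" using assms path_edges_range by blast
  have "uC j \<in> QP" unfolding QP_def using assms(1) by (auto intro: generate.incl)
  then have "uC j = s (transpose (eA j) (eB j))" using s_psi psi_u[OF j] by metis
  moreover have "eA j = a \<and> eB j = b \<or> eA j = b \<and> eB j = a"
    using assms(2) by (auto simp: edgeT_eq doubleton_eq_iff)
  ultimately show ?thesis by (elim disjE) (simp_all add: t_def transpose_commute)
qed

text \<open>The permutations whose lift commutes with \<open>p\<close> are closed under composition,
  so it suffices to test the transpositions along a tree on \<open>W\<close>.\<close>

lemma commutes_stabilizer:
  assumes "p \<in> carrier C_grp" "grows {v} es" "insert v (snd ` set es) = W" "W \<subseteq> {1..18}"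
    and "\<And>a b. (a, b) \<in> set es \<Longrightarrow> a \<in> {1..18} \<and> b \<in> {1..18} \<and> C.commutes p (t a b)"
    and "\<sigma> permutes W"
  shows "s \<sigma> \<otimes>\<^bsub>C_grp\<^esub> p = p \<otimes>\<^bsub>C_grp\<^esub> s \<sigma>"
proof -
  have "\<sigma> \<in> {\<sigma>. \<sigma> permutes {1..18} \<and> C.commutes p (s \<sigma>)}"
  proof (rule tree_generates_permutations[OF _ _ assms(2)])
    show "\<sigma> permutes insert v (snd ` set es)" using assms by simp
    show "id \<in> {\<sigma>. \<sigma> permutes {1..18} \<and> C.commutes p (s \<sigma>)}"
      using assms(1) by (simp add: permutes_id C.commutes_def)
    fix a b assume "(a, b) \<in> set es"
    then show "transpose a b \<in> {\<sigma>. \<sigma> permutes {1..18} \<and> C.commutes p (s \<sigma>)}"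
      using assms(5)[of a b] by (auto simp: t_def permutes_swap_id simp del: atLeastAtMost_iff)
  next
    fix \<sigma> \<tau> assume "\<sigma> \<in> {\<sigma>. \<sigma> permutes {1..18} \<and> C.commutes p (s \<sigma>)}" "\<tau> \<in> {\<sigma>. \<sigma> permutes {1..18} \<and> C.commutes p (s \<sigma>)}"
    then show "\<sigma> \<circ> \<tau> \<in> {\<sigma>. \<sigma> permutes {1..18} \<and> C.commutes p (s \<sigma>)}"
      using assms(1) by (auto simp: s_comp permutes_compose intro!: C.commutes_mult)
  qed
  then show ?thesis by (simp add: C.commutes_def)
qed

end

section \<open>Lifting edges 12 and 2 to families\<close>

context C_model
begin

lemma uC_path_simps:
  "uC 9 = t 4 6" "uC 10 = t 4 5" "uC 5 = t 1 5" "uC 4 = t 1 3" "uC 6 = t 2 3" "uC 1 = t 2 7"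
  "uC 14 = t 7 11" "uC 17 = t 9 11" "uC 18 = t 9 17" "uC 23 = t 13 17" "uC 22 = t 13 15"
  "uC 26 = t 15 16" "uC 16 = t 8 16" "uC 15 = t 8 12" "uC 19 = t 10 12" "uC 20 = t 10 18" "uC 24 = t 14 18"
  by (rule uC_path; simp add: path_edges_def edgeT_def edge_list_def)+

lemma uC_commutes_path:
  assumes "i \<in> {1..27}" "edgeT i \<inter> {a, b} = {}" "\<exists>j\<in>set path_edges. edgeT j = {a, b}"
  shows "C.commutes (uC i) (t a b)"
  using assms uC_path path_edges_range uC_commutes by (metis subsetD)

text \<open>Edge 12 joins the two ends 6 and 14 of the path. What remains of the path without its
  ends is still connected and disjoint from edge 12, so (R2) alone gives commutation with the
  stabilizer. The vertices 18 and 4 are the neighbours of 14 and 6 on the path.\<close>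

lemma path_lift_exists:
  obtains P where "lift_family C_grp {1..18} s P" "P 6 14 = uC 12"
proof (rule lift_family_exists[of "uC 12" 6 14 18 4])
  let ?es = "[(4,5),(5,1),(1,3),(3,2),(2,7),(7,11),(11,9),(9,17),(17,13),(13,15),(15,16),(16,8),(8,12),(12,10),(10,18)] :: (nat \<times> nat) list"
  fix \<sigma> :: "nat \<Rightarrow> nat" assume "\<sigma> permutes {1..18} - {6, 14}"
  then show "s \<sigma> \<otimes>\<^bsub>C_grp\<^esub> uC 12 = uC 12 \<otimes>\<^bsub>C_grp\<^esub> s \<sigma>"
  proof (rule commutes_stabilizer[rotated 5])
    show "insert 4 (snd ` set ?es) = {1..18} - {6, 14}"
      unfolding vertices_eq_path by (simp add: path_vertices_def insert_Diff_if)
    fix a b assume "(a, b) \<in> set ?es"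
    moreover have "\<forall>(a, b)\<in>set ?es. a \<in> {1..18} \<and> b \<in> {1..18} \<and> edgeT 12 \<inter> {a, b} = {} \<and> (\<exists>j\<in>set path_edges. edgeT j = {a, b})"
      by (simp add: path_edges_def edgeT_def edge_list_def doubleton_eq_iff)
    ultimately show "a \<in> {1..18} \<and> b \<in> {1..18} \<and> C.commutes (uC 12) (t a b)"
      using uC_commutes_path[of 12 a b] by auto
  qed auto
next
  show "C.braid (uC 12) (t 14 18)"
    unfolding uC_path_simps[symmetric] by (rule uC_braid) (simp_all add: edgeT_def edge_list_def)
  show "C.braid (uC 12) (t 6 4)"
    unfolding t_sym[of 6] uC_path_simps[symmetric] by (rule uC_braid) (simp_all add: edgeT_def edge_list_def)
qed (use that in auto)

text \<open>Edge 2 joins two interior vertices, 1 and 13, of the path. Removing them breaks the path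
  between 5 and 3 and between 17 and 15. Each gap is bridged by a hexagon through one of the two
  vertices that avoids the other, so that its four remaining edges are disjoint from edge 2.\<close>

lemma uC2_commutes_forks: "C.commutes (uC 2) (t 5 3)" "C.commutes (uC 2) (t 17 15)"
proof -
  have h: "C.hexagon (uC 11) (uC 15) (uC 19) (uC 8) (uC 4) (uC 5)" "C.hexagon (uC 27) (uC 23) (uC 22) (uC 26) (uC 25) (uC 24)"
    by (rule uC_hexagon; simp add: hexagons_def)+
  have "C.commutes (uC 2) (C.cj (uC 5) (uC 4))"
    by (rule C.hexagon_fork[OF C.hexagon_rotate[OF C.hexagon_rotate[OF C.hexagon_rotate[OF C.hexagon_rotate[OF h(1)]]]]])
      (auto intro!: uC_commutes simp: edgeT_def edge_list_def)
  then show "C.commutes (uC 2) (t 5 3)" by (simp add: uC_path_simps cj_t_t)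
  have "C.commutes (uC 2) (C.cj (uC 22) (uC 23))"
    by (rule C.hexagon_fork[OF C.hexagon_rotate[OF h(2)]])
      (auto intro!: uC_commutes simp: edgeT_def edge_list_def)
  then show "C.commutes (uC 2) (t 17 15)" by (simp add: uC_path_simps cj_t_t t_sym[of 17])
qed

text \<open>The stabilizer of the pair 1, 13 is generated along the path with its two gaps closed by
  the fork transpositions. The vertices 15 and 3 are path neighbours of 13 and 1 and supply the
  braid relations at the two ends.\<close>

lemma chord_lift_exists:
  obtains Q where "lift_family C_grp {1..18} s Q" "Q 1 13 = uC 2"
proof (rule lift_family_exists[of "uC 2" 1 13 15 3])
  let ?es = "[(6,4),(4,5),(3,2),(2,7),(7,11),(11,9),(9,17),(15,16),(16,8),(8,12),(12,10),(10,18),(18,14)] :: (nat \<times> nat) list"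
  let ?es' = "[(6,4),(4,5),(5,3),(3,2),(2,7),(7,11),(11,9),(9,17),(17,15),(15,16),(16,8),(8,12),(12,10),(10,18),(18,14)] :: (nat \<times> nat) list"
  fix \<sigma> :: "nat \<Rightarrow> nat" assume "\<sigma> permutes {1..18} - {1, 13}"
  then show "s \<sigma> \<otimes>\<^bsub>C_grp\<^esub> uC 2 = uC 2 \<otimes>\<^bsub>C_grp\<^esub> s \<sigma>"
  proof (rule commutes_stabilizer[rotated 5])
    show "insert 6 (snd ` set ?es') = {1..18} - {1, 13}"
      unfolding vertices_eq_path by (simp add: path_vertices_def insert_Diff_if)
    fix a b assume "(a, b) \<in> set ?es'"
    then consider "(a, b) \<in> set ?es" | "a = 5" "b = 3" | "a = 17" "b = 15" by auto
    then show "a \<in> {1..18} \<and> b \<in> {1..18} \<and> C.commutes (uC 2) (t a b)"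
    proof cases
      case 1
      moreover have "\<forall>(a, b)\<in>set ?es. a \<in> {1..18} \<and> b \<in> {1..18} \<and> edgeT 2 \<inter> {a, b} = {} \<and> (\<exists>j\<in>set path_edges. edgeT j = {a, b})"
        by (simp add: path_edges_def edgeT_def edge_list_def doubleton_eq_iff)
      ultimately show ?thesis using uC_commutes_path[of 2 a b] by auto
    qed (simp_all add: uC2_commutes_forks)
  qed auto
next
  show "C.braid (uC 2) (t 13 15)"
    unfolding uC_path_simps[symmetric] by (rule uC_braid) (simp_all add: edgeT_def edge_list_def)
  show "C.braid (uC 2) (t 1 3)"
    unfolding uC_path_simps[symmetric] by (rule uC_braid) (simp_all add: edgeT_def edge_list_def)
qed (use that in auto)

end

section \<open>Expressing the remaining edges through the two families\<close>

locale C_families = C_model F + lift_pair C_grp "{1..18}" "C_model.s F" P Q for F P Q +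
  assumes P_base: "P 6 14 = uC 12" and Q_base: "Q 1 13 = uC 2"
begin

lemmas cj_rules = cj_t_t P.cj_t_P Q.cj_t_P P.cj_P_t_simps Q.cj_P_t_simps transpose_def

text \<open>The hexagon is rotated until edge 13 comes last; the other five edges are path edges and
  the chord, and transport prolongs the arc of the chord by ordinary edges. The following chords
  arise in the same way, in an order in which each hexagon has one unknown edge left.\<close>

lemma chord_13: "uC 13 = Q 7 15"
proof -
  have "C.hexagon (uC 2) (uC 4) (uC 6) (uC 1) (uC 13) (uC 22)" by (rule uC_hexagon) (simp add: hexagons_def)
  from this[THEN C.hexagon_rotate, THEN C.hexagon_rotate, THEN C.hexagon_rotate, THEN C.hexagon_rotate,
      THEN C.hexagon_rotate, THEN C.hexagonD]
  show ?thesis by (simp add: uC_path_simps uC_path_simps(6)[simplified] Q_base[symmetric] cj_rules)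
qed

lemma chord_21: "uC 21 = Q 11 12"
proof -
  have "C.hexagon (uC 26) (uC 13) (uC 14) (uC 21) (uC 15) (uC 16)" by (rule uC_hexagon) (simp add: hexagons_def)
  from this[THEN C.hexagon_rotate, THEN C.hexagon_rotate, THEN C.hexagon_rotate, THEN C.hexagon_rotate, THEN C.hexagonD]
  show ?thesis by (simp add: uC_path_simps chord_13 cj_rules)
qed

lemma chord_27: "uC 27 = Q 17 18"
proof -
  have "C.hexagon (uC 21) (uC 17) (uC 18) (uC 27) (uC 20) (uC 19)" by (rule uC_hexagon) (simp add: hexagons_def)
  from this[THEN C.hexagon_rotate, THEN C.hexagon_rotate, THEN C.hexagon_rotate, THEN C.hexagon_rotate, THEN C.hexagonD]
  show ?thesis by (simp add: uC_path_simps chord_21 cj_rules)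
qed

lemma chord_25: "uC 25 = Q 16 14"
proof -
  have "C.hexagon (uC 27) (uC 23) (uC 22) (uC 26) (uC 25) (uC 24)" by (rule uC_hexagon) (simp add: hexagons_def)
  from this[THEN C.hexagon_rotate, THEN C.hexagon_rotate, THEN C.hexagon_rotate, THEN C.hexagon_rotate,
      THEN C.hexagon_rotate, THEN C.hexagonD]
  show ?thesis by (simp add: uC_path_simps chord_27 cj_rules)
qed

lemma chord_3: "uC 3 = Q 4 9"
proof -
  have "C.hexagon (uC 3) (uC 10) (uC 5) (uC 2) (uC 23) (uC 18)" by (rule uC_hexagon) (simp add: hexagons_def)
  from this[THEN C.hexagon_rotate, THEN C.hexagonD]
  show ?thesis by (simp add: uC_path_simps Q_base[symmetric] cj_rules)
qed

lemma chord_7: "uC 7 = Q 6 2"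
proof -
  have "C.hexagon (uC 1) (uC 7) (uC 9) (uC 3) (uC 17) (uC 14)" by (rule uC_hexagon) (simp add: hexagons_def)
  from this[THEN C.hexagon_rotate, THEN C.hexagon_rotate, THEN C.hexagonD]
  show ?thesis by (simp add: uC_path_simps uC_path_simps(6)[simplified] chord_3 cj_rules)
qed

text \<open>Its hexagon contains edge 12 from the first family and edge 7 from the second, so edge 8
  is a lifted transposition with periods from both. The same happens for edge 11 through edges 12
  and 25.\<close>

lemma chord_8: "uC 8 = C.cj (Q 6 3) (P 6 10)"
proof -
  have "C.hexagon (uC 8) (uC 20) (uC 24) (uC 12) (uC 7) (uC 6)" by (rule uC_hexagon) (simp add: hexagons_def)
  from this[THEN C.hexagon_rotate, THEN C.hexagonD]
  have "uC 8 = C.cj (t 2 3) (C.cj (Q 6 2) (P 6 10))"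
    by (simp add: uC_path_simps P_base[symmetric] chord_7 cj_rules)
  then show ?thesis by (simp add: C.cj_cj_distrib cj_rules)
qed

lemma chord_11: "uC 11 = C.cj (Q 8 14) (P 5 14)"
proof -
  have "C.hexagon (uC 12) (uC 25) (uC 16) (uC 11) (uC 10) (uC 9)" by (rule uC_hexagon) (simp add: hexagons_def)
  from this[THEN C.hexagon_rotate, THEN C.hexagon_rotate, THEN C.hexagon_rotate, THEN C.hexagon_rotate, THEN C.hexagonD]
  have "uC 11 = C.cj (t 8 16) (C.cj (Q 16 14) (P 5 14))"
    by (simp add: uC_path_simps P_base[symmetric] chord_25 cj_rules)
  then show ?thesis by (simp add: C.cj_cj_distrib cj_rules)
qed

text \<open>The one hexagon not yet solved for an edge contains both mixed edges. Its relation gives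
  edge 11 as a transport of edge 8, to be compared with \<open>chord_11\<close>. In that transport
  \<open>Q 6 3\<close> commutes with \<open>t 8 10\<close>, so only the inner \<open>P 6 10\<close>
  moves the latter, and the two outer edges shift 3 to 5.\<close>

lemma mixed_eq: "C.cj (Q 6 5) (P 6 8) = C.cj (Q 8 14) (P 5 14)"
proof -
  have "C.hexagon (uC 11) (uC 15) (uC 19) (uC 8) (uC 4) (uC 5)" by (rule uC_hexagon) (simp add: hexagons_def)
  from this[THEN C.hexagon_rotate, THEN C.hexagonD]
  have "uC 11 = C.cj (t 1 5) (C.cj (t 1 3) (C.cj (C.cj (Q 6 3) (P 6 10)) (t 8 10)))"
    by (simp add: uC_path_simps chord_8 cj_rules)
  also have "C.cj (C.cj (Q 6 3) (P 6 10)) (t 8 10) = C.cj (Q 6 3) (C.cj (P 6 10) (C.cj (Q 6 3) (t 8 10)))"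
    by (simp add: C.cj_def C.m_assoc)
  also have "\<dots> = C.cj (Q 6 3) (P 6 8)"
    by (simp add: Q.cj_P_t_disjoint cj_rules)
  finally show ?thesis by (simp add: chord_11 C.cj_cj_distrib cj_rules)
qed

text \<open>The quadruple 5, 6, 14, 8 is the one in \<open>mixed_eq\<close>. The quadruple 6, 14, 1,
  13 consists of the ends of the disjoint edges 12 and 2.\<close>

lemma C_central_element:
  obtains z where "z \<in> carrier C_grp"
    "\<And>a b. \<lbrakk>a \<in> {1..18}; b \<in> {1..18}; a \<noteq> b\<rbrakk> \<Longrightarrow> C.commutes z (P.Tr a b) \<and> C.commutes z (Q.Tr a b)"
    "\<And>a b c. \<lbrakk>a \<in> {1..18}; b \<in> {1..18}; c \<in> {1..18}; distinct [a, b, c]\<rbrakk> \<Longrightarrow>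
       P.Tr a c \<otimes>\<^bsub>C_grp\<^esub> Q.Tr b a = Q.Tr b a \<otimes>\<^bsub>C_grp\<^esub> P.Tr a c \<otimes>\<^bsub>C_grp\<^esub> z"
proof (rule central_element_exists[of 5 6 14 8 6 14 1 13])
  show "C.cj (Q 6 5) (P 6 8) = C.cj (Q 8 14) (P 5 14)" by (rule mixed_eq)
  show "C.commutes (P 6 14) (Q 1 13)"
    unfolding P_base Q_base by (rule uC_commutes) (simp_all add: edgeT_def edge_list_def)
qed (use that in auto)

end

section \<open>Coordinates of the model\<close>

context C_model
begin

definition coA :: "nat word set \<Rightarrow> nat \<Rightarrow> int" where "coA c = fst (snd (F c))"
definition coB :: "nat word set \<Rightarrow> nat \<Rightarrow> int" where "coB c = fst (snd (snd (F c)))"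

text \<open>The coordinates are crossed homomorphisms: they add after a permutation of the entries
  of the second factor, and become additive on the kernel of \<open>psi\<close>.\<close>

lemma co_mult:
  assumes "c \<in> carrier C_grp" "d \<in> carrier C_grp"
  shows "coA (c \<otimes>\<^bsub>C_grp\<^esub> d) i = coA c i + coA d (inv_into UNIV (psi c) i)"
    "coB (c \<otimes>\<^bsub>C_grp\<^esub> d) i = coB c i + coB d (inv_into UNIV (psi c) i)"
proof -
  obtain \<sigma> a b e \<sigma>' a' b' e' where "F c = (\<sigma>, a, b, e)" "F d = (\<sigma>', a', b', e')"
    by (metis prod.exhaust)
  then show "coA (c \<otimes>\<^bsub>C_grp\<^esub> d) i = coA c i + coA d (inv_into UNIV (psi c) i)"
    "coB (c \<otimes>\<^bsub>C_grp\<^esub> d) i = coB c i + coB d (inv_into UNIV (psi c) i)"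
    using assms by (simp_all add: coA_def coB_def psi_def MM_simps heis_simps hperm_simp)
qed

lemma co_one: "coA \<one>\<^bsub>C_grp\<^esub> i = 0" "coB \<one>\<^bsub>C_grp\<^esub> i = 0"
  by (simp_all add: coA_def coB_def MM_simps heis_simps)

text \<open>The contributions of \<open>g\<close> and of its inverse cancel, so conjugation merely
  permutes the coordinates of a kernel element.\<close>

lemma co_conj:
  assumes "g \<in> carrier C_grp" "x \<in> carrier C_grp" "psi x = id"
  shows "coA (g \<otimes>\<^bsub>C_grp\<^esub> (x \<otimes>\<^bsub>C_grp\<^esub> inv\<^bsub>C_grp\<^esub> g)) i = coA x (inv_into UNIV (psi g) i)"
    "coB (g \<otimes>\<^bsub>C_grp\<^esub> (x \<otimes>\<^bsub>C_grp\<^esub> inv\<^bsub>C_grp\<^esub> g)) i = coB x (inv_into UNIV (psi g) i)"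
    "psi (g \<otimes>\<^bsub>C_grp\<^esub> (x \<otimes>\<^bsub>C_grp\<^esub> inv\<^bsub>C_grp\<^esub> g)) = id"
proof -
  have "coA g i + coA (inv\<^bsub>C_grp\<^esub> g) (inv_into UNIV (psi g) i) = 0"
    "coB g i + coB (inv\<^bsub>C_grp\<^esub> g) (inv_into UNIV (psi g) i) = 0"
    using co_mult[of g "inv\<^bsub>C_grp\<^esub> g" i] assms by (simp_all add: co_one)
  then show "coA (g \<otimes>\<^bsub>C_grp\<^esub> (x \<otimes>\<^bsub>C_grp\<^esub> inv\<^bsub>C_grp\<^esub> g)) i = coA x (inv_into UNIV (psi g) i)"
    "coB (g \<otimes>\<^bsub>C_grp\<^esub> (x \<otimes>\<^bsub>C_grp\<^esub> inv\<^bsub>C_grp\<^esub> g)) i = coB x (inv_into UNIV (psi g) i)"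
    using assms by (simp_all add: co_mult)
  have "psi g \<circ> psi (inv\<^bsub>C_grp\<^esub> g) = id"
    using psi_mult[of g "inv\<^bsub>C_grp\<^esub> g"] assms by (simp add: psi_one)
  then show "psi (g \<otimes>\<^bsub>C_grp\<^esub> (x \<otimes>\<^bsub>C_grp\<^esub> inv\<^bsub>C_grp\<^esub> g)) = id"
    using assms by (simp add: psi_mult)
qed

text \<open>A potential whose coboundary is the cocycle on the Hamiltonian path.\<close>
definition gpa :: "nat \<Rightarrow> int" where "gpa v = (if v \<in> {7..18} then 1 else 0)"
definition gpb :: "nat \<Rightarrow> int" where
  "gpb v = (if v \<in> {2, 3} then 1 else if v \<in> {7, 8, 9, 11, 13, 15, 16, 17} then - 1 else 0)"

text \<open>On a path every cocycle is a coboundary. Hence the coordinates of an element of the path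
  subgroup depend only on its permutation and telescope along products.\<close>

lemma co_QP:
  assumes "c \<in> QP"
  shows "coA c i = gpa i - gpa (inv_into UNIV (psi c) i)" "coB c i = gpb i - gpb (inv_into UNIV (psi c) i)"
proof -
  let ?R = "\<lambda>c. \<forall>i. coA c i = gpa i - gpa (inv_into UNIV (psi c) i) \<and> coB c i = gpb i - gpb (inv_into UNIV (psi c) i)"
  have sub: "uC ` set path_edges \<subseteq> carrier C_grp" using path_edges_range uC_closed by blast
  have pot: "\<forall>j\<in>set path_edges. hm j = gpa (eA j) - gpa (eB j) \<and> hn j = gpb (eA j) - gpb (eB j)"
    by (simp add: path_edges_def hm_def hn_def gpa_def gpb_def eA_def eB_def edge_list_def)
  have step: "?R (uC j \<otimes>\<^bsub>C_grp\<^esub> g)" if j: "j \<in> set path_edges" and g: "g \<in> carrier C_grp" "?R g" for j g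
  proof -
    have j': "j \<in> {1..27}" using j path_edges_range by blast
    have A: "coA (uC j) i = gpa i - gpa (transpose (eA j) (eB j) i)"
      "coB (uC j) i = gpb i - gpb (transpose (eA j) (eB j) i)" for i
      using pot j by (auto simp: coA_def coB_def F_u[OF j'] uval_def lift_transp_def transpose_def)
    have "bij (psi g)" using psi_permutes[OF g(1)] by (rule permutes_bij)
    then have "inv_into UNIV (transpose (eA j) (eB j) \<circ> psi g) i = inv_into UNIV (psi g) (transpose (eA j) (eB j) i)" for i
      by (simp add: o_inv_distrib)
    then show ?thesis
      using g j' by (simp add: co_mult psi_mult psi_u A)
  qed
  have "?R c"
  proof (rule C.generate_closed_under_mult[of c "uC ` set path_edges"])
    show "c \<in> generate C_grp (uC ` set path_edges)" using assms by (simp add: QP_def)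
    show "?R \<one>\<^bsub>C_grp\<^esub>" by (simp add: co_one psi_one)
    fix u g assume u: "u \<in> uC ` set path_edges" "g \<in> carrier C_grp" "?R g"
    then obtain j where j: "j \<in> set path_edges" "u = uC j" by blast
    show "?R (u \<otimes>\<^bsub>C_grp\<^esub> g)" using step u j by blast
    have "j \<in> {1..27}" using j path_edges_range by blast
    then have "inv\<^bsub>C_grp\<^esub> u = u" using j by (simp add: C.inv_equality)
    then show "?R (inv\<^bsub>C_grp\<^esub> u \<otimes>\<^bsub>C_grp\<^esub> g)" using step u j by metis
  qed (rule sub)
  then show "coA c i = gpa i - gpa (inv_into UNIV (psi c) i)" "coB c i = gpb i - gpb (inv_into UNIV (psi c) i)"
    by blast+
qed

lemma snd_F_mult:
  assumes "c \<in> carrier C_grp" "d \<in> carrier C_grp" "psi c = id"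
  shows "snd (F (c \<otimes>\<^bsub>C_grp\<^esub> d)) = snd (F c) \<otimes>\<^bsub>heis\<^esub> snd (F d)"
  using assms by (cases "F c", cases "F d") (simp add: psi_def MM_simps)

text \<open>An edge contributes a value at one end and its negative at the other, and permuting the
  entries preserves sums. This is the counterpart in the model of lying in the kernel of
  \<open>ab\<close>.\<close>

lemma F_sum_zero:
  assumes "c \<in> carrier C_grp"
  shows "(\<Sum>i\<in>{1..18}. coA c i) = 0" "(\<Sum>i\<in>{1..18}. coB c i) = 0"
proof -
  let ?R = "\<lambda>c. (\<Sum>i\<in>{1..18}. coA c i) = 0 \<and> (\<Sum>i\<in>{1..18}. coB c i) = 0"
  have u: "?R (uC j)" if "j \<in> {1..27}" for j
  proof -
    have d: "(\<Sum>i\<in>{1..18}. if i = eA j then x else if i = eB j then - x else (0::int)) = 0" for x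
    proof -
      have "(\<Sum>i\<in>{1..18}. if i = eA j then x else if i = eB j then - x else 0) =
          (\<Sum>i\<in>{1..18}. (if i = eA j then x else 0) - (if i = eB j then x else 0))"
        using edge_bounds[OF that] by (intro sum.cong) auto
      then show ?thesis using edge_bounds[OF that] by (simp add: sum_subtractf)
    qed
    show ?thesis using d by (simp add: coA_def coB_def F_u[OF that] uval_def lift_transp_def)
  qed
  have mult: "?R (c \<otimes>\<^bsub>C_grp\<^esub> d)" if "c \<in> carrier C_grp" "d \<in> carrier C_grp" "?R c" "?R d" for c d
  proof -
    have i: "inv_into UNIV (psi c) permutes {1..18}" using psi_permutes[OF that(1)] by (rule permutes_inv)
    show ?thesis
      using that sum.permute[OF i, of "coA d"] sum.permute[OF i, of "coB d"]
      by (simp add: co_mult sum.distrib comp_def)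
  qed
  have "?R c"
  proof (rule C.generate_closed_under_mult[of c "uC ` {1..27}"])
    show "c \<in> generate C_grp (uC ` {1..27})" using assms C_generate by blast
    show "?R \<one>\<^bsub>C_grp\<^esub>" by (simp add: co_one)
    fix u' g assume u': "u' \<in> uC ` {1..27}" "g \<in> carrier C_grp" "?R g"
    then obtain j where j: "j \<in> {1..27}" "u' = uC j" by blast
    then show "?R (u' \<otimes>\<^bsub>C_grp\<^esub> g)" using mult u u' by (metis uC_closed)
    moreover have "inv\<^bsub>C_grp\<^esub> u' = u'" using j by (simp add: C.inv_equality)
    ultimately show "?R (inv\<^bsub>C_grp\<^esub> u' \<otimes>\<^bsub>C_grp\<^esub> g)" by simp
  qed (use uC_closed in blast)
  then show "(\<Sum>i\<in>{1..18}. coA c i) = 0" "(\<Sum>i\<in>{1..18}. coB c i) = 0" by blast+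
qed

end

context C_families
begin

text \<open>Relative to the potential along the path, the loop closed by edge 12 has period
  \<open>(1, 0)\<close> and the loop closed by edge 2 has period \<open>(0, 1)\<close>. The two
  families are thus the translations in the two basis directions.\<close>

lemma base_coords:
  "psi (P.Tr 6 14) = id" "psi (Q.Tr 1 13) = id"
  "coA (P.Tr 6 14) i = (if i = 6 then 1 else if i = 14 then - 1 else 0)" "coB (P.Tr 6 14) i = 0"
  "coA (Q.Tr 1 13) i = 0" "coB (Q.Tr 1 13) i = (if i = 1 then 1 else if i = 13 then - 1 else 0)"
proof -
  have t: "t a b \<in> carrier C_grp" "psi (t a b) = transpose a b"
    "coA (t a b) i = gpa i - gpa (transpose a b i)" "coB (t a b) i = gpb i - gpb (transpose a b i)"
    if "a \<in> {1..18}" "b \<in> {1..18}" for a b i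
  proof -
    have p: "transpose a b permutes {1..18}" using that by (simp add: permutes_swap_id)
    show "t a b \<in> carrier C_grp" using that by simp
    show "psi (t a b) = transpose a b" unfolding t_def by (rule psi_s[OF p])
    then show "coA (t a b) i = gpa i - gpa (transpose a b i)" "coB (t a b) i = gpb i - gpb (transpose a b i)"
      using co_QP[OF s_QP[OF p]] by (simp_all add: t_def)
  qed
  have e: "eA 12 = 6" "eB 12 = 14" "eA 2 = 1" "eB 2 = 13" by (simp_all add: eA_def eB_def edge_list_def)
  have u: "psi (uC 12) = transpose 6 14" "psi (uC 2) = transpose 1 13" "uC 12 \<in> carrier C_grp" "uC 2 \<in> carrier C_grp"
    using psi_u[of 12] psi_u[of 2] by (simp_all add: e)
  have c: "coA (uC 12) i = 0" "coB (uC 12) i = 0" "coA (uC 2) i = (if i = 1 then - 1 else if i = 13 then 1 else 0)"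
    "coB (uC 2) i = (if i = 1 then 2 else if i = 13 then - 2 else 0)" for i
    using F_u[of 12] F_u[of 2] by (simp_all add: coA_def coB_def uval_def lift_transp_def hm_def hn_def e)
  have T: "P.Tr 6 14 = uC 12 \<otimes>\<^bsub>C_grp\<^esub> t 6 14" "Q.Tr 1 13 = uC 2 \<otimes>\<^bsub>C_grp\<^esub> t 1 13"
    by (simp_all only: P.Tr_def Q.Tr_def P_base Q_base)
  show "psi (P.Tr 6 14) = id" "psi (Q.Tr 1 13) = id"
    unfolding T using t[of 6 14] t[of 1 13] u by (simp_all add: psi_mult)
  show "coA (P.Tr 6 14) i = (if i = 6 then 1 else if i = 14 then - 1 else 0)" "coB (P.Tr 6 14) i = 0"
    unfolding T using t[of 6 14] u c by (auto simp: co_mult gpa_def gpb_def transpose_def)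
  show "coA (Q.Tr 1 13) i = 0" "coB (Q.Tr 1 13) i = (if i = 1 then 1 else if i = 13 then - 1 else 0)"
    unfolding T using t[of 1 13] u c by (auto simp: co_mult gpa_def gpb_def transpose_def)
qed

lemma Tr_coords:
  assumes "a \<in> {1..18}" "b \<in> {1..18}" "a \<noteq> b"
  shows "psi (P.Tr a b) = id" "psi (Q.Tr a b) = id"
    "coA (P.Tr a b) i = (if i = a then 1 else if i = b then - 1 else 0)" "coB (P.Tr a b) i = 0"
    "coA (Q.Tr a b) i = 0" "coB (Q.Tr a b) i = (if i = a then 1 else if i = b then - 1 else 0)"
proof -
  obtain \<sigma> where \<sigma>: "\<sigma> permutes {1..18}" "\<sigma> 6 = a" "\<sigma> 14 = b"
    using permutation_extending_lists[of "[6, 14]" "[a, b]" "{1..18}"] assms by auto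
  have P: "P.Tr a b = s \<sigma> \<otimes>\<^bsub>C_grp\<^esub> (P.Tr 6 14 \<otimes>\<^bsub>C_grp\<^esub> inv\<^bsub>C_grp\<^esub> s \<sigma>)"
    using P.ac_Tr[OF \<sigma>(1), of 6 14] \<sigma> by (simp add: ac_def)
  obtain \<tau> where \<tau>: "\<tau> permutes {1..18}" "\<tau> 1 = a" "\<tau> 13 = b"
    using permutation_extending_lists[of "[1, 13]" "[a, b]" "{1..18}"] assms by auto
  have Q: "Q.Tr a b = s \<tau> \<otimes>\<^bsub>C_grp\<^esub> (Q.Tr 1 13 \<otimes>\<^bsub>C_grp\<^esub> inv\<^bsub>C_grp\<^esub> s \<tau>)"
    using Q.ac_Tr[OF \<tau>(1), of 1 13] \<tau> by (simp add: ac_def)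
  have C: "s \<sigma> \<in> carrier C_grp" "s \<tau> \<in> carrier C_grp" "P.Tr 6 14 \<in> carrier C_grp" "Q.Tr 1 13 \<in> carrier C_grp"
    using \<sigma>(1) \<tau>(1) P.Tr_closed[of 6 14] Q.Tr_closed[of 1 13] s_closed by auto
  have iv: "inv_into UNIV \<sigma> i = j \<longleftrightarrow> i = \<sigma> j" "inv_into UNIV \<tau> i = j \<longleftrightarrow> i = \<tau> j" for i j
    using permutes_inv_eq[OF \<sigma>(1)] permutes_inv_eq[OF \<tau>(1)] by auto
  note cP = co_conj[OF C(1,3) base_coords(1)] and cQ = co_conj[OF C(2,4) base_coords(2)]
  show "psi (P.Tr a b) = id" "psi (Q.Tr a b) = id" unfolding P Q by (rule cP cQ)+
  show "coA (P.Tr a b) i = (if i = a then 1 else if i = b then - 1 else 0)" "coB (P.Tr a b) i = 0"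
    unfolding P cP psi_s[OF \<sigma>(1)] base_coords iv \<sigma>(2,3) by simp_all
  show "coA (Q.Tr a b) i = 0" "coB (Q.Tr a b) i = (if i = a then 1 else if i = b then - 1 else 0)"
    unfolding Q cQ psi_s[OF \<tau>(1)] base_coords iv \<tau>(2,3) by simp_all
qed

definition zC :: "nat word set" where
  "zC = (SOME z. z \<in> carrier C_grp \<and>
    (\<forall>a\<in>{1..18}. \<forall>b\<in>{1..18}. a \<noteq> b \<longrightarrow> C.commutes z (P.Tr a b) \<and> C.commutes z (Q.Tr a b)) \<and>
    (\<forall>a\<in>{1..18}. \<forall>b\<in>{1..18}. \<forall>c\<in>{1..18}. distinct [a, b, c] \<longrightarrow>
       P.Tr a c \<otimes>\<^bsub>C_grp\<^esub> Q.Tr b a = Q.Tr b a \<otimes>\<^bsub>C_grp\<^esub> P.Tr a c \<otimes>\<^bsub>C_grp\<^esub> z))"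

lemma zC:
  shows zC_closed: "zC \<in> carrier C_grp"
    and zC_commutes: "\<And>a b. \<lbrakk>a \<in> {1..18}; b \<in> {1..18}; a \<noteq> b\<rbrakk> \<Longrightarrow> C.commutes zC (P.Tr a b) \<and> C.commutes zC (Q.Tr a b)"
    and zC_rel: "\<And>a b c. \<lbrakk>a \<in> {1..18}; b \<in> {1..18}; c \<in> {1..18}; distinct [a, b, c]\<rbrakk> \<Longrightarrow>
       P.Tr a c \<otimes>\<^bsub>C_grp\<^esub> Q.Tr b a = Q.Tr b a \<otimes>\<^bsub>C_grp\<^esub> P.Tr a c \<otimes>\<^bsub>C_grp\<^esub> zC"
proof -
  let ?R = "\<lambda>z. z \<in> carrier C_grp \<and>
    (\<forall>a\<in>{1..18}. \<forall>b\<in>{1..18}. a \<noteq> b \<longrightarrow> C.commutes z (P.Tr a b) \<and> C.commutes z (Q.Tr a b)) \<and>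
    (\<forall>a\<in>{1..18}. \<forall>b\<in>{1..18}. \<forall>c\<in>{1..18}. distinct [a, b, c] \<longrightarrow>
       P.Tr a c \<otimes>\<^bsub>C_grp\<^esub> Q.Tr b a = Q.Tr b a \<otimes>\<^bsub>C_grp\<^esub> P.Tr a c \<otimes>\<^bsub>C_grp\<^esub> z)"
  have "\<exists>z. ?R z"
  proof (rule C_central_element)
    fix z assume "z \<in> carrier C_grp"
      "\<And>a b. \<lbrakk>a \<in> {1..18}; b \<in> {1..18}; a \<noteq> b\<rbrakk> \<Longrightarrow> C.commutes z (P.Tr a b) \<and> C.commutes z (Q.Tr a b)"
      "\<And>a b c. \<lbrakk>a \<in> {1..18}; b \<in> {1..18}; c \<in> {1..18}; distinct [a, b, c]\<rbrakk> \<Longrightarrow>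
         P.Tr a c \<otimes>\<^bsub>C_grp\<^esub> Q.Tr b a = Q.Tr b a \<otimes>\<^bsub>C_grp\<^esub> P.Tr a c \<otimes>\<^bsub>C_grp\<^esub> z"
    then show "\<exists>z. ?R z" by blast
  qed
  then have R: "?R zC" unfolding zC_def by (rule someI_ex[of ?R])
  then show "zC \<in> carrier C_grp" by blast
  show "\<And>a b. \<lbrakk>a \<in> {1..18}; b \<in> {1..18}; a \<noteq> b\<rbrakk> \<Longrightarrow> C.commutes zC (P.Tr a b) \<and> C.commutes zC (Q.Tr a b)"
    "\<And>a b c. \<lbrakk>a \<in> {1..18}; b \<in> {1..18}; c \<in> {1..18}; distinct [a, b, c]\<rbrakk> \<Longrightarrow>
       P.Tr a c \<otimes>\<^bsub>C_grp\<^esub> Q.Tr b a = Q.Tr b a \<otimes>\<^bsub>C_grp\<^esub> P.Tr a c \<otimes>\<^bsub>C_grp\<^esub> zC"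
    using R by blast+
qed

text \<open>The translations overlap only at vertex 1, where the x-entry is 1 and the y-entry is -1.
  Their commutator therefore has central coordinate -1, so \<open>zC\<close> has infinite order and
  is the inverse of the generator chosen in the Heisenberg group.\<close>

lemma F_zC: "F zC = (id, \<lambda>_. 0, \<lambda>_. 0, - 1)"
proof -
  let ?X = "P.Tr 1 3" and ?Y = "Q.Tr 2 1"
  have C: "?X \<in> carrier C_grp" "?Y \<in> carrier C_grp" by simp_all
  have rel: "?X \<otimes>\<^bsub>C_grp\<^esub> ?Y = (?Y \<otimes>\<^bsub>C_grp\<^esub> ?X) \<otimes>\<^bsub>C_grp\<^esub> zC" using zC_rel[of 1 2 3] by simp
  have id: "psi ?X = id" "psi ?Y = id" using Tr_coords(1)[of 1 3] Tr_coords(2)[of 2 1] by simp_all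
  have YX: "psi (?Y \<otimes>\<^bsub>C_grp\<^esub> ?X) = id" using C id by (simp add: psi_mult)
  have "psi (?X \<otimes>\<^bsub>C_grp\<^esub> ?Y) = psi zC"
    unfolding rel using C zC_closed id by (simp add: psi_mult)
  then have "psi zC = id" using C id by (simp add: psi_mult)
  moreover obtain r where X: "snd (F ?X) = (\<lambda>i. if i = 1 then 1 else if i = 3 then - 1 else 0, \<lambda>_. 0, r)"
    using Tr_coords(3,4)[of 1 3] by (cases "snd (F ?X)") (auto simp: coA_def coB_def fun_eq_iff)
  moreover obtain r' where Y: "snd (F ?Y) = (\<lambda>_. 0, \<lambda>i. if i = 2 then 1 else if i = 1 then - 1 else 0, r')"
    using Tr_coords(5,6)[of 2 1] by (cases "snd (F ?Y)") (auto simp: coA_def coB_def fun_eq_iff)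
  obtain a b c where z: "snd (F zC) = (a, b, c)" by (metis prod.exhaust)
  have "snd (F ?X) \<otimes>\<^bsub>heis\<^esub> snd (F ?Y) = (snd (F ?Y) \<otimes>\<^bsub>heis\<^esub> snd (F ?X)) \<otimes>\<^bsub>heis\<^esub> snd (F zC)"
    using arg_cong[OF rel, of "\<lambda>c. snd (F c)"]
    by (simp only: snd_F_mult[OF C id(1)] snd_F_mult[OF C(2,1) id(2)]
        snd_F_mult[OF C.m_closed[OF C(2,1)] zC_closed YX])
  moreover have sum: "(\<Sum>i\<in>{1..18::nat}. (if i = 1 then 1 else if i = 3 then - 1 else 0) * (if i = 2 then 1 else if i = 1 then - 1 else 0))
      = (- 1 :: int)"
  proof -
    have "(\<Sum>i\<in>{1..18::nat}. (if i = 1 then 1 else if i = 3 then - 1 else 0) * (if i = 2 then 1 else if i = 1 then - 1 else 0))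
      = (\<Sum>i\<in>{1..18::nat}. if i = 1 then - 1 else (0::int))" by (intro sum.cong) auto
    then show ?thesis by simp
  qed
  ultimately have eq: "(\<lambda>i. if i = 1 then 1 else if i = 3 then - 1 else 0, \<lambda>_. 0, r) \<otimes>\<^bsub>heis\<^esub>
     (\<lambda>_. 0, \<lambda>i. if i = 2 then 1 else if i = 1 then - 1 else 0, r') =
     ((\<lambda>_. 0, \<lambda>i. if i = 2 then 1 else if i = 1 then - 1 else 0, r') \<otimes>\<^bsub>heis\<^esub>
      (\<lambda>i. if i = 1 then 1 else if i = 3 then - 1 else 0, \<lambda>_. 0, r)) \<otimes>\<^bsub>heis\<^esub> (a, b, c)"
    by (simp only: X Y z)
  then have "a = (\<lambda>_. 0)" "b = (\<lambda>_. 0)"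
    by (auto simp: heis_simps fun_eq_iff)
  with eq have "c = - 1" using sum by (simp add: heis_simps)
  with \<open>a = _\<close> \<open>b = _\<close> z \<open>psi zC = id\<close> show ?thesis by (cases "F zC") (simp add: psi_def)
qed

text \<open>Translations out of the base vertex 1 suffice, since every other one is a difference of
  two of them. They turn out to generate the kernel of \<open>psi\<close> together with
  \<open>zC\<close>.\<close>

definition NC :: "nat word set set" where
  "NC = generate C_grp ((\<lambda>i. P.Tr 1 i) ` {2..18} \<union> (\<lambda>i. Q.Tr 1 i) ` {2..18} \<union> {zC})"

lemma NC_gens: "(\<lambda>i. P.Tr 1 i) ` {2..18} \<union> (\<lambda>i. Q.Tr 1 i) ` {2..18} \<union> {zC} \<subseteq> carrier C_grp"
  using zC_closed by auto

lemma NC_subgroup: "subgroup NC C_grp"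
  unfolding NC_def by (rule C.generate_is_subgroup[OF NC_gens])

lemma Tr_in_NC:
  assumes "a \<in> {1..18}" "b \<in> {1..18}" "a \<noteq> b"
  shows "P.Tr a b \<in> NC" "Q.Tr a b \<in> NC"
proof -
  interpret NC: subgroup NC C_grp by (rule NC_subgroup)
  have 1: "P.Tr 1 i \<in> NC" "Q.Tr 1 i \<in> NC" if "i \<in> {1..18}" "i \<noteq> 1" for i
    using that unfolding NC_def by (auto intro!: generate.incl)
  have 2: "P.Tr i 1 \<in> NC" "Q.Tr i 1 \<in> NC" if "i \<in> {1..18}" "i \<noteq> 1" for i
    using 1[OF that] P.Tr_swap[of 1 i] Q.Tr_swap[of 1 i] that by auto
  have "P.Tr a b \<in> NC \<and> Q.Tr a b \<in> NC"
  proof (cases "a = 1 \<or> b = 1")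
    case True
    then show ?thesis using 1 2 assms by auto
  next
    case False
    then have "P.Tr a b = P.Tr a 1 \<otimes>\<^bsub>C_grp\<^esub> P.Tr 1 b" "Q.Tr a b = Q.Tr a 1 \<otimes>\<^bsub>C_grp\<^esub> Q.Tr 1 b"
      using P.Tr_cocycle(1)[of a 1 b] Q.Tr_cocycle(1)[of a 1 b] assms by auto
    then show ?thesis using 1 2 assms False by auto
  qed
  then show "P.Tr a b \<in> NC" "Q.Tr a b \<in> NC" by auto
qed

text \<open>Permuting the vertices in the relation that defines \<open>zC\<close> gives the same
  relation at other vertices, and that relation determines the central factor by
  cancellation.\<close>

lemma ac_zC:
  assumes "\<sigma> permutes {1..18}" shows "ac \<sigma> zC = zC"
proof -
  have im: "\<sigma> i \<in> {1..18}" if "i \<in> {1..18}" for i using permutes_in_image[OF assms] that by blast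
  have ne: "\<sigma> i \<noteq> \<sigma> j" if "i \<noteq> j" for i j using permutes_inj[OF assms] that by (auto dest: injD)
  have V: "1 \<in> {1..18::nat}" "2 \<in> {1..18::nat}" "3 \<in> {1..18::nat}" by auto
  let ?X = "P.Tr (\<sigma> 1) (\<sigma> 3)" and ?Y = "Q.Tr (\<sigma> 2) (\<sigma> 1)"
  have C: "?X \<in> carrier C_grp" "?Y \<in> carrier C_grp" "ac \<sigma> zC \<in> carrier C_grp"
    using P.Tr_closed[OF im im ne] Q.Tr_closed[OF im im ne] V ac_closed[OF assms zC_closed] by simp_all
  have "ac \<sigma> (P.Tr 1 3 \<otimes>\<^bsub>C_grp\<^esub> Q.Tr 2 1) = ac \<sigma> (Q.Tr 2 1 \<otimes>\<^bsub>C_grp\<^esub> P.Tr 1 3 \<otimes>\<^bsub>C_grp\<^esub> zC)"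
    using zC_rel[of 1 2 3] by simp
  then have "?X \<otimes>\<^bsub>C_grp\<^esub> ?Y = ?Y \<otimes>\<^bsub>C_grp\<^esub> ?X \<otimes>\<^bsub>C_grp\<^esub> ac \<sigma> zC"
    using V by (simp add: ac_mult[OF assms] zC_closed P.ac_Tr[OF assms] Q.ac_Tr[OF assms] del: One_nat_def atLeastAtMost_iff)
  moreover have "?X \<otimes>\<^bsub>C_grp\<^esub> ?Y = ?Y \<otimes>\<^bsub>C_grp\<^esub> ?X \<otimes>\<^bsub>C_grp\<^esub> zC"
    using zC_rel[OF im im im, of 1 2 3] ne V by simp
  ultimately have "?Y \<otimes>\<^bsub>C_grp\<^esub> ?X \<otimes>\<^bsub>C_grp\<^esub> ac \<sigma> zC = ?Y \<otimes>\<^bsub>C_grp\<^esub> ?X \<otimes>\<^bsub>C_grp\<^esub> zC" by simp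
  then show ?thesis using C zC_closed by (meson C.l_cancel C.m_closed)
qed

lemma ac_NC:
  assumes "\<sigma> permutes {1..18}" "n \<in> NC" shows "ac \<sigma> n \<in> NC"
proof -
  interpret NC: subgroup NC C_grp by (rule NC_subgroup)
  have gen: "ac \<sigma> u \<in> NC" if "u \<in> (\<lambda>i. P.Tr 1 i) ` {2..18} \<union> (\<lambda>i. Q.Tr 1 i) ` {2..18} \<union> {zC}" for u
  proof -
    have "ac \<sigma> (P.Tr 1 i) \<in> NC \<and> ac \<sigma> (Q.Tr 1 i) \<in> NC" if "i \<in> {2..18}" for i
    proof -
      have i: "i \<in> {1..18}" "1 \<in> {1..18::nat}" "1 \<noteq> i" using that by auto
      then have "\<sigma> 1 \<in> {1..18}" "\<sigma> i \<in> {1..18}" "\<sigma> 1 \<noteq> \<sigma> i"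
        using permutes_in_image[OF assms(1)] permutes_inj[OF assms(1)] by (auto dest: injD simp del: atLeastAtMost_iff)
      then show ?thesis using Tr_in_NC P.ac_Tr[OF assms(1) i(2,1,3)] Q.ac_Tr[OF assms(1) i(2,1,3)] by simp
    qed
    moreover have "ac \<sigma> zC \<in> NC" unfolding ac_zC[OF assms(1)] NC_def by (rule generate.incl) simp
    ultimately show ?thesis using that by blast
  qed
  have "ac \<sigma> n \<in> NC \<and> n \<in> carrier C_grp" using assms(2) unfolding NC_def
  proof (induction rule: generate.induct)
    case one
    then show ?case using ac_one[OF assms(1)] generate.one[of C_grp] by simp
  next
    case (incl h) then show ?case using gen NC_gens unfolding NC_def by blast
  next
    case (inv h)
    then have "h \<in> carrier C_grp" "ac \<sigma> h \<in> NC" using gen NC_gens by blast+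
    then show ?case using ac_inv[OF assms(1)] NC.m_inv_closed unfolding NC_def by auto
  next
    case (eng h1 h2)
    then show ?case using ac_mult[OF assms(1)] by (auto intro: generate.eng)
  qed
  then show ?thesis by blast
qed

text \<open>Products of a lifted permutation and an element of \<open>NC\<close> are closed under
  multiplication because conjugation by permutations preserves \<open>NC\<close>; it remains to find
  all 27 generators among them.\<close>

lemma C_decompose:
  assumes "c \<in> carrier C_grp"
  obtains \<sigma> n where "\<sigma> permutes {1..18}" "n \<in> NC" "c = s \<sigma> \<otimes>\<^bsub>C_grp\<^esub> n"
proof -
  interpret NC: subgroup NC C_grp by (rule NC_subgroup)
  define D where "D = {s \<sigma> \<otimes>\<^bsub>C_grp\<^esub> n | \<sigma> n. \<sigma> permutes {1..18} \<and> n \<in> NC}"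
  have D_s: "s \<sigma> \<in> D" if "\<sigma> permutes {1..18}" for \<sigma>
  proof -
    have "s \<sigma> = s \<sigma> \<otimes>\<^bsub>C_grp\<^esub> \<one>\<^bsub>C_grp\<^esub>" using s_closed[OF that] by simp
    then show ?thesis unfolding D_def using that NC.one_closed by blast
  qed
  have D_N: "n \<in> D" if "n \<in> NC" for n
  proof -
    have "n = s id \<otimes>\<^bsub>C_grp\<^esub> n" using that NC.subset by auto
    then show ?thesis unfolding D_def using that permutes_id by blast
  qed
  have D_mult: "c \<otimes>\<^bsub>C_grp\<^esub> d \<in> D" if "c \<in> D" "d \<in> D" for c d
  proof -
    obtain \<sigma> n \<tau> m where *: "\<sigma> permutes {1..18}" "n \<in> NC" "c = s \<sigma> \<otimes>\<^bsub>C_grp\<^esub> n"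
      "\<tau> permutes {1..18}" "m \<in> NC" "d = s \<tau> \<otimes>\<^bsub>C_grp\<^esub> m"
      using \<open>c \<in> D\<close> \<open>d \<in> D\<close> unfolding D_def by blast
    let ?n = "ac (inv_into UNIV \<tau>) n"
    have n: "?n \<in> NC" using * by (intro ac_NC permutes_inv)
    have cl: "s \<sigma> \<in> carrier C_grp" "s \<tau> \<in> carrier C_grp" "n \<in> carrier C_grp" "m \<in> carrier C_grp" "?n \<in> carrier C_grp"
      using * n NC.subset s_closed by auto
    have "ac \<tau> ?n \<otimes>\<^bsub>C_grp\<^esub> s \<tau> = s \<tau> \<otimes>\<^bsub>C_grp\<^esub> ?n"
      unfolding ac_def[of \<tau>] using cl by (simp add: C.m_assoc)
    then have "s \<tau> \<otimes>\<^bsub>C_grp\<^esub> ?n = n \<otimes>\<^bsub>C_grp\<^esub> s \<tau>"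
      by (simp only: ac_inv_cancel(1)[OF *(4) cl(3)])
    then have "c \<otimes>\<^bsub>C_grp\<^esub> d = (s \<sigma> \<otimes>\<^bsub>C_grp\<^esub> s \<tau>) \<otimes>\<^bsub>C_grp\<^esub> (?n \<otimes>\<^bsub>C_grp\<^esub> m)"
      unfolding *(3,6) using cl by (metis C.m_assoc C.m_closed)
    also have "s \<sigma> \<otimes>\<^bsub>C_grp\<^esub> s \<tau> = s (\<sigma> \<circ> \<tau>)" using * by (simp only: s_comp)
    finally show ?thesis unfolding D_def using * n permutes_compose[OF *(4,1)] by blast
  qed
  have t: "t a b \<in> D" if "a \<in> {1..18}" "b \<in> {1..18}" for a b
    unfolding t_def using that by (intro D_s permutes_swap_id)
  have PQ: "P a b \<in> D" "Q a b \<in> D" if "a \<in> {1..18}" "b \<in> {1..18}" "a \<noteq> b" for a b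
    unfolding P.P_eq[OF that] Q.P_eq[OF that]
    by (rule D_mult[OF D_N[OF Tr_in_NC(1)[OF that]] t[OF that(1,2)]],
        rule D_mult[OF D_N[OF Tr_in_NC(2)[OF that]] t[OF that(1,2)]])
  have cj: "C.cj x y \<in> D" if "x \<in> D" "y \<in> D" for x y unfolding C.cj_def using that by (intro D_mult)
  have all: "uC j \<in> D" if "j \<in> {1..27}" for j
  proof -
    have path: "uC j \<in> D" if "j \<in> set path_edges" for j
    proof -
      have j: "j \<in> {1..27}" using that path_edges_range by blast
      show ?thesis unfolding uC_path[OF that edgeT_eq] using edge_bounds[OF j] by (intro t)
    qed
    \<comment> \<open>The ten edges off the path: the two base edges, six members of the second
      family and the two mixed edges.\<close>
    have "\<forall>j\<in>set [12, 2, 13, 21, 27, 25, 3, 7, 8, 11]. uC j \<in> D"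
      by (simp add: P_base[symmetric] Q_base[symmetric] chord_13 chord_21 chord_27 chord_25 chord_3 chord_7
          chord_8 chord_11 PQ cj)
    moreover have "{1..27} \<subseteq> set path_edges \<union> set [12, 2, 13, 21, 27, 25, 3, 7, 8, 11]"
      by (rule subsetI) (simp add: path_edges_def, presburger)
    ultimately show ?thesis using path that by blast
  qed
  have "c \<in> D"
  proof (rule C.generate_closed_under_mult[of c "uC ` {1..27}"])
    show "c \<in> generate C_grp (uC ` {1..27})" using assms C_generate by blast
    show "\<one>\<^bsub>C_grp\<^esub> \<in> D" by (rule D_N) simp
    fix u' g assume u': "u' \<in> uC ` {1..27}" "g \<in> carrier C_grp" "g \<in> D"
    then obtain j where j: "j \<in> {1..27}" "u' = uC j" by blast
    then show "u' \<otimes>\<^bsub>C_grp\<^esub> g \<in> D" using D_mult all u' by blast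
    moreover have "inv\<^bsub>C_grp\<^esub> u' = u'" using j by (simp add: C.inv_equality)
    ultimately show "inv\<^bsub>C_grp\<^esub> u' \<otimes>\<^bsub>C_grp\<^esub> g \<in> D" by simp
  qed (use uC_closed in blast)
  then show thesis using that unfolding D_def by blast
qed

definition vlist2 :: "nat list" where "vlist2 = [2..<19]"

lemma set_vlist2: "set vlist2 = {2..18}" and distinct_vlist2: "distinct vlist2"
  unfolding vlist2_def set_upt by (auto intro: distinct_upt)

text \<open>For distinct \<open>i\<close> and \<open>j\<close> the translations share only the base
  vertex and the commutator is given by \<open>zC_rel\<close>. For \<open>i = j\<close> they share
  both ends, which that relation does not cover.\<close>

lemma Q_P_commutator:
  assumes "i \<in> {2..18}" "j \<in> {2..18}"
  shows "\<exists>k::int. Q.Tr 1 j \<otimes>\<^bsub>C_grp\<^esub> P.Tr 1 i = P.Tr 1 i \<otimes>\<^bsub>C_grp\<^esub> (Q.Tr 1 j \<otimes>\<^bsub>C_grp\<^esub> zC [^]\<^bsub>C_grp\<^esub> k)"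
proof -
  let ?y = "Q.Tr 1 j"
  let ?H = "{g \<in> carrier C_grp. C.commutes zC g \<and> (\<exists>k::int. ?y \<otimes>\<^bsub>C_grp\<^esub> g = g \<otimes>\<^bsub>C_grp\<^esub> (?y \<otimes>\<^bsub>C_grp\<^esub> zC [^]\<^bsub>C_grp\<^esub> k))}"
  have V: "i \<in> {1..18}" "j \<in> {1..18}" "1 \<in> {1..18::nat}" "i \<noteq> 1" "j \<noteq> 1" using assms by auto
  have y: "?y \<in> carrier C_grp" using Q.Tr_closed[of 1 j] V by simp
  have sub: "subgroup ?H C_grp"
    by (rule C.commutator_power_subgroup[OF y zC_closed]) (use zC_commutes[of 1 j] V in auto)
  have 1: "P.Tr 1 m \<in> ?H" if m: "m \<in> {1..18}" "m \<noteq> 1" "m \<noteq> j" for m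
  proof -
    let ?x = "P.Tr 1 m"
    have x: "?x \<in> carrier C_grp" using P.Tr_closed[of 1 m] V m by simp
    have zx: "zC \<otimes>\<^bsub>C_grp\<^esub> ?y = ?y \<otimes>\<^bsub>C_grp\<^esub> zC"
      using zC_commutes[of 1 j] V by (auto simp: C.commutes_def)
    have "?x \<otimes>\<^bsub>C_grp\<^esub> inv\<^bsub>C_grp\<^esub> ?y = inv\<^bsub>C_grp\<^esub> ?y \<otimes>\<^bsub>C_grp\<^esub> (?x \<otimes>\<^bsub>C_grp\<^esub> zC)"
      using zC_rel[of 1 j m] Q.Tr_swap[of 1 j] V m x y zC_closed by (auto simp: C.m_assoc)
    then have "?y \<otimes>\<^bsub>C_grp\<^esub> (?x \<otimes>\<^bsub>C_grp\<^esub> inv\<^bsub>C_grp\<^esub> ?y) \<otimes>\<^bsub>C_grp\<^esub> ?y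
        = ?y \<otimes>\<^bsub>C_grp\<^esub> (inv\<^bsub>C_grp\<^esub> ?y \<otimes>\<^bsub>C_grp\<^esub> (?x \<otimes>\<^bsub>C_grp\<^esub> zC)) \<otimes>\<^bsub>C_grp\<^esub> ?y" by simp
    then have "?y \<otimes>\<^bsub>C_grp\<^esub> ?x = ?x \<otimes>\<^bsub>C_grp\<^esub> (zC \<otimes>\<^bsub>C_grp\<^esub> ?y)"
      using x y zC_closed by (simp add: C.m_assoc C.inv_mult_cancel)
    then have "?y \<otimes>\<^bsub>C_grp\<^esub> ?x = ?x \<otimes>\<^bsub>C_grp\<^esub> (?y \<otimes>\<^bsub>C_grp\<^esub> zC [^]\<^bsub>C_grp\<^esub> (1::int))"
      using zx zC_closed by (simp add: C.int_pow_1)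
    then show ?thesis using x zC_commutes[of 1 m] V m by blast
  qed
  have "P.Tr 1 i \<in> ?H"
  proof (cases "i = j")
    case False
    then show ?thesis using 1 V by blast
  next
    case True
    \<comment> \<open>A detour through \<open>m\<close> writes \<open>P.Tr 1 i\<close> as
      \<open>P.Tr 1 m\<close> times the inverse of \<open>P.Tr i m\<close>. Each factor shares just
      one vertex with \<open>Q.Tr 1 j\<close>, and the subgroup property combines the two
      exponents.\<close>
    obtain m where m: "m \<in> {1..18}" "m \<notin> set [1, i]"
      by (rule C.fresh_element[of "{1..18}" "[1, i]"]) auto
    let ?x = "P.Tr i m"
    have x: "?x \<in> carrier C_grp" using P.Tr_closed[of i m] V m by simp
    have "?x \<otimes>\<^bsub>C_grp\<^esub> ?y = ?y \<otimes>\<^bsub>C_grp\<^esub> (?x \<otimes>\<^bsub>C_grp\<^esub> zC)"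
      using zC_rel[of i 1 m] V m True x y zC_closed by (auto simp: C.m_assoc)
    then have "?y \<otimes>\<^bsub>C_grp\<^esub> ?x = ?x \<otimes>\<^bsub>C_grp\<^esub> (?y \<otimes>\<^bsub>C_grp\<^esub> inv\<^bsub>C_grp\<^esub> zC)"
      using x y zC_closed by (intro C.commutator_flip)
    then have "?y \<otimes>\<^bsub>C_grp\<^esub> ?x = ?x \<otimes>\<^bsub>C_grp\<^esub> (?y \<otimes>\<^bsub>C_grp\<^esub> zC [^]\<^bsub>C_grp\<^esub> (- 1::int))"
      using zC_closed by (simp add: C.int_pow_neg C.int_pow_1)
    moreover have "C.commutes zC ?x" using zC_commutes[of i m] V m by auto
    ultimately have "?x \<in> ?H" using x by blast
    then have inv: "inv\<^bsub>C_grp\<^esub> ?x \<in> ?H" by (rule subgroup.m_inv_closed[OF sub])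
    have "P.Tr 1 m \<in> ?H" using 1 m True by auto
    from subgroup.m_closed[OF sub this inv]
    have "P.Tr 1 m \<otimes>\<^bsub>C_grp\<^esub> P.Tr m i \<in> ?H" using P.Tr_swap[of i m] V m by simp
    moreover have "P.Tr 1 m \<otimes>\<^bsub>C_grp\<^esub> P.Tr m i = P.Tr 1 i"
      using P.Tr_cocycle(1)[of 1 m i] V m by auto
    ultimately show ?thesis by (simp only:)
  qed
  then show ?thesis by blast
qed

lemma NC_normal_form:
  assumes "n \<in> NC"
  obtains f g and k :: int where
    "n = C.pp (P.Tr 1) f vlist2 \<otimes>\<^bsub>C_grp\<^esub> (C.pp (Q.Tr 1) g vlist2 \<otimes>\<^bsub>C_grp\<^esub> zC [^]\<^bsub>C_grp\<^esub> k)"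
proof -
  have comm: "C.commutes (d 1 i) (d 1 j)" if "C.cocycle {1..18} d" "i \<in> {2..18}" "j \<in> {2..18}" for d and i j :: nat
  proof (cases "i = j")
    case True then show ?thesis by (simp add: C.commutes_refl)
  next
    case False
    obtain m where m: "m \<in> {1..18}" "m \<notin> set [1, i, j]"
      by (rule C.fresh_element[of "{1..18}" "[1, i, j]"]) auto
    show ?thesis
      by (rule C.cocycle_commutes(1)[OF that(1), of 1 i j m]) (use that False m in auto)
  qed
  have "\<exists>f g k. n = C.pp (P.Tr 1) f vlist2 \<otimes>\<^bsub>C_grp\<^esub> (C.pp (Q.Tr 1) g vlist2 \<otimes>\<^bsub>C_grp\<^esub> zC [^]\<^bsub>C_grp\<^esub> (k::int))"
  proof (rule C.heisenberg_normal_form)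
    show "n \<in> generate C_grp (P.Tr 1 ` set vlist2 \<union> Q.Tr 1 ` set vlist2 \<union> {zC})"
      using assms by (simp add: NC_def set_vlist2)
    show "P.Tr 1 \<in> set vlist2 \<rightarrow> carrier C_grp" "Q.Tr 1 \<in> set vlist2 \<rightarrow> carrier C_grp"
      by (auto simp: set_vlist2)
    show "\<exists>k::int. Q.Tr 1 j \<otimes>\<^bsub>C_grp\<^esub> P.Tr 1 i = P.Tr 1 i \<otimes>\<^bsub>C_grp\<^esub> (Q.Tr 1 j \<otimes>\<^bsub>C_grp\<^esub> zC [^]\<^bsub>C_grp\<^esub> k)"
      if "i \<in> set vlist2" "j \<in> set vlist2" for i j
      using Q_P_commutator that by (simp add: set_vlist2)
    show "C.commutes zC (P.Tr 1 i) \<and> C.commutes zC (Q.Tr 1 i)" if "i \<in> set vlist2" for i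
      using zC_commutes[of 1 i] that by (auto simp: set_vlist2)
    show "C.commutes (P.Tr 1 i) (P.Tr 1 j)" "C.commutes (Q.Tr 1 i) (Q.Tr 1 j)"
      if "i \<in> set vlist2" "j \<in> set vlist2" for i j
      using comm[OF P.cocycle_Tr] comm[OF Q.cocycle_Tr] that by (simp_all add: set_vlist2)
  qed (simp_all add: zC_closed distinct_vlist2)
  then show thesis using that by blast
qed

lemma co_additive:
  "C.additive_on {c \<in> carrier C_grp. psi c = id} (\<lambda>c. coA c j)"
  "C.additive_on {c \<in> carrier C_grp. psi c = id} (\<lambda>c. coB c j)"
  unfolding C.additive_on_def by (auto simp: co_mult)

lemma F_zC_pow: "F (zC [^]\<^bsub>C_grp\<^esub> (k::int)) = (id, \<lambda>_. 0, \<lambda>_. 0, - k)"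
  using F.hom_int_pow[OF zC_closed] F_zC by (simp add: MM_central_pow)

text \<open>The sign appears because \<open>Tr 1 j\<close> has entry -1 at \<open>j\<close>. Only
  the coordinates from 2 on are stated; the one at vertex 1 is forced by the vanishing of the
  sums.\<close>

lemma pp_coords:
  fixes f g :: "nat \<Rightarrow> int" and k :: int
  defines "n \<equiv> C.pp (P.Tr 1) f vlist2 \<otimes>\<^bsub>C_grp\<^esub> (C.pp (Q.Tr 1) g vlist2 \<otimes>\<^bsub>C_grp\<^esub> zC [^]\<^bsub>C_grp\<^esub> k)"
  shows "n \<in> carrier C_grp" "psi n = id"
    "j \<in> {2..18} \<Longrightarrow> coA n j = - f j" "j \<in> {2..18} \<Longrightarrow> coB n j = - g j"
proof -
  let ?H = "{c \<in> carrier C_grp. psi c = id}"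
  have V: "1 \<in> {1..18::nat}" "i \<in> {1..18}" "1 \<noteq> i" if "i \<in> set vlist2" for i
    using that by (auto simp: set_vlist2)
  have Tr: "P.Tr 1 i \<in> ?H" "Q.Tr 1 i \<in> ?H" if "i \<in> set vlist2" for i
    using Tr_coords(1,2)[OF V[OF that]] P.Tr_closed[OF V[OF that]] Q.Tr_closed[OF V[OF that]] by blast+
  have X: "C.pp (P.Tr 1) f vlist2 \<in> ?H"
    by (rule C.pp_in_subgroup[OF psi_kernel(1)]) (erule Tr(1))
  have Y: "C.pp (Q.Tr 1) g vlist2 \<in> ?H"
    by (rule C.pp_in_subgroup[OF psi_kernel(1)]) (erule Tr(2))
  have "psi (zC [^]\<^bsub>C_grp\<^esub> k) = id" unfolding psi_def F_zC_pow by simp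
  then have Z: "zC [^]\<^bsub>C_grp\<^esub> k \<in> ?H" using C.int_pow_closed[OF zC_closed] by blast
  have "n \<in> ?H" unfolding n_def using X Y Z by (intro subgroup.m_closed[OF psi_kernel(1)])
  then show "n \<in> carrier C_grp" "psi n = id" by auto
  assume j: "j \<in> {2..18}"
  \<comment> \<open>The constant zeros are written as conditionals to fit \<open>additive_pp\<close>
    with \<open>d = 0\<close>.\<close>
  have t: "coA (P.Tr 1 i) j = (if i = j then - 1 else 0)" "coB (P.Tr 1 i) j = (if i = j then 0 else 0)"
    "coA (Q.Tr 1 i) j = (if i = j then 0 else 0)" "coB (Q.Tr 1 i) j = (if i = j then - 1 else 0)"
    if "i \<in> set vlist2" for i
    unfolding Tr_coords(3-6)[OF V[OF that]] using j by auto
  have "coA (C.pp (P.Tr 1) f vlist2) j = (if j \<in> set vlist2 then f j * - 1 else 0)"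
    by (rule C.additive_pp[OF psi_kernel(1) co_additive(1)]) (erule Tr(1), erule t(1), rule distinct_vlist2)
  moreover have "coB (C.pp (P.Tr 1) f vlist2) j = (if j \<in> set vlist2 then f j * 0 else 0)"
    by (rule C.additive_pp[OF psi_kernel(1) co_additive(2)]) (erule Tr(1), use t(2) distinct_vlist2 in auto)
  moreover have "coA (C.pp (Q.Tr 1) g vlist2) j = (if j \<in> set vlist2 then g j * 0 else 0)"
    by (rule C.additive_pp[OF psi_kernel(1) co_additive(1)]) (erule Tr(2), use t(3) distinct_vlist2 in auto)
  moreover have "coB (C.pp (Q.Tr 1) g vlist2) j = (if j \<in> set vlist2 then g j * - 1 else 0)"
    by (rule C.additive_pp[OF psi_kernel(1) co_additive(2)]) (erule Tr(2), erule t(4), rule distinct_vlist2)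
  moreover have "coA (zC [^]\<^bsub>C_grp\<^esub> k) j = 0" "coB (zC [^]\<^bsub>C_grp\<^esub> k) j = 0"
    unfolding coA_def coB_def F_zC_pow by simp_all
  ultimately show "coA n j = - f j" "coB n j = - g j"
    unfolding n_def using X Y Z j by (simp_all add: co_mult set_vlist2)
qed

text \<open>The permutation, and after it all exponents of translations, are determined by the
  image. What is left is a power of \<open>zC\<close>, whose exponent is visible in the central
  coordinate.\<close>

lemma F_injective:
  assumes "c \<in> carrier C_grp" "F c = \<one>\<^bsub>MM\<^esub>"
  shows "c = \<one>\<^bsub>C_grp\<^esub>"
proof -
  obtain \<sigma> n where c: "\<sigma> permutes {1..18}" "n \<in> NC" "c = s \<sigma> \<otimes>\<^bsub>C_grp\<^esub> n"
    using C_decompose[OF assms(1)] by blast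
  obtain f g and k :: int where n: "n = C.pp (P.Tr 1) f vlist2 \<otimes>\<^bsub>C_grp\<^esub> (C.pp (Q.Tr 1) g vlist2 \<otimes>\<^bsub>C_grp\<^esub> zC [^]\<^bsub>C_grp\<^esub> k)"
    using NC_normal_form[OF c(2)] by blast
  note pn = pp_coords[where f = f and g = g and k = k, folded n]
  have "psi c = id" using assms(2) by (simp add: psi_def MM_simps)
  then have "\<sigma> = id" using c pn(1,2) s_closed[OF c(1)] by (simp add: psi_mult psi_s)
  then have cn: "c = n" using c(3) pn(1) by simp
  have "f j = 0" "g j = 0" if "j \<in> {2..18}" for j
    using pn(3,4)[OF that] assms(2) by (simp_all add: cn[symmetric] coA_def coB_def MM_simps heis_simps)
  then have "C.pp (P.Tr 1) f vlist2 = \<one>\<^bsub>C_grp\<^esub>" "C.pp (Q.Tr 1) g vlist2 = \<one>\<^bsub>C_grp\<^esub>"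
    by (auto intro!: C.pp_zero simp: set_vlist2)
  then have "c = zC [^]\<^bsub>C_grp\<^esub> k" using cn n zC_closed by simp
  with assms(2) F_zC_pow[of k] show ?thesis by (simp add: MM_simps heis_simps)
qed

lemma F_image:
  "F ` carrier C_grp = {(\<sigma>, a, b, c) \<in> carrier MM. (\<Sum>i\<in>{1..18}. a i) = 0 \<and> (\<Sum>i\<in>{1..18}. b i) = 0}" (is "_ = ?M")
proof
  show "F ` carrier C_grp \<subseteq> ?M"
  proof
    fix x assume "x \<in> F ` carrier C_grp"
    then obtain c where "c \<in> carrier C_grp" "x = F c" by blast
    then show "x \<in> ?M" using F_sum_zero[of c] F.hom_closed[of c]
      by (cases "F c") (auto simp: coA_def coB_def)
  qed
  show "?M \<subseteq> F ` carrier C_grp"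
  proof
    fix x assume x: "x \<in> ?M"
    obtain \<sigma> a b c where xe: "x = (\<sigma>, a, b, c)" by (metis prod.exhaust)
    have \<sigma>: "\<sigma> permutes {1..18}" and sup: "\<And>i. i \<notin> {1..18} \<Longrightarrow> a i = 0 \<and> b i = 0"
      and sum: "(\<Sum>i\<in>{1..18}. a i) = 0" "(\<Sum>i\<in>{1..18}. b i) = 0"
      using x unfolding xe by (auto simp: MM_simps heis_simps)
    have sc: "s \<sigma> \<in> carrier C_grp" using \<sigma> by simp
    \<comment> \<open>The exponents offset the coordinates of \<open>s \<sigma>\<close>: by the sign
      in \<open>pp_coords\<close> the product \<open>n \<otimes> s \<sigma>\<close> has coordinates
      \<open>a\<close> and \<open>b\<close> at the vertices from 2 on. The sums settle vertex
      1.\<close>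
    define n where "n = C.pp (P.Tr 1) (\<lambda>i. coA (s \<sigma>) i - a i) vlist2 \<otimes>\<^bsub>C_grp\<^esub>
      (C.pp (Q.Tr 1) (\<lambda>i. coB (s \<sigma>) i - b i) vlist2 \<otimes>\<^bsub>C_grp\<^esub> zC [^]\<^bsub>C_grp\<^esub> (0::int))"
    note pn = pp_coords[where f = "\<lambda>i. coA (s \<sigma>) i - a i" and g = "\<lambda>i. coB (s \<sigma>) i - b i" and k = 0, folded n_def]
    define g where "g = n \<otimes>\<^bsub>C_grp\<^esub> s \<sigma>"
    have gc: "g \<in> carrier C_grp" and pg: "psi g = \<sigma>"
      using pn(1,2) sc by (simp_all add: g_def psi_mult psi_s[OF \<sigma>])
    have co2: "coA g i = a i" "coB g i = b i" if "i \<in> {2..18}" for i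
      using pn(1,2) pn(3,4)[OF that] sc by (simp_all add: g_def co_mult)
    have V: "{1..18::nat} = insert 1 {2..18}" by auto
    have co1: "coA g 1 = a 1" "coB g 1 = b 1"
      using F_sum_zero[OF gc] sum co2 unfolding V by simp_all
    have co0: "coA g i = a i" "coB g i = b i" if "i \<notin> {1..18}" for i
      using F.hom_closed[OF gc] sup[OF that] that by (cases "F g"; auto simp: MM_simps heis_simps coA_def coB_def)+
    have "coA g i = a i \<and> coB g i = b i" for i
      using co0[of i] co1 co2[of i] V by (cases "i \<in> {1..18}") auto
    then have "coA g = a" "coB g = b" by auto
    then obtain c' where Fg: "F g = (\<sigma>, a, b, c')"
      using pg by (cases "F g") (auto simp: coA_def coB_def psi_def)
    \<comment> \<open>The exponent is \<open>c' - c\<close> and not its negative because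
      \<open>zC\<close> has central coordinate -1.\<close>
    have "F (zC [^]\<^bsub>C_grp\<^esub> (c' - c) \<otimes>\<^bsub>C_grp\<^esub> g) = x"
      using gc zC_closed by (simp add: F_zC_pow Fg xe MM_simps heis_simps)
    moreover have "zC [^]\<^bsub>C_grp\<^esub> (c' - c) \<otimes>\<^bsub>C_grp\<^esub> g \<in> carrier C_grp" using gc zC_closed by simp
    ultimately show "x \<in> F ` carrier C_grp" by blast
  qed
qed

end

text \<open>The interface to the rest: from here on the families of lifts disappear, and every claim
  about \<open>C_grp\<close> becomes a computation with coordinates of sum zero.\<close>

lemma C_iso_sum_zero:
  obtains F where "C_model F" "inj_on F (carrier C_grp)"
    "F ` carrier C_grp = {(\<sigma>, a, b, c) \<in> carrier MM. (\<Sum>i\<in>{1..18}. a i) = 0 \<and> (\<Sum>i\<in>{1..18}. b i) = 0}"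
proof -
  obtain F where F: "F \<in> hom C_grp MM" "\<And>j. j \<in> {1..27} \<Longrightarrow> F (uC j) = uval j" by (rule C_hom_MM) blast
  then interpret C_model F by unfold_locales
  obtain P where P: "lift_family C_grp {1..18} s P" "P 6 14 = uC 12" by (rule path_lift_exists)
  obtain Q where Q: "lift_family C_grp {1..18} s Q" "Q 1 13 = uC 2" by (rule chord_lift_exists)
  interpret P: lift_family C_grp "{1..18}" s P by (rule P(1))
  interpret Q: lift_family C_grp "{1..18}" s Q by (rule Q(1))
  interpret C_families F P Q using P(2) Q(2) by unfold_locales
  have "inj_on F (carrier C_grp)" unfolding F.inj_on_one_iff using F_injective by blast
  with F_image show thesis using that[OF C_model_axioms] by blast
qed

section \<open>Structure of the group\<close>

locale C_iso_model = C_model +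
  assumes F_inj: "inj_on F (carrier C_grp)"
    and F_img: "F ` carrier C_grp = {(\<sigma>, a, b, c) \<in> carrier MM. (\<Sum>i\<in>{1..18}. a i) = 0 \<and> (\<Sum>i\<in>{1..18}. b i) = 0}"
begin

lemma F_eqI: "\<lbrakk>c \<in> carrier C_grp; d \<in> carrier C_grp; F c = F d\<rbrakk> \<Longrightarrow> c = d"
  using F_inj by (auto dest: inj_onD)

lemma F_onto:
  assumes "\<sigma> permutes {1..18}" "\<And>i. i \<notin> {1..18} \<Longrightarrow> a i = 0 \<and> b i = 0"
    and "(\<Sum>i\<in>{1..18}. a i) = 0" "(\<Sum>i\<in>{1..18}. b i) = 0"
  obtains c where "c \<in> carrier C_grp" "F c = (\<sigma>, a, b, k)"
proof -
  have "(\<sigma>, a, b, k) \<in> F ` carrier C_grp" unfolding F_img using assms by (simp add: MM_simps heis_simps)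
  then show thesis using that by (metis imageE)
qed

lemma coords_outside:
  assumes "c \<in> carrier C_grp" "i \<notin> {1..18}" shows "coA c i = 0" "coB c i = 0"
  using F.hom_closed[OF assms(1)] assms(2)
  by (cases "F c"; auto simp: MM_simps heis_simps coA_def coB_def)+

text \<open>The cocycle vanishes on \<open>T0\<close>, so its edges act as plain permutation
  matrices. With injectivity of the model this makes \<open>psi\<close> injective on the subgroup
  they generate.\<close>

lemma F_T0:
  assumes "q \<in> generate C_grp (uC ` T0)" shows "F q = (psi q, \<one>\<^bsub>heis\<^esub>)"
proof -
  have T0: "T0 \<subseteq> {1..27}" by (simp add: T0_def)
  have sub: "uC ` T0 \<subseteq> carrier C_grp" using T0 uC_closed by blast
  have u: "F (uC j) = (psi (uC j), \<one>\<^bsub>heis\<^esub>)" if "j \<in> T0" for j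
  proof -
    have "hm j = 0" "hn j = 0" using that by (auto simp: T0_def hm_def hn_def)
    moreover have "j \<in> {1..27}" using T0 that by blast
    ultimately show ?thesis using F_u[of j] by (simp add: psi_def uval_def lift_transp_def heis_simps fun_eq_iff)
  qed
  have one: "hperm \<sigma> \<one>\<^bsub>heis\<^esub> = \<one>\<^bsub>heis\<^esub>" for \<sigma> by (simp add: heis_simps hperm_simp comp_def)
  have mult: "F (c \<otimes>\<^bsub>C_grp\<^esub> d) = (psi (c \<otimes>\<^bsub>C_grp\<^esub> d), \<one>\<^bsub>heis\<^esub>)"
    if "c \<in> carrier C_grp" "d \<in> carrier C_grp" "F c = (psi c, \<one>\<^bsub>heis\<^esub>)" "F d = (psi d, \<one>\<^bsub>heis\<^esub>)" for c d
    using that by (simp add: MM_simps one psi_mult)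
  show ?thesis
  proof (rule C.generate_closed_under_mult[OF assms sub])
    show "F \<one>\<^bsub>C_grp\<^esub> = (psi \<one>\<^bsub>C_grp\<^esub>, \<one>\<^bsub>heis\<^esub>)" by (simp add: psi_one MM_simps)
    fix u' g assume *: "u' \<in> uC ` T0" "g \<in> carrier C_grp" "F g = (psi g, \<one>\<^bsub>heis\<^esub>)"
    then obtain j where j: "j \<in> T0" "u' = uC j" by blast
    then have j': "j \<in> {1..27}" using T0 by blast
    show "F (u' \<otimes>\<^bsub>C_grp\<^esub> g) = (psi (u' \<otimes>\<^bsub>C_grp\<^esub> g), \<one>\<^bsub>heis\<^esub>)"
      unfolding j(2) by (rule mult[OF uC_closed[OF j'] *(2) u[OF j(1)] *(3)])
    moreover have "inv\<^bsub>C_grp\<^esub> u' = u'" using j j' by (simp add: C.inv_equality)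
    ultimately show "F (inv\<^bsub>C_grp\<^esub> u' \<otimes>\<^bsub>C_grp\<^esub> g) = (psi (inv\<^bsub>C_grp\<^esub> u' \<otimes>\<^bsub>C_grp\<^esub> g), \<one>\<^bsub>heis\<^esub>)" by simp
  qed
qed

lemma T0_closed: "q \<in> generate C_grp (uC ` T0) \<Longrightarrow> q \<in> carrier C_grp"
proof -
  have "uC ` T0 \<subseteq> carrier C_grp" using uC_closed by (auto simp: T0_def)
  then show "q \<in> generate C_grp (uC ` T0) \<Longrightarrow> q \<in> carrier C_grp" by (rule C.generate_in_carrier)
qed

lemma psi_T0: "psi ` generate C_grp (uC ` T0) = carrier (sym_group 18)"
proof (rule psi_generate_tree)
  let ?es = "[(1,5),(5,8),(8,16),(16,14),(16,15),(15,13),(14,6),(6,4),(14,18),(18,10),(18,17),(17,9),(10,3),(3,2),(10,12),(12,11),(11,7)] :: (nat \<times> nat) list"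
  show "T0 \<subseteq> {1..27}" by (simp add: T0_def)
  show "grows {1} ?es" by simp
  show "insert 1 (snd ` set ?es) = {1..18}" unfolding vertices_eq_path by (auto simp: path_vertices_def)
  have "\<forall>(a, b)\<in>set ?es. \<exists>j\<in>T0. edgeT j = {a, b}"
    by (simp add: T0_def edgeT_def edge_list_def doubleton_eq_iff)
  then show "\<exists>j\<in>T0. edgeT j = {a, b}" if "(a, b) \<in> set ?es" for a b using that by blast
qed

lemma T0_complement:
  defines "K \<equiv> {c \<in> carrier C_grp. psi c = id}" and "Q \<equiv> generate C_grp (uC ` T0)"
  shows "bij_betw psi Q (carrier (sym_group 18))" "Q \<inter> K = {\<one>\<^bsub>C_grp\<^esub>}" "Q <#>\<^bsub>C_grp\<^esub> K = carrier C_grp"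
proof -
  have Qc: "q \<in> carrier C_grp" "F q = (psi q, \<one>\<^bsub>heis\<^esub>)" if "q \<in> Q" for q
    using that T0_closed F_T0 unfolding Q_def by auto
  have inj: "inj_on psi Q" by (rule inj_onI) (metis Qc F_eqI)
  then show "bij_betw psi Q (carrier (sym_group 18))" using psi_T0 by (simp add: bij_betw_def Q_def)
  show "Q \<inter> K = {\<one>\<^bsub>C_grp\<^esub>}"
  proof -
    have one: "\<one>\<^bsub>C_grp\<^esub> \<in> Q" by (simp add: Q_def generate.one)
    have "q = \<one>\<^bsub>C_grp\<^esub>" if "q \<in> Q" "psi q = id" for q
      using inj that one psi_one by (metis inj_onD)
    then show ?thesis using one psi_one C.one_closed unfolding K_def by blast
  qed
  show "Q <#>\<^bsub>C_grp\<^esub> K = carrier C_grp"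
  proof
    show "Q <#>\<^bsub>C_grp\<^esub> K \<subseteq> carrier C_grp"
      using Qc(1) C.m_closed unfolding set_mult_def K_def by blast
    show "carrier C_grp \<subseteq> Q <#>\<^bsub>C_grp\<^esub> K"
    proof
      fix c assume c: "c \<in> carrier C_grp"
      then have "psi c \<in> psi ` Q" using psi_T0 psi_permutes by (simp add: Q_def sym_group_carrier)
      then obtain q where q: "q \<in> Q" "psi q = psi c" by (metis imageE)
      let ?k = "inv\<^bsub>C_grp\<^esub> q \<otimes>\<^bsub>C_grp\<^esub> c"
      have "psi (inv\<^bsub>C_grp\<^esub> q) \<circ> psi q = id"
        using psi_mult[of "inv\<^bsub>C_grp\<^esub> q" q] Qc(1)[OF q(1)] by (simp add: psi_one)
      then have "psi ?k = id" using Qc(1)[OF q(1)] c q by (simp add: psi_mult)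
      moreover have "c = q \<otimes>\<^bsub>C_grp\<^esub> ?k" using Qc(1)[OF q(1)] c by (simp add: C.inv_mult_cancel)
      ultimately show "c \<in> Q <#>\<^bsub>C_grp\<^esub> K"
        using q(1) Qc(1)[OF q(1)] c unfolding set_mult_def K_def by blast
    qed
  qed
qed

lemma F_coords: "F c = (psi c, coA c, coB c, snd (snd (snd (F c))))"
  by (simp add: psi_def coA_def coB_def)

text \<open>Taken as a preimage with central coordinate 1, and not as the commutator found earlier,
  so that it corresponds to \<open>zH\<close>.\<close>

definition zeta :: "nat word set" where
  "zeta = inv_into (carrier C_grp) F (id, \<lambda>_. 0, \<lambda>_. 0, 1)"

lemma zeta: "zeta \<in> carrier C_grp" "F zeta = (id, \<lambda>_. 0, \<lambda>_. 0, 1)"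
proof -
  have "(id, \<lambda>_. 0, \<lambda>_. 0, 1) \<in> F ` carrier C_grp"
    unfolding F_img by (simp add: MM_simps heis_simps permutes_id)
  then show "zeta \<in> carrier C_grp" "F zeta = (id, \<lambda>_. 0, \<lambda>_. 0, 1)"
    unfolding zeta_def by (rule inv_into_into, rule f_inv_into_f)
qed

lemma F_zeta_pow: "F (zeta [^]\<^bsub>C_grp\<^esub> (k::int)) = (id, \<lambda>_. 0, \<lambda>_. 0, k)"
  using F.hom_int_pow[OF zeta(1)] zeta(2) by (simp add: MM_central_pow)

lemma generate_zeta:
  "generate C_grp {zeta} = {c \<in> carrier C_grp. psi c = id \<and> (\<forall>i. coA c i = 0 \<and> coB c i = 0)}"
proof -
  have "generate C_grp {zeta} = range (\<lambda>k::int. zeta [^]\<^bsub>C_grp\<^esub> k)"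
    using C.generate_pow[OF zeta(1)] by auto
  also have "\<dots> = {c \<in> carrier C_grp. psi c = id \<and> (\<forall>i. coA c i = 0 \<and> coB c i = 0)}" (is "_ = ?R")
  proof
    show "range (\<lambda>k::int. zeta [^]\<^bsub>C_grp\<^esub> k) \<subseteq> ?R"
      using C.int_pow_closed[OF zeta(1)] by (auto simp: psi_def coA_def coB_def F_zeta_pow simp del: F.hom_int_pow)
    show "?R \<subseteq> range (\<lambda>k::int. zeta [^]\<^bsub>C_grp\<^esub> k)"
    proof
      fix c assume c: "c \<in> ?R"
      then have "coA c = (\<lambda>_. 0)" "coB c = (\<lambda>_. 0)" by auto
      then have "F c = F (zeta [^]\<^bsub>C_grp\<^esub> (snd (snd (snd (F c)))))"
        using F_coords[of c] c unfolding F_zeta_pow by simp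
      then have "c = zeta [^]\<^bsub>C_grp\<^esub> (snd (snd (snd (F c))))"
        using c C.int_pow_closed[OF zeta(1)] by (intro F_eqI) auto
      then show "c \<in> range (\<lambda>k::int. zeta [^]\<^bsub>C_grp\<^esub> k)" by blast
    qed
  qed
  finally show ?thesis .
qed

lemma infinite_generate_zeta: "infinite (generate C_grp {zeta})"
proof -
  have "inj (\<lambda>k::int. zeta [^]\<^bsub>C_grp\<^esub> k)"
  proof (rule injI)
    fix k l :: int assume "zeta [^]\<^bsub>C_grp\<^esub> k = zeta [^]\<^bsub>C_grp\<^esub> l"
    then have "F (zeta [^]\<^bsub>C_grp\<^esub> k) = F (zeta [^]\<^bsub>C_grp\<^esub> l)" by (rule arg_cong)
    then show "k = l" unfolding F_zeta_pow by simp
  qed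
  then have "infinite (range (\<lambda>k::int. zeta [^]\<^bsub>C_grp\<^esub> k))"
    using finite_imageD infinite_UNIV_int by blast
  moreover have "generate C_grp {zeta} = range (\<lambda>k::int. zeta [^]\<^bsub>C_grp\<^esub> k)"
    using C.generate_pow[OF zeta(1)] by auto
  ultimately show ?thesis by simp
qed

text \<open>Commuting with the plain permutation matrices, all of which lie in the image of the
  model, forces the permutation of a central element to be trivial and its coordinates to be
  constant; zero sums then make them vanish.\<close>

lemma center_C: "group_center C_grp = generate C_grp {zeta}"
proof
  show "generate C_grp {zeta} \<subseteq> group_center C_grp"
  proof
    fix c assume "c \<in> generate C_grp {zeta}"
    then have c: "c \<in> carrier C_grp" "psi c = id" "coA c = (\<lambda>_. 0)" "coB c = (\<lambda>_. 0)"
      unfolding generate_zeta by auto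
    then obtain k where Fc: "F c = (id, \<lambda>_. 0, \<lambda>_. 0, k)" using F_coords[of c] by metis
    have "c \<otimes>\<^bsub>C_grp\<^esub> d = d \<otimes>\<^bsub>C_grp\<^esub> c" if d: "d \<in> carrier C_grp" for d
    proof (rule F_eqI)
      obtain \<sigma> a b l where Fd: "F d = (\<sigma>, a, b, l)" by (metis prod.exhaust)
      show "F (c \<otimes>\<^bsub>C_grp\<^esub> d) = F (d \<otimes>\<^bsub>C_grp\<^esub> c)"
        using c(1) d by (simp add: Fc Fd MM_simps heis_simps hperm_simp comp_def)
    qed (use c d in auto)
    then show "c \<in> group_center C_grp" using c by (simp add: group_center_def)
  qed
  show "group_center C_grp \<subseteq> generate C_grp {zeta}"
  proof
    fix c assume "c \<in> group_center C_grp"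
    then have c: "c \<in> carrier C_grp" and cen: "\<And>d. d \<in> carrier C_grp \<Longrightarrow> c \<otimes>\<^bsub>C_grp\<^esub> d = d \<otimes>\<^bsub>C_grp\<^esub> c"
      by (auto simp: group_center_def)
    have perm: "psi c \<circ> \<sigma> = \<sigma> \<circ> psi c \<and> coA c i = coA c (inv_into UNIV \<sigma> i) \<and> coB c i = coB c (inv_into UNIV \<sigma> i)"
      if \<sigma>: "\<sigma> permutes {1..18}" for \<sigma> i
    proof -
      obtain g where g: "g \<in> carrier C_grp" "F g = (\<sigma>, \<lambda>_. 0, \<lambda>_. 0, 0)"
        by (rule F_onto[of \<sigma> "\<lambda>_. 0" "\<lambda>_. 0" 0]) (use \<sigma> in auto)
      have g': "psi g = \<sigma>" "coA g i = 0" "coB g i = 0" for i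
        using g(2) by (simp_all add: psi_def coA_def coB_def)
      have eq: "c \<otimes>\<^bsub>C_grp\<^esub> g = g \<otimes>\<^bsub>C_grp\<^esub> c" by (rule cen[OF g(1)])
      show ?thesis
        using arg_cong[OF eq, of psi] arg_cong[OF eq, of "\<lambda>x. coA x i"] arg_cong[OF eq, of "\<lambda>x. coB x i"]
        by (simp add: psi_mult co_mult g' c g(1))
    qed
    have "psi c i = i" for i
    proof (rule ccontr)
      assume ne: "psi c i \<noteq> i"
      then have i: "i \<in> {1..18}" "psi c i \<in> {1..18}"
        using psi_permutes[OF c] by (auto simp: permutes_def permutes_in_image[OF psi_permutes[OF c]] simp del: atLeastAtMost_iff)
      \<comment> \<open>Swapping \<open>psi c i\<close> with a third vertex \<open>m\<close> fixes
        \<open>i\<close>, so one order of composition sends \<open>i\<close> to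
        \<open>psi c i\<close> and the other to \<open>m\<close>.\<close>
      obtain m where m: "m \<in> {1..18}" "m \<notin> set [i, psi c i]"
        by (rule C.fresh_element[of "{1..18}" "[i, psi c i]"]) auto
      have "(psi c \<circ> transpose (psi c i) m) i = (transpose (psi c i) m \<circ> psi c) i"
        using perm[of "transpose (psi c i) m"] i m by (simp add: permutes_swap_id del: atLeastAtMost_iff)
      then show False using ne m by (simp add: transpose_def)
    qed
    then have "psi c = id" by auto
    moreover have "coA c i = 0 \<and> coB c i = 0" for i
    proof (cases "i \<in> {1..18}")
      case True
      have "coA c j = coA c i" "coB c j = coB c i" if "j \<in> {1..18}" for j
        using perm[OF permutes_swap_id[OF that True], of j] by simp_all
      \<comment> \<open>A constant family has sum 18 times its value, and this sum is zero.\<close>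
      then have "(\<Sum>j\<in>{1..18}. coA c j) = (\<Sum>j\<in>{1..18::nat}. coA c i)" "(\<Sum>j\<in>{1..18}. coB c j) = (\<Sum>j\<in>{1..18::nat}. coB c i)"
        by (auto intro!: sum.cong simp del: sum_constant)
      then show ?thesis using F_sum_zero[OF c] by simp
    next
      case False
      then show ?thesis using coords_outside[OF c] by blast
    qed
    ultimately show "c \<in> generate C_grp {zeta}" unfolding generate_zeta using c by blast
  qed
qed

text \<open>Forgetting the central coordinate is a homomorphism on the kernel, and a vector of sum
  zero on 18 vertices is free in 17 entries. Two such vectors account for the rank 34.\<close>

lemma kernel_mod_center:
  defines "K \<equiv> {c \<in> carrier C_grp. psi c = id}"
  shows "(C_grp\<lparr>carrier := K\<rparr>) Mod (generate C_grp {zeta}) \<cong> Zn 34"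
proof -
  \<comment> \<open>Positions 0 to 16 hold the x-entries and positions 17 to 33 the y-entries of the
    vertices 2 to 18, hence the shifts by 2 and by 15.\<close>
  define \<kappa> where "\<kappa> c = (\<lambda>i. if i < 17 then coA c (i + 2) else if i < 34 then coB c (i - 15) else 0)" for c
  have V: "{1..18::nat} = insert 1 {2..18}" by auto
  have Zn: "group (Zn 34)"
  proof (rule groupI, goal_cases)
    case (5 x)
    then show ?case by (intro bexI[of _ "\<lambda>i. - x i"]) (auto simp: Zn_def)
  qed (auto simp: Zn_def fun_eq_iff)
  have KG: "group (C_grp\<lparr>carrier := K\<rparr>)"
    unfolding K_def using psi_kernel(1) by (rule C.subgroup_imp_group)
  have hom: "\<kappa> \<in> hom (C_grp\<lparr>carrier := K\<rparr>) (Zn 34)"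
    by (rule homI) (auto simp: Zn_def \<kappa>_def K_def co_mult intro!: ext)
  interpret \<kappa>: group_hom "C_grp\<lparr>carrier := K\<rparr>" "Zn 34" \<kappa>
    using Zn KG hom by (simp add: group_hom_def group_hom_axioms_def)
  have ker: "kernel (C_grp\<lparr>carrier := K\<rparr>) (Zn 34) \<kappa> = generate C_grp {zeta}"
  proof
    show "generate C_grp {zeta} \<subseteq> kernel (C_grp\<lparr>carrier := K\<rparr>) (Zn 34) \<kappa>"
      unfolding generate_zeta by (auto simp: kernel_def K_def Zn_def \<kappa>_def)
    show "kernel (C_grp\<lparr>carrier := K\<rparr>) (Zn 34) \<kappa> \<subseteq> generate C_grp {zeta}"
    proof
      fix c assume "c \<in> kernel (C_grp\<lparr>carrier := K\<rparr>) (Zn 34) \<kappa>"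
      then have c: "c \<in> carrier C_grp" "psi c = id" and 0: "\<And>i. \<kappa> c i = 0"
        by (auto simp: kernel_def K_def Zn_def)
      have 2: "coA c i = 0" "coB c i = 0" if i: "i \<in> {2..18}" for i
      proof -
        obtain k where "i = k + 2" using i le_Suc_ex[of 2 i] by (auto simp: add.commute)
        then show "coA c i = 0" "coB c i = 0"
          using 0[of k] 0[of "k + 17"] i by (auto simp: \<kappa>_def)
      qed
      have 1: "coA c 1 = 0" "coB c 1 = 0" using F_sum_zero[OF c(1)] 2 unfolding V by simp_all
      have "coA c i = 0 \<and> coB c i = 0" for i
        using 1 2[of i] coords_outside[OF c(1), of i] V by (cases "i \<in> {1..18}") auto
      then show "c \<in> generate C_grp {zeta}" unfolding generate_zeta using c by blast
    qed
  qed
  have "\<kappa> ` carrier (C_grp\<lparr>carrier := K\<rparr>) = carrier (Zn 34)"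
  proof
    show "\<kappa> ` carrier (C_grp\<lparr>carrier := K\<rparr>) \<subseteq> carrier (Zn 34)" using \<kappa>.hom_closed by blast
    show "carrier (Zn 34) \<subseteq> \<kappa> ` carrier (C_grp\<lparr>carrier := K\<rparr>)"
    proof
      fix v assume "v \<in> carrier (Zn 34)"
      then have v: "\<And>i. i \<ge> 34 \<Longrightarrow> v i = 0" by (simp add: Zn_def)
      define a where "a i = (if i \<in> {2..18} then v (i - 2) else if i = 1 then - (\<Sum>j\<in>{2..18}. v (j - 2)) else 0)" for i
      define b where "b i = (if i \<in> {2..18} then v (i + 15) else if i = 1 then - (\<Sum>j\<in>{2..18}. v (j + 15)) else 0)" for i
      have sum: "(\<Sum>i\<in>{1..18}. a i) = 0" "(\<Sum>i\<in>{1..18}. b i) = 0"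
        unfolding V by (simp_all add: a_def b_def)
      obtain c where c: "c \<in> carrier C_grp" "F c = (id, a, b, 0)"
        by (rule F_onto[of id a b 0]) (use sum in \<open>auto simp: permutes_id a_def b_def\<close>)
      then have "coA c = a" "coB c = b" "psi c = id" by (simp_all add: coA_def coB_def psi_def)
      then have "\<kappa> c i = v i" for i
        using v[of i] by (auto simp: \<kappa>_def a_def b_def)
      then have "\<kappa> c = v" by auto
      then show "v \<in> \<kappa> ` carrier (C_grp\<lparr>carrier := K\<rparr>)" using c \<open>psi c = id\<close> by (auto simp: K_def)
    qed
  qed
  from \<kappa>.FactGroup_iso[OF this] show ?thesis by (simp add: ker)
qed

end

section \<open>Comparison with the presented Heisenberg group\<close>

lemma Z2_simps: "carrier Z2 = UNIV" "\<one>\<^bsub>Z2\<^esub> = (0, 0)" "(a, b) \<otimes>\<^bsub>Z2\<^esub> (c, d) = (a + c, b + d)"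
  by (simp_all add: Z2_def)

lemma Z2_group: "group Z2"
proof (rule groupI, goal_cases)
  case (5 x)
  then show ?case by (intro bexI[of _ "(- fst x, - snd x)"]) (auto simp: Z2_def case_prod_unfold)
qed (auto simp: Z2_def)

locale C_H_model = C_iso_model +
  fixes \<theta>
  assumes \<theta>_iso: "\<theta> \<in> iso H_grp heis"
    and \<theta>_gens: "\<And>i. i \<in> {1..18} \<Longrightarrow> \<theta> (xH i) = hval (HX i) \<and> \<theta> (yH i) = hval (HY i)" "\<theta> zH = hval HZ"
    and \<theta>_hact: "\<And>\<sigma> h. \<sigma> permutes {1..18} \<Longrightarrow> h \<in> carrier H_grp \<Longrightarrow>
       hact \<sigma> h \<in> carrier H_grp \<and> \<theta> (hact \<sigma> h) = hperm \<sigma> (\<theta> h)"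
begin

sublocale \<theta>: group_hom H_grp heis \<theta>
  using \<theta>_iso by unfold_locales (simp add: iso_def)

lemma \<theta>_bij: "bij_betw \<theta> (carrier H_grp) (carrier heis)"
  using \<theta>_iso by (simp add: iso_def)

lemma \<theta>_eqI: "\<lbrakk>g \<in> carrier H_grp; h \<in> carrier H_grp; \<theta> g = \<theta> h\<rbrakk> \<Longrightarrow> g = h"
  using \<theta>_bij by (auto simp: bij_betw_def dest: inj_onD)

definition hsum :: "hgen word set \<Rightarrow> int \<times> int" where
  "hsum h = (\<Sum>i\<in>{1..18}. fst (\<theta> h) i, \<Sum>i\<in>{1..18}. fst (snd (\<theta> h)) i)"

lemma hsum_is_ab: "is_ab hsum"
proof -
  have "hsum \<in> hom H_grp Z2"
    by (rule homI) (simp_all add: Z2_simps hsum_def heis_coords sum.distrib)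
  then show ?thesis
    unfolding is_ab_def hsum_def by (simp add: \<theta>_gens[simplified])
qed

lemma is_ab_unique:
  assumes "is_ab ab" "h \<in> carrier H_grp"
  shows "ab h = hsum h"
proof (rule hom_eq_on_generate[OF H.group_axioms Z2_group])
  show "ab \<in> hom H_grp Z2" "hsum \<in> hom H_grp Z2" using assms(1) hsum_is_ab by (simp_all add: is_ab_def)
  show "h \<in> generate H_grp (pgen SH relH ` SH)"
    using assms(2) presented_group_generate[of SH relH] by (simp add: H_grp_def)
  show "pgen SH relH ` SH \<subseteq> carrier H_grp" by (auto simp: H_grp_def)
  fix u assume "u \<in> pgen SH relH ` SH"
  then obtain g where g: "g \<in> SH" "u = pgen SH relH g" by blast
  from g(1) show "ab u = hsum u"
    unfolding g(2)
    by (cases rule: SH_cases) (use assms(1) hsum_is_ab in \<open>auto simp: is_ab_def xH_def yH_def zH_def\<close>)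
qed

text \<open>The Heisenberg component of the model, transported back to \<open>H_grp\<close>. With
  \<open>psi\<close> it forms the two components of the semidirect product.\<close>

definition phi :: "nat word set \<Rightarrow> hgen word set" where
  "phi c = inv_into (carrier H_grp) \<theta> (snd (F c))"

lemma phi:
  assumes "c \<in> carrier C_grp"
  shows "phi c \<in> carrier H_grp" "\<theta> (phi c) = snd (F c)" "hsum (phi c) = (0, 0)"
proof -
  have "snd (F c) \<in> carrier heis" using F.hom_closed[OF assms] by (cases "F c") (simp add: MM_simps)
  then have "snd (F c) \<in> \<theta> ` carrier H_grp" using \<theta>_bij by (simp add: bij_betw_def)
  then show 1: "phi c \<in> carrier H_grp" "\<theta> (phi c) = snd (F c)"
    unfolding phi_def by (rule inv_into_into, rule f_inv_into_f)
  then show "hsum (phi c) = (0, 0)"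
    using F_sum_zero[OF assms] by (simp add: hsum_def coA_def coB_def)
qed

lemma phi_onto:
  assumes "\<sigma> permutes {1..18}" "h \<in> carrier H_grp" "hsum h = (0, 0)"
  obtains c where "c \<in> carrier C_grp" "psi c = \<sigma>" "phi c = h"
proof -
  obtain a b k where \<theta>h: "\<theta> h = (a, b, k)" by (metis prod.exhaust)
  have "(a, b, k) \<in> carrier heis" using \<theta>.hom_closed[OF assms(2)] \<theta>h by simp
  then have out: "\<And>i. i \<notin> {1..18} \<Longrightarrow> a i = 0 \<and> b i = 0" by (simp add: heis_simps)
  have sum: "(\<Sum>i\<in>{1..18}. a i) = 0" "(\<Sum>i\<in>{1..18}. b i) = 0" using assms(3) \<theta>h by (simp_all add: hsum_def)
  obtain c where c: "c \<in> carrier C_grp" "F c = (\<sigma>, a, b, k)" by (rule F_onto[OF assms(1) out sum])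
  have "phi c = h" using phi[OF c(1)] c(2) \<theta>h assms(2) by (intro \<theta>_eqI) simp_all
  with c that show thesis by (simp add: psi_def)
qed

text \<open>The multiplication of the model read in its second component; equivariance of
  \<open>\<theta>\<close> turns the permutation of coordinates into \<open>hact\<close>.\<close>

lemma phi_mult:
  assumes "c \<in> carrier C_grp" "d \<in> carrier C_grp"
  shows "phi (c \<otimes>\<^bsub>C_grp\<^esub> d) = phi c \<otimes>\<^bsub>H_grp\<^esub> hact (psi c) (phi d)"
proof (rule \<theta>_eqI)
  note h = \<theta>_hact[OF psi_permutes[OF assms(1)] phi(1)[OF assms(2)]]
  show "phi c \<otimes>\<^bsub>H_grp\<^esub> hact (psi c) (phi d) \<in> carrier H_grp" using phi(1)[OF assms(1)] h by simp
  have "\<theta> (phi c \<otimes>\<^bsub>H_grp\<^esub> hact (psi c) (phi d)) = snd (F c) \<otimes>\<^bsub>heis\<^esub> hperm (psi c) (snd (F d))"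
    using phi[OF assms(1)] phi[OF assms(2)] h by simp
  also have "\<dots> = snd (F c \<otimes>\<^bsub>MM\<^esub> F d)" by (cases "F c", cases "F d") (simp add: psi_def MM_simps)
  also have "\<dots> = snd (F (c \<otimes>\<^bsub>C_grp\<^esub> d))" using assms by simp
  finally show "\<theta> (phi (c \<otimes>\<^bsub>C_grp\<^esub> d)) = \<theta> (phi c \<otimes>\<^bsub>H_grp\<^esub> hact (psi c) (phi d))"
    using phi(2)[of "c \<otimes>\<^bsub>C_grp\<^esub> d"] assms by simp
qed (use phi(1) assms in simp)

lemma psi_phi_inj:
  assumes "c \<in> carrier C_grp" "d \<in> carrier C_grp" "psi c = psi d" "phi c = phi d"
  shows "c = d"
proof (rule F_eqI[OF assms(1,2)])
  have "snd (F c) = snd (F d)" using phi(2)[OF assms(1)] phi(2)[OF assms(2)] assms(4) by simp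
  with assms(3) show "F c = F d" by (simp add: psi_def prod_eq_iff)
qed

lemma semidirect_iso:
  "(\<lambda>c. (psi c, phi c)) \<in> iso C_grp
     (sdprod (sym_group 18) (H_grp\<lparr>carrier := {h \<in> carrier H_grp. hsum h = (0, 0)}\<rparr>) hact)" (is "?f \<in> iso _ ?S")
proof -
  have S: "carrier ?S = {\<sigma>. \<sigma> permutes {1..18}} \<times> {h \<in> carrier H_grp. hsum h = (0, 0)}"
    by (auto simp: sdprod_def sym_group_carrier)
  have hom: "?f \<in> hom C_grp ?S"
  proof (rule homI)
    fix c assume "c \<in> carrier C_grp"
    then show "?f c \<in> carrier ?S" unfolding S using psi_permutes phi by blast
  next
    fix c d assume "c \<in> carrier C_grp" "d \<in> carrier C_grp"
    then show "?f (c \<otimes>\<^bsub>C_grp\<^esub> d) = ?f c \<otimes>\<^bsub>?S\<^esub> ?f d"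
      by (simp add: sdprod_def sym_group_mult psi_mult phi_mult)
  qed
  moreover have "bij_betw ?f (carrier C_grp) (carrier ?S)"
  proof (rule bij_betw_imageI)
    show "inj_on ?f (carrier C_grp)" by (intro inj_onI psi_phi_inj) auto
    show "?f ` carrier C_grp = carrier ?S"
    proof
      show "?f ` carrier C_grp \<subseteq> carrier ?S" using hom by (auto simp: hom_def)
      show "carrier ?S \<subseteq> ?f ` carrier C_grp"
      proof
        fix x assume "x \<in> carrier ?S"
        then obtain \<sigma> h where x: "x = (\<sigma>, h)" "\<sigma> permutes {1..18}" "h \<in> carrier H_grp" "hsum h = (0, 0)"
          unfolding S by blast
        obtain c where "c \<in> carrier C_grp" "psi c = \<sigma>" "phi c = h" by (rule phi_onto[OF x(2-4)])
        then show "x \<in> ?f ` carrier C_grp" using x(1) by blast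
      qed
    qed
  qed
  ultimately show ?thesis by (simp add: iso_def)
qed

lemma kernel_iso:
  "C_grp\<lparr>carrier := {c \<in> carrier C_grp. psi c = id}\<rparr> \<cong> H_grp\<lparr>carrier := {h \<in> carrier H_grp. hsum h = (0, 0)}\<rparr>"
    (is "?K \<cong> ?H")
proof -
  have "hact id h = h" if "h \<in> carrier H_grp" for h
    using \<theta>_hact[OF permutes_id that] that by (intro \<theta>_eqI) simp_all
  then have "phi \<in> hom ?K ?H"
    using phi by (intro homI) (auto simp: phi_mult)
  moreover have "bij_betw phi (carrier ?K) (carrier ?H)"
  proof (rule bij_betw_imageI)
    show "inj_on phi (carrier ?K)" by (intro inj_onI psi_phi_inj) auto
    show "phi ` carrier ?K = carrier ?H"
    proof
      show "phi ` carrier ?K \<subseteq> carrier ?H" using phi by auto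
      show "carrier ?H \<subseteq> phi ` carrier ?K"
      proof
        fix h assume h: "h \<in> carrier ?H"
        obtain c where "c \<in> carrier C_grp" "psi c = id" "phi c = h"
          by (rule phi_onto[OF permutes_id, of h]) (use h in auto)
        then show "h \<in> phi ` carrier ?K" by force
      qed
    qed
  qed
  ultimately show ?thesis unfolding is_iso_def iso_def by blast
qed

lemma phi_zeta: "phi zeta = zH"
  using phi[OF zeta(1)] zeta(2) \<theta>_gens(2) by (intro \<theta>_eqI) simp_all

end

theorem theorem1p1:
  shows "(\<exists>\<psi>. is_psiC \<psi>) \<and> (\<exists>ab. is_ab ab) \<and>
    (\<forall>\<psi> ab. is_psiC \<psi> \<and> is_ab ab \<longrightarrow>
      (let K = kernel C_grp (sym_group 18) \<psi>;
           Q = generate C_grp (uC ` T0);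
           KH = kernel H_grp Z2 ab
       in
         \<comment> \<open>(i)\<close>
         \<psi> ` carrier C_grp = carrier (sym_group 18)
       \<and> bij_betw \<psi> Q (carrier (sym_group 18))
       \<and> K \<lhd> C_grp \<and> Q \<inter> K = {\<one>\<^bsub>C_grp\<^esub>} \<and> Q <#>\<^bsub>C_grp\<^esub> K = carrier C_grp
         \<comment> \<open>(ii)\<close>
       \<and> C_grp\<lparr>carrier := K\<rparr> \<cong> H_grp\<lparr>carrier := KH\<rparr>
       \<and> (\<exists>f. f \<in> iso C_grp (sdprod (sym_group 18) (H_grp\<lparr>carrier := KH\<rparr>) hact)
             \<and> (\<forall>c\<in>carrier C_grp. fst (f c) = \<psi> c)
         \<comment> \<open>(iii), with zeta the element of C corresponding to z\<close>
             \<and> (\<exists>\<zeta>\<in>carrier C_grp. f \<zeta> = (id, zH)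
                 \<and> \<zeta> \<in> K
                 \<and> infinite (generate C_grp {\<zeta>})
                 \<and> generate C_grp {\<zeta>} \<subseteq> group_center (C_grp\<lparr>carrier := K\<rparr>)
                 \<and> (C_grp\<lparr>carrier := K\<rparr>) Mod (generate C_grp {\<zeta>}) \<cong> Zn 34
                 \<and> group_center C_grp = generate C_grp {\<zeta>}))))"
proof -
  obtain F where F: "C_model F" "inj_on F (carrier C_grp)"
    "F ` carrier C_grp = {(\<sigma>, a, b, c) \<in> carrier MM. (\<Sum>i\<in>{1..18}. a i) = 0 \<and> (\<Sum>i\<in>{1..18}. b i) = 0}"
    by (rule C_iso_sum_zero)
  obtain \<theta> where \<theta>: "\<theta> \<in> iso H_grp heis"
    "\<And>i. i \<in> {1..18} \<Longrightarrow> \<theta> (xH i) = hval (HX i) \<and> \<theta> (yH i) = hval (HY i)" "\<theta> zH = hval HZ"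
    "\<And>\<sigma> h. \<sigma> permutes {1..18} \<Longrightarrow> h \<in> carrier H_grp \<Longrightarrow>
       hact \<sigma> h \<in> carrier H_grp \<and> \<theta> (hact \<sigma> h) = hperm \<sigma> (\<theta> h)"
    by (rule H_iso_heis) blast
  interpret C_H_model F \<theta>
    by (intro C_H_model.intro C_iso_model.intro C_iso_model_axioms.intro C_H_model_axioms.intro F \<theta>)
  have psi: "is_psiC psi" using psi_hom psi_u by (simp add: is_psiC_def)
  show ?thesis
  proof (intro conjI allI impI)
    show "\<exists>\<psi>. is_psiC \<psi>" using psi by blast
    show "\<exists>ab. is_ab ab" using hsum_is_ab by blast
    fix \<psi> ab assume *: "is_psiC \<psi> \<and> is_ab ab"
    \<comment> \<open>The conditions on \<open>\<psi>\<close> fix it on generators, hence on the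
      carrier, so the arbitrary \<open>\<psi>\<close> may be replaced by \<open>psi\<close>;
      likewise \<open>ab\<close> by \<open>hsum\<close>.\<close>
    have \<psi>: "\<psi> c = psi c" if "c \<in> carrier C_grp" for c
    proof (rule hom_eq_on_generate[OF C.group_axioms sym_group_is_group[of 18]])
      show "\<psi> \<in> hom C_grp (sym_group 18)" "psi \<in> hom C_grp (sym_group 18)"
        using * psi by (simp_all add: is_psiC_def)
      show "c \<in> generate C_grp (uC ` {1..27})" using that C_generate by blast
      show "uC ` {1..27} \<subseteq> carrier C_grp" using uC_closed by blast
      fix u assume "u \<in> uC ` {1..27}"
      then show "\<psi> u = psi u" using * psi unfolding is_psiC_def by (metis imageE)
    qed
    have K: "kernel C_grp (sym_group 18) \<psi> = {c \<in> carrier C_grp. psi c = id}"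
      using \<psi> by (auto simp: kernel_def sym_group_one)
    have KH: "kernel H_grp Z2 ab = {h \<in> carrier H_grp. hsum h = (0, 0)}"
      using is_ab_unique * by (auto simp: kernel_def Z2_simps)
    have bij: "bij_betw \<psi> (generate C_grp (uC ` T0)) (carrier (sym_group 18))"
      using T0_complement(1) \<psi> T0_closed by (subst bij_betw_cong[of _ \<psi> psi]) auto
    have surj: "\<psi> ` carrier C_grp = carrier (sym_group 18)"
    proof
      show "\<psi> ` carrier C_grp \<subseteq> carrier (sym_group 18)"
        using \<psi> psi_permutes by (auto simp: sym_group_carrier)
      show "carrier (sym_group 18) \<subseteq> \<psi> ` carrier C_grp"
        using bij_betw_imp_surj_on[OF bij] T0_closed by blast
    qed
    have cen: "generate C_grp {zeta} \<subseteq> group_center (C_grp\<lparr>carrier := {c \<in> carrier C_grp. psi c = id}\<rparr>)"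
    proof
      fix c assume c: "c \<in> generate C_grp {zeta}"
      then have "c \<in> group_center C_grp" using center_C by simp
      moreover have "psi c = id" using c unfolding generate_zeta by blast
      ultimately show "c \<in> group_center (C_grp\<lparr>carrier := {c \<in> carrier C_grp. psi c = id}\<rparr>)"
        unfolding group_center_def by simp
    qed
    have zid: "psi zeta = id" using zeta(2) by (simp add: psi_def)
    let ?f = "\<lambda>c. (psi c, phi c)"
    have "?f \<in> iso C_grp (sdprod (sym_group 18) (H_grp\<lparr>carrier := {h \<in> carrier H_grp. hsum h = (0, 0)}\<rparr>) hact) \<and>
      (\<forall>c\<in>carrier C_grp. fst (?f c) = \<psi> c) \<and>
      (\<exists>\<zeta>\<in>carrier C_grp. ?f \<zeta> = (id, zH) \<and> \<zeta> \<in> {c \<in> carrier C_grp. psi c = id} \<and>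
        infinite (generate C_grp {\<zeta>}) \<and>
        generate C_grp {\<zeta>} \<subseteq> group_center (C_grp\<lparr>carrier := {c \<in> carrier C_grp. psi c = id}\<rparr>) \<and>
        (C_grp\<lparr>carrier := {c \<in> carrier C_grp. psi c = id}\<rparr>) Mod (generate C_grp {\<zeta>}) \<cong> Zn 34 \<and>
        group_center C_grp = generate C_grp {\<zeta>})"
    proof (intro conjI bexI[of _ zeta])
      show "\<forall>c\<in>carrier C_grp. fst (?f c) = \<psi> c" using \<psi> by simp
      show "?f zeta = (id, zH)" by (simp add: zid phi_zeta)
      show "zeta \<in> {c \<in> carrier C_grp. psi c = id}" using zeta(1) zid by blast
    qed (rule semidirect_iso infinite_generate_zeta cen kernel_mod_center center_C zeta(1))+
    then show "let K = kernel C_grp (sym_group 18) \<psi>; Q = generate C_grp (uC ` T0); KH = kernel H_grp Z2 ab in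
        \<psi> ` carrier C_grp = carrier (sym_group 18)
       \<and> bij_betw \<psi> Q (carrier (sym_group 18))
       \<and> K \<lhd> C_grp \<and> Q \<inter> K = {\<one>\<^bsub>C_grp\<^esub>} \<and> Q <#>\<^bsub>C_grp\<^esub> K = carrier C_grp
       \<and> C_grp\<lparr>carrier := K\<rparr> \<cong> H_grp\<lparr>carrier := KH\<rparr>
       \<and> (\<exists>f. f \<in> iso C_grp (sdprod (sym_group 18) (H_grp\<lparr>carrier := KH\<rparr>) hact)
             \<and> (\<forall>c\<in>carrier C_grp. fst (f c) = \<psi> c)
             \<and> (\<exists>\<zeta>\<in>carrier C_grp. f \<zeta> = (id, zH)
                 \<and> \<zeta> \<in> K
                 \<and> infinite (generate C_grp {\<zeta>})
                 \<and> generate C_grp {\<zeta>} \<subseteq> group_center (C_grp\<lparr>carrier := K\<rparr>)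
                 \<and> (C_grp\<lparr>carrier := K\<rparr>) Mod (generate C_grp {\<zeta>}) \<cong> Zn 34
                 \<and> group_center C_grp = generate C_grp {\<zeta>}))"
      unfolding Let_def K KH
      by (intro conjI surj bij psi_kernel(2) T0_complement(2,3) kernel_iso exI[of _ ?f]) blast+
  qed
qed

end
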